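(* Suppose that for the operator family $P$ the adjoint $(D_{(g,\cdot)}P\,h)^*(k)$ exists, is smooth in $(g,h,k)$ and bilinear in $(h,k)$. Then the geodesic equation of the Riemannian metric $G^P$ on $\mathcal M(M)$ is $$g_{tt}=P_g^{-1}\Big[\tfrac12 (D_{(g,\cdot)}P\,g_t)^*(g_t)+\tfrac14\,g\operatorname{Tr}(g^{-1}P_gg_t\,g^{-1}g_t)+\tfrac12 g_tg^{-1}P_gg_t+\tfrac12 P_gg_t\,g^{-1}g_t-(D_{(g,g_t)}P)g_t-\tfrac12\operatorname{Tr}(g^{-1}g_t)P_gg_t\Big],$$ or equivalently $$(P_gg_t)_t=\tfrac12(D_{(g,\cdot)}P\,g_t)^*(g_t)+\tfrac14\,g\operatorname{Tr}(g^{-1}P_gg_t\,g^{-1}g_t)+\tfrac12 g_tg^{-1}P_gg_t+\tfrac12P_gg_t\,g^{-1}g_t-\tfrac12\operatorname{Tr}(g^{-1}g_t)P_gg_t .$$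
   Context: $M$ is a compact smooth manifold. $\mathcal M(M)=\Gamma(S^2_+T^*M)$ is the space of all smooth Riemannian metrics on $M$, an open convex subset of the Fréchet space $\Gamma(S^2T^*M)$ of smooth symmetric $\binom02$-tensor fields, so $T_g\mathcal M(M)=\Gamma(S^2T^*M)$. A $\binom02$-tensor is viewed as a map $TM\to T^*M$, $g^{-1}:T^*M\to TM$, and juxtaposition denotes composition; for symmetric $h,k$ one has $g^0_2(h,k)=\operatorname{Tr}(g^{-1}hg^{-1}k)$. $\operatorname{vol}(g)$ is the volume density of $g$. $D_{(g,m)}F$ denotes the directional derivative $\partial_t|_0F(g+tm)$. $P_g:\Gamma(S^2T^*M)\to\Gamma(S^2T^*M)$ is a positive, symmetric, bijective pseudo-differential operator of order $2p$, depending smoothly on $g$, and $G^P_g(h,k)=\int_M g^0_2(P_gh,k)\operatorname{vol}(g)$. The adjoint $(D_{(g,\cdot)}P\,h)^*(k)\in\Gamma(S^2T^*M)$ is defined by $$\int_M g^0_2\big((D_{(g,m)}P)h,k\big)\operatorname{vol}(g)=\int_M g^0_2\big(m,(D_{(g,\cdot)}P\,h)^*(k)\big)\operatorname{vol}(g)\quad\text{for all } m\in\Gamma(S^2T^*M).$$ Subscripts $t$ denote time derivatives along a path $t\mapsto g(t)\in\mathcal M(M)$. *)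

theory Defs
  imports "HOL-Analysis.Analysis" "HOL-Library.Function_Algebras"
begin

section \<open>Function spaces as real vector spaces\<close>

instantiation "fun" :: (type, scaleR) scaleR
begin

definition scaleR_fun :: "real \<Rightarrow> ('a \<Rightarrow> 'b) \<Rightarrow> 'a \<Rightarrow> 'b" where
  "scaleR_fun r f = (\<lambda>x. r *\<^sub>R f x)"

instance ..

end

instance "fun" :: (type, real_vector) real_vector
  by standard (auto simp: scaleR_fun_def fun_eq_iff scaleR_add_right scaleR_add_left)

definition linear_on_subspace :: "'v::real_vector set \<Rightarrow> ('v \<Rightarrow> 'w::real_vector) \<Rightarrow> bool" where
  "linear_on_subspace V f \<longleftrightarrow>
     (\<forall>h\<in>V. \<forall>k\<in>V. f (h + k) = f h + f k) \<and> (\<forall>r. \<forall>h\<in>V. f (r *\<^sub>R h) = r *\<^sub>R f h)"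


section \<open>Smooth maps between open subsets of Euclidean spaces\<close>

fun iter_partial ::
  "'v list \<Rightarrow> ('v::real_normed_vector \<Rightarrow> 'w::real_normed_vector) \<Rightarrow> 'v \<Rightarrow> 'w" where
  "iter_partial [] f = f"
| "iter_partial (v # vs) f = (\<lambda>x. frechet_derivative (iter_partial vs f) (at x) v)"

text \<open>Meant for open \<open>S\<close>; derivatives at a point of \<open>S\<close> then only depend on \<open>f\<close> near that point,
  so the values of \<open>f\<close> outside \<open>S\<close> are irrelevant.\<close>

definition smooth_on ::
  "'v::real_normed_vector set \<Rightarrow> ('v \<Rightarrow> 'w::real_normed_vector) \<Rightarrow> bool" where
  "smooth_on S f \<longleftrightarrow> (\<forall>vs. \<forall>x\<in>S. iter_partial vs f differentiable (at x))"


section \<open>Smooth maps between Frechet spaces\<close>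

text \<open>A topological vector space is given by a topology \<open>X\<close> on a linear subspace \<open>topspace X\<close> of a
  type of class \<open>real_vector\<close>.  The definition below is that of Michal--Bastiani and Hamilton:
  all iterated directional derivatives \<open>D\<^sup>k F(u){v\<^sub>1,...,v\<^sub>k}\<close> of \<open>F\<close> on the open set \<open>U\<close> exist and are
  jointly continuous in \<open>(u, v\<^sub>1, ..., v\<^sub>k)\<close>.  Here \<open>D (v # vs)\<close> is the directional derivative of
  \<open>D vs\<close> in direction \<open>v\<close>.  On Frechet spaces this agrees with smoothness in the sense of
  convenient calculus.\<close>

definition tvs_smooth ::
  "'v::real_vector topology \<Rightarrow> 'v set \<Rightarrow> 'w::real_vector topology \<Rightarrow> ('v \<Rightarrow> 'w) \<Rightarrow> bool" where
  "tvs_smooth X U Y F \<longleftrightarrow>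
     (\<exists>D :: 'v list \<Rightarrow> 'v \<Rightarrow> 'w.
        (\<forall>u\<in>U. D [] u = F u) \<and>
        (\<forall>vs\<in>lists (topspace X). \<forall>v\<in>topspace X. \<forall>u\<in>U.
           limitin Y (\<lambda>s::real. (1 / s) *\<^sub>R (D vs (u + s *\<^sub>R v) - D vs u)) (D (v # vs) u) (at 0)) \<and>
        (\<forall>k. continuous_map
               (prod_topology (subtopology X U) (product_topology (\<lambda>i::nat. X) {..<k})) Y
               (\<lambda>(u, f). D (map f [0..<k]) u)))"

definition tvs_deriv :: "'w::real_vector topology \<Rightarrow> (real \<Rightarrow> 'w) \<Rightarrow> real \<Rightarrow> 'w" where
  "tvs_deriv Y c t = (THE l. limitin Y (\<lambda>s. (1 / s) *\<^sub>R (c (t + s) - c t)) l (at 0))"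


section \<open>Compact smooth manifolds\<close>

text \<open>A chart is a pair of its domain and a coordinate map (whose values off the domain are
  irrelevant).  The manifold is the whole type \<open>'a\<close>; its dimension is \<open>CARD('n)\<close>.  Chart domains
  need not be connected.\<close>

type_synonym ('a, 'n) chart = "'a set \<times> ('a \<Rightarrow> real^'n)"

definition chart_range :: "('a, 'n) chart \<Rightarrow> (real^'n) set" where
  "chart_range c = snd c ` fst c"

definition chart_inv :: "('a, 'n) chart \<Rightarrow> real^'n \<Rightarrow> 'a" where
  "chart_inv c = inv_into (fst c) (snd c)"

definition is_chart :: "('a::topological_space, 'n::finite) chart \<Rightarrow> bool" where
  "is_chart c \<longleftrightarrow> open (fst c) \<and> open (chart_range c) \<and>
     homeomorphism (fst c) (chart_range c) (snd c) (chart_inv c)"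

definition charts_compatible ::
  "('a::topological_space, 'n::finite) chart \<Rightarrow> ('a, 'n) chart \<Rightarrow> bool" where
  "charts_compatible c d \<longleftrightarrow>
     smooth_on (snd c ` (fst c \<inter> fst d)) (snd d \<circ> chart_inv c) \<and>
     smooth_on (snd d ` (fst c \<inter> fst d)) (snd c \<circ> chart_inv d)"

text \<open>\<open>A\<close> is the maximal atlas.  Second countability follows from compactness.\<close>

definition compact_smooth_manifold :: "('a::t2_space, 'n::finite) chart set \<Rightarrow> bool" where
  "compact_smooth_manifold A \<longleftrightarrow>
     compact (UNIV :: 'a set) \<and>
     (\<forall>c\<in>A. is_chart c) \<and>
     (\<forall>c\<in>A. \<forall>d\<in>A. charts_compatible c d) \<and>
     (\<Union>c\<in>A. fst c) = UNIV \<and>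
     (\<forall>c. is_chart c \<and> (\<forall>d\<in>A. charts_compatible c d) \<longrightarrow> c \<in> A)"


section \<open>Symmetric tensor fields\<close>

text \<open>Each tangent space \<open>T\<^sub>xM\<close> is identified with \<open>real^'n\<close> by means of the coordinate basis of one
  chart \<open>chart_at A x\<close> around \<open>x\<close>, chosen once and for all for every point \<open>x\<close> (no continuity of
  this choice is involved).  A tensor of type (0,2) at \<open>x\<close>, viewed as a map from \<open>T\<^sub>xM\<close> to
  \<open>T\<^sub>x\<^sup>*M\<close>, is then a matrix.  The components of a tensor field in an arbitrary chart \<open>c\<close> are
  obtained by the tensor transformation rule, and smoothness is smoothness of these components
  in every chart.\<close>

type_synonym ('a, 'n) tensor_field = "'a \<Rightarrow> real^'n^'n"

definition chart_at :: "('a, 'n) chart set \<Rightarrow> 'a \<Rightarrow> ('a, 'n) chart" where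
  "chart_at A x = (SOME c. c \<in> A \<and> x \<in> fst c)"

definition components ::
  "('a, 'n::finite) chart set \<Rightarrow> ('a, 'n) chart \<Rightarrow> ('a, 'n) tensor_field \<Rightarrow> real^'n \<Rightarrow> real^'n^'n" where
  "components A c h y =
     (let x = chart_inv c y;
          J = matrix (frechet_derivative (snd (chart_at A x) \<circ> chart_inv c) (at y))
      in transpose J ** h x ** J)"

definition sym_tensor_fields :: "('a, 'n::finite) chart set \<Rightarrow> ('a, 'n) tensor_field set" where
  "sym_tensor_fields A =
     {h. (\<forall>x. transpose (h x) = h x) \<and> (\<forall>c\<in>A. smooth_on (chart_range c) (components A c h))}"

definition metrics :: "('a, 'n::finite) chart set \<Rightarrow> ('a, 'n) tensor_field set" where
  "metrics A = {g \<in> sym_tensor_fields A. \<forall>x v. v \<noteq> 0 \<longrightarrow> v \<bullet> (g x *v v) > 0}"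

text \<open>The Frechet topology: uniform convergence of all partial derivatives of the components on
  compact subsets of charts.\<close>

definition tensor_topology :: "('a, 'n::finite) chart set \<Rightarrow> ('a, 'n) tensor_field topology" where
  "tensor_topology A = topology_generated_by
     {{h \<in> sym_tensor_fields A.
         \<forall>y\<in>K. norm (iter_partial vs (components A c h) y - iter_partial vs (components A c u) y) < e}
      | c K vs u e. c \<in> A \<and> compact K \<and> K \<subseteq> chart_range c \<and> u \<in> sym_tensor_fields A \<and> e > 0}"

definition tensor_inner ::
  "('a, 'n::finite) tensor_field \<Rightarrow> ('a, 'n) tensor_field \<Rightarrow> ('a, 'n) tensor_field \<Rightarrow> 'a \<Rightarrow> real" where
  "tensor_inner g h k x = trace (matrix_inv (g x) ** h x ** matrix_inv (g x) ** k x)"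

text \<open>The measure of the volume density: in every chart it has density \<open>sqrt (det g\<^sub>i\<^sub>j)\<close>.\<close>

definition vol ::
  "('a::topological_space, 'n::finite) chart set \<Rightarrow> ('a, 'n) tensor_field \<Rightarrow> 'a measure" where
  "vol A g = (THE \<mu>. sets \<mu> = sets borel \<and>
     (\<forall>c\<in>A. \<forall>B\<in>sets borel. B \<subseteq> fst c \<longrightarrow>
        emeasure \<mu> B =
          (\<integral>\<^sup>+ y. ennreal (sqrt (det (components A c g y))) * indicator (snd c ` B) y \<partial>lborel)))"


section \<open>Pseudo-differential operators on symmetric tensor fields\<close>

text \<open>Symbols of class \<open>S\<^sup>m\<close> (type (1,0), uniform in \<open>x\<close>) and their quantization on compactly
  supported smooth functions.\<close>

definition symbol_class :: "real \<Rightarrow> ((real^'n::finite) \<times> (real^'n) \<Rightarrow> complex) \<Rightarrow> bool" where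
  "symbol_class m a \<longleftrightarrow> smooth_on UNIV a \<and>
     (\<forall>vs ws. \<exists>C. \<forall>x \<xi>.
        norm (iter_partial (map (\<lambda>v. (v, 0)) vs @ map (\<lambda>w. (0, w)) ws) a (x, \<xi>))
          \<le> C * (1 + norm \<xi>) powr (m - real (length ws)))"

definition fourier :: "(real^'n::finite \<Rightarrow> real) \<Rightarrow> real^'n \<Rightarrow> complex" where
  "fourier u \<xi> = (LINT y|lborel. cis (- (\<xi> \<bullet> y)) * complex_of_real (u y))"

definition quantize ::
  "((real^'n::finite) \<times> (real^'n) \<Rightarrow> complex) \<Rightarrow> (real^'n \<Rightarrow> real) \<Rightarrow> real^'n \<Rightarrow> complex" where
  "quantize a u x =
     (LINT \<xi>|lborel. cis (x \<bullet> \<xi>) * a (x, \<xi>) * fourier u \<xi>) / complex_of_real ((2 * pi) ^ CARD('n))"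

definition cutoff :: "('a, 'n::finite) chart \<Rightarrow> (real^'n \<Rightarrow> real) \<Rightarrow> bool" where
  "cutoff c \<theta> \<longleftrightarrow> smooth_on UNIV \<theta> \<and>
     (\<exists>K. compact K \<and> K \<subseteq> chart_range c \<and> (\<forall>y. y \<notin> K \<longrightarrow> \<theta> y = 0))"

definition cut_field ::
  "('a, 'n::finite) chart \<Rightarrow> (real^'n \<Rightarrow> real) \<Rightarrow> ('a, 'n) tensor_field \<Rightarrow> ('a, 'n) tensor_field" where
  "cut_field c \<theta> h = (\<lambda>x. if x \<in> fst c then \<theta> (snd c x) *\<^sub>R h x else 0)"

definition cut_component ::
  "('a, 'n::finite) chart set \<Rightarrow> ('a, 'n) chart \<Rightarrow> (real^'n \<Rightarrow> real) \<Rightarrow> ('a, 'n) tensor_field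
     \<Rightarrow> 'n \<Rightarrow> 'n \<Rightarrow> real^'n \<Rightarrow> real" where
  "cut_component A c \<theta> h i j y =
     (if y \<in> chart_range c then \<theta> y * components A c h y $ i $ j else 0)"

text \<open>Hoermander's definition (The Analysis of Linear Partial Differential Operators III,
  Definition 18.1.20): in every chart \<open>c\<close> and for all cutoffs \<open>\<theta>, \<theta>'\<close> the operator \<open>\<theta>' Q \<theta>\<close> is the
  quantization of a matrix of symbols of order \<open>m\<close>.  Since charts of the maximal atlas may have
  disconnected domains, this includes smoothness of the kernel off the diagonal.\<close>

definition pseudo_diff_op ::
  "('a, 'n::finite) chart set \<Rightarrow> real \<Rightarrow> (('a, 'n) tensor_field \<Rightarrow> ('a, 'n) tensor_field) \<Rightarrow> bool" where
  "pseudo_diff_op A m Q \<longleftrightarrow>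
     linear_on_subspace (sym_tensor_fields A) Q \<and>
     Q ` sym_tensor_fields A \<subseteq> sym_tensor_fields A \<and>
     (\<forall>c\<in>A. \<forall>\<theta> \<theta>'. cutoff c \<theta> \<and> cutoff c \<theta>' \<longrightarrow>
        (\<exists>a. (\<forall>i j k l. symbol_class m (a i j k l)) \<and>
             (\<forall>h\<in>sym_tensor_fields A. \<forall>y i j.
                complex_of_real (cut_component A c \<theta>' (Q (cut_field c \<theta> h)) i j y) =
                (\<Sum>k\<in>UNIV. \<Sum>l\<in>UNIV. quantize (a i j k l) (cut_component A c \<theta> h k l) y))))"


section \<open>The Riemannian metric \<open>G\<^sup>P\<close> and its geodesics\<close>

definition metric_GP ::
  "('a::topological_space, 'n::finite) chart set
     \<Rightarrow> (('a, 'n) tensor_field \<Rightarrow> ('a, 'n) tensor_field \<Rightarrow> ('a, 'n) tensor_field)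
     \<Rightarrow> ('a, 'n) tensor_field \<Rightarrow> ('a, 'n) tensor_field \<Rightarrow> ('a, 'n) tensor_field \<Rightarrow> real" where
  "metric_GP A P g h k = (LINT x|vol A g. tensor_inner g (P g h) k x)"

text \<open>Positivity and symmetry of \<open>P g\<close> refer to the \<open>L\<^sup>2\<close>-inner product given by \<open>g\<close>.\<close>

definition admissible_operator_family ::
  "('a::topological_space, 'n::finite) chart set \<Rightarrow> real
     \<Rightarrow> (('a, 'n) tensor_field \<Rightarrow> ('a, 'n) tensor_field \<Rightarrow> ('a, 'n) tensor_field) \<Rightarrow> bool" where
  "admissible_operator_family A m P \<longleftrightarrow>
     (\<forall>g\<in>metrics A.
        pseudo_diff_op A m (P g) \<and>
        bij_betw (P g) (sym_tensor_fields A) (sym_tensor_fields A) \<and>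
        (\<forall>h\<in>sym_tensor_fields A. \<forall>k\<in>sym_tensor_fields A.
           (LINT x|vol A g. tensor_inner g (P g h) k x) =
           (LINT x|vol A g. tensor_inner g h (P g k) x)) \<and>
        (\<forall>h\<in>sym_tensor_fields A. h \<noteq> 0 \<longrightarrow> (LINT x|vol A g. tensor_inner g (P g h) h x) > 0)) \<and>
     tvs_smooth (prod_topology (tensor_topology A) (tensor_topology A))
       (metrics A \<times> sym_tensor_fields A) (tensor_topology A) (\<lambda>(g, h). P g h)"

definition D_operator ::
  "('a, 'n::finite) chart set
     \<Rightarrow> (('a, 'n) tensor_field \<Rightarrow> ('a, 'n) tensor_field \<Rightarrow> ('a, 'n) tensor_field)
     \<Rightarrow> ('a, 'n) tensor_field \<Rightarrow> ('a, 'n) tensor_field \<Rightarrow> ('a, 'n) tensor_field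
     \<Rightarrow> ('a, 'n) tensor_field" where
  "D_operator A P g m h = tvs_deriv (tensor_topology A) (\<lambda>t. P (g + t *\<^sub>R m) h) 0"

text \<open>\<open>Adj g h k\<close> is \<open>(D\<^sub>(\<^sub>g\<^sub>,\<^sub>.\<^sub>)P h)\<^sup>*(k)\<close>.\<close>

definition is_adjoint_of_D ::
  "('a::topological_space, 'n::finite) chart set
     \<Rightarrow> (('a, 'n) tensor_field \<Rightarrow> ('a, 'n) tensor_field \<Rightarrow> ('a, 'n) tensor_field)
     \<Rightarrow> (('a, 'n) tensor_field \<Rightarrow> ('a, 'n) tensor_field \<Rightarrow> ('a, 'n) tensor_field
         \<Rightarrow> ('a, 'n) tensor_field) \<Rightarrow> bool" where
  "is_adjoint_of_D A P Adj \<longleftrightarrow>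
     (\<forall>g\<in>metrics A. \<forall>h\<in>sym_tensor_fields A. \<forall>k\<in>sym_tensor_fields A.
        Adj g h k \<in> sym_tensor_fields A \<and>
        (\<forall>m\<in>sym_tensor_fields A.
           (LINT x|vol A g. tensor_inner g (D_operator A P g m h) k x) =
           (LINT x|vol A g. tensor_inner g m (Adj g h k) x)))"

definition smooth_metric_path ::
  "('a, 'n::finite) chart set \<Rightarrow> real set \<Rightarrow> (real \<Rightarrow> ('a, 'n) tensor_field) \<Rightarrow> bool" where
  "smooth_metric_path A J g \<longleftrightarrow>
     tvs_smooth euclidean J (tensor_topology A) g \<and> (\<forall>t\<in>J. g t \<in> metrics A)"

definition path_energy ::
  "('a, 'n::finite) chart set
     \<Rightarrow> (('a, 'n) tensor_field \<Rightarrow> ('a, 'n) tensor_field \<Rightarrow> ('a, 'n) tensor_field \<Rightarrow> real)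
     \<Rightarrow> real \<Rightarrow> real \<Rightarrow> (real \<Rightarrow> ('a, 'n) tensor_field) \<Rightarrow> real" where
  "path_energy A G a b g =
     1/2 * integral {a..b} (\<lambda>t. G (g t) (tvs_deriv (tensor_topology A) g t)
                                        (tvs_deriv (tensor_topology A) g t))"

text \<open>A geodesic is a smooth path which is a critical point of the energy, on each compact
  subinterval of its domain \<open>J\<close>, among smooth variations with fixed end points.\<close>

definition is_geodesic ::
  "('a, 'n::finite) chart set
     \<Rightarrow> (('a, 'n) tensor_field \<Rightarrow> ('a, 'n) tensor_field \<Rightarrow> ('a, 'n) tensor_field \<Rightarrow> real)
     \<Rightarrow> real set \<Rightarrow> (real \<Rightarrow> ('a, 'n) tensor_field) \<Rightarrow> bool" where
  "is_geodesic A G J g \<longleftrightarrow>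
     smooth_metric_path A J g \<and>
     (\<forall>a b. a < b \<and> {a..b} \<subseteq> J \<longrightarrow>
       (\<forall>\<epsilon>>0. \<forall>\<gamma> :: real \<times> real \<Rightarrow> ('a, 'n) tensor_field.
          tvs_smooth euclidean ({-\<epsilon><..<\<epsilon>} \<times> J) (tensor_topology A) \<gamma> \<and>
          (\<forall>s\<in>{-\<epsilon><..<\<epsilon>}. \<forall>t\<in>J. \<gamma> (s, t) \<in> metrics A) \<and>
          (\<forall>t\<in>J. \<gamma> (0, t) = g t) \<and>
          (\<forall>s\<in>{-\<epsilon><..<\<epsilon>}. \<gamma> (s, a) = g a \<and> \<gamma> (s, b) = g b)
          \<longrightarrow> ((\<lambda>s. path_energy A G a b (\<lambda>t. \<gamma> (s, t))) has_real_derivative 0) (at 0)))"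

end

theory Submission
  imports Defs
begin

text \<open>Geodesics are the critical points of the energy \<open>1/2 \<integral> \<langle>P\<^sub>g g\<^sub>t, g\<^sub>t\<rangle>\<^sub>g dt\<close>, where \<open>\<langle>h, k\<rangle>\<^sub>g\<close> is the integral of
  \<open>Tr (g\<^sup>-\<^sup>1 h g\<^sup>-\<^sup>1 k)\<close> against the volume of \<open>g\<close>.  For a variation with field \<open>m\<close> the integrand depends on \<open>g\<close>
  in four places: through the operator, which gives \<open>\<langle>(D\<^sub>m P) g\<^sub>t, g\<^sub>t\<rangle>\<close> and hence the adjoint term; through
  the two inverse metrics, which give the products \<open>g\<^sub>t g\<^sup>-\<^sup>1 P g\<^sub>t\<close> and \<open>P g\<^sub>t g\<^sup>-\<^sup>1 g\<^sub>t\<close>; through the volume density,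
  which gives traces by Jacobi's formula; and through \<open>g\<^sub>t\<close>, which by symmetry of \<open>P\<close> gives \<open>2 \<langle>P g\<^sub>t, m\<^sub>t\<rangle>\<close>.
  The last term is integrated by parts in time; differentiating \<open>\<langle>P g\<^sub>t, m\<rangle>\<close> produces the momentum equation's
  \<open>(P g\<^sub>t)\<^sub>t\<close> and the same kind of metric terms with \<open>g\<^sub>t\<close> in place of \<open>m\<close>.  Altogether
  (\<open>variation_identity\<close>, \<open>first_variation\<close>) the derivative of the energy is \<open>\<integral> \<langle>X, m\<rangle> dt\<close>, where \<open>X\<close> is the
  right-hand side of the equation minus \<open>(P g\<^sub>t)\<^sub>t\<close>.

  If \<open>X = 0\<close> the path is critical.  Conversely, variations \<open>g + s \<phi>(t) h\<close> with a bump function \<open>\<phi>\<close> force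
  \<open>\<langle>X, h\<rangle> = 0\<close> for every \<open>h\<close> and every time (\<open>geodesic_iff_momentum\<close>).  The pairing is non-degenerate since
  \<open>P\<close> is positive and onto (\<open>ip_nondegenerate\<close>); this uses that \<open>X\<close> is again a smooth symmetric field.  The
  form solved for \<open>g\<^sub>t\<^sub>t\<close> follows from \<open>(P g\<^sub>t)\<^sub>t = (D\<^bsub>g\<^sub>t\<^esub>P) g\<^sub>t + P g\<^sub>t\<^sub>t\<close> and bijectivity of \<open>P\<close>
  (\<open>momentum_iff_acceleration\<close>).

  The analysis behind this calculation is of three kinds.  The volume measure is glued from charts by the
  change of variables formula; on a fixed reference measure, varying the metric only changes the
  integrand, so that integrals over the compact manifold may be differentiated under the integral sign
  (\<open>vol_density\<close>, \<open>ip_has_derivative\<close>).  Convergence in the Frechet space is uniform convergence of all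
  partial derivatives in charts (\<open>limitin_TT\<close>).  Finally \<open>P\<close> obeys a chain rule along differentiable
  paths, by the mean value theorem applied to each coordinate functional (\<open>P_chain\<close>).\<close>


section \<open>Calculus of smooth functions\<close>

lemma frechet_derivative_cong_open:
  assumes "open S" "x \<in> S" "\<And>y. y \<in> S \<Longrightarrow> f y = g y"
  shows "f differentiable (at x) \<longleftrightarrow> g differentiable (at x)"
    and "frechet_derivative f (at x) = frechet_derivative g (at x)"
proof -
  have eq: "(f has_derivative f') (at x) \<longleftrightarrow> (g has_derivative f') (at x)" for f'
    using has_derivative_transform_within_open[of f f' x UNIV S g]
      has_derivative_transform_within_open[of g f' x UNIV S f] assms by auto
  show "f differentiable (at x) \<longleftrightarrow> g differentiable (at x)"
    using eq by (simp add: differentiable_def)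
  show "frechet_derivative f (at x) = frechet_derivative g (at x)"
    using eq by (simp add: frechet_derivative_def)
qed

lemma iter_partial_append:
  "iter_partial (vs @ [v]) f = iter_partial vs (\<lambda>x. frechet_derivative f (at x) v)"
  by (induction vs) auto

lemma smooth_onD: "smooth_on S f \<Longrightarrow> x \<in> S \<Longrightarrow> iter_partial vs f differentiable (at x)"
  by (simp add: smooth_on_def)

lemma smooth_on_differentiable: "smooth_on S f \<Longrightarrow> x \<in> S \<Longrightarrow> f differentiable (at x)"
  using smooth_onD[of S f x "[]"] by simp

lemma smooth_on_continuous_iter:
  "smooth_on S f \<Longrightarrow> continuous_on S (iter_partial vs f)"
  by (intro differentiable_imp_continuous_on)
     (auto simp: differentiable_on_def smooth_on_def intro: differentiable_at_withinI)

lemma iter_partial_add: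
  assumes "open S" "smooth_on S f" "smooth_on S g"
  shows "x \<in> S \<Longrightarrow> iter_partial vs (\<lambda>x. f x + g x) x = iter_partial vs f x + iter_partial vs g x"
proof (induction vs arbitrary: x)
  case (Cons v vs)
  have "frechet_derivative (iter_partial vs (\<lambda>x. f x + g x)) (at x)
      = frechet_derivative (\<lambda>x. iter_partial vs f x + iter_partial vs g x) (at x)"
    using Cons by (intro frechet_derivative_cong_open(2)[OF assms(1)]) auto
  also have "\<dots> = (\<lambda>v. frechet_derivative (iter_partial vs f) (at x) v + frechet_derivative (iter_partial vs g) (at x) v)"
    by (rule sym, rule frechet_derivative_at, rule has_derivative_add)
       (use assms Cons.prems in \<open>auto simp: smooth_on_def frechet_derivative_works[symmetric]\<close>)
  finally show ?case by simp
qed simp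

lemma iter_partial_scaleR:
  assumes "open S" "smooth_on S f"
  shows "x \<in> S \<Longrightarrow> iter_partial vs (\<lambda>x. r *\<^sub>R f x) x = r *\<^sub>R iter_partial vs f x"
proof (induction vs arbitrary: x)
  case (Cons v vs)
  have "frechet_derivative (iter_partial vs (\<lambda>x. r *\<^sub>R f x)) (at x)
      = frechet_derivative (\<lambda>x. r *\<^sub>R iter_partial vs f x) (at x)"
    using Cons by (intro frechet_derivative_cong_open(2)[OF assms(1)]) auto
  also have "\<dots> = (\<lambda>v. r *\<^sub>R frechet_derivative (iter_partial vs f) (at x) v)"
    by (rule sym, rule frechet_derivative_at, rule has_derivative_scaleR_right)
       (use assms Cons.prems in \<open>auto simp: smooth_on_def frechet_derivative_works[symmetric]\<close>)
  finally show ?case by simp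
qed simp

text \<open>Closure of smooth functions under products and matrix inversion is proved by induction on the
  order of differentiability.  A finite order is needed in the induction, since the derivative of
  \<open>x \<mapsto> (f x)\<^sup>-\<^sup>1\<close> contains \<open>(f x)\<^sup>-\<^sup>1\<close> again.\<close>

fun Ck :: "nat \<Rightarrow> 'v::real_normed_vector set \<Rightarrow> ('v \<Rightarrow> 'w::real_normed_vector) \<Rightarrow> bool" where
  "Ck 0 S f \<longleftrightarrow> True"
| "Ck (Suc n) S f \<longleftrightarrow> (\<forall>x\<in>S. f differentiable (at x)) \<and>
     (\<forall>v. Ck n S (\<lambda>x. frechet_derivative f (at x) v))"

text \<open>\<open>iter_partial\<close> adds derivatives on the outside; peeling off the innermost one instead turns
  smoothness into a recursion on the function.\<close>

lemma smooth_on_rec: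
  "smooth_on S f \<longleftrightarrow> (\<forall>x\<in>S. f differentiable (at x)) \<and>
     (\<forall>v. smooth_on S (\<lambda>x. frechet_derivative f (at x) v))"
proof (intro iffI conjI ballI allI)
  assume *: "(\<forall>x\<in>S. f differentiable (at x)) \<and> (\<forall>v. smooth_on S (\<lambda>x. frechet_derivative f (at x) v))"
  show "smooth_on S f"
    unfolding smooth_on_def
  proof (intro allI ballI)
    fix vs x assume "x \<in> S"
    then show "iter_partial vs f differentiable (at x)"
      using * by (cases vs rule: rev_cases) (auto simp: iter_partial_append smooth_on_def)
  qed
qed (auto simp: smooth_on_def iter_partial_append[symmetric] intro: smooth_on_differentiable)

lemma smooth_on_iff_Ck: "smooth_on S f \<longleftrightarrow> (\<forall>n. Ck n S f)"
proof
  show "\<forall>n. Ck n S f" if "smooth_on S f"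
  proof
    fix n show "Ck n S f" using that
    proof (induction n arbitrary: f)
      case (Suc n)
      then show ?case using smooth_on_rec[of S f] by auto
    qed simp
  qed
  assume *: "\<forall>n. Ck n S f"
  have "iter_partial vs f differentiable (at x)" if "x \<in> S" "Ck (Suc (length vs)) S f" for vs x
    using that by (induction vs arbitrary: f rule: rev_induct) (auto simp: iter_partial_append)
  with * show "smooth_on S f" by (auto simp: smooth_on_def)
qed

lemma Ck_cong:
  assumes "open S" "\<And>x. x \<in> S \<Longrightarrow> f x = g x" "Ck n S f"
  shows "Ck n S g"
  using assms(2,3)
proof (induction n arbitrary: f g)
  case (Suc n)
  have d: "frechet_derivative f (at x) = frechet_derivative g (at x)" "g differentiable at x" if "x \<in> S" for x
    using frechet_derivative_cong_open[OF assms(1) that, of f g] Suc.prems that by auto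
  have "Ck n S (\<lambda>x. frechet_derivative g (at x) v)" for v
    using Suc.prems d by (rule_tac Suc.IH[of "\<lambda>x. frechet_derivative f (at x) v"]) auto
  with d show ?case by auto
qed simp

lemma Ck_SucD: "Ck (Suc n) S f \<Longrightarrow> Ck n S f"
proof (induction n arbitrary: f)
  case (Suc n) then show ?case by (metis Ck.simps(2))
qed simp

lemma Ck_SucI:
  assumes "open S" "\<And>x. x \<in> S \<Longrightarrow> (f has_derivative f' x) (at x)" "\<And>v. Ck n S (\<lambda>x. f' x v)"
  shows "Ck (Suc n) S f"
proof -
  have "f' x = frechet_derivative f (at x)" if "x \<in> S" for x
    using assms(2)[OF that] by (rule frechet_derivative_at)
  then have "Ck n S (\<lambda>x. frechet_derivative f (at x) v)" for v
    by (intro Ck_cong[OF assms(1) _ assms(3)[of v]]) simp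
  then show ?thesis using assms(2) by (auto intro: differentiableI)
qed

lemma Ck_derivative:
  assumes "Ck (Suc n) S f" "x \<in> S"
  shows "(f has_derivative frechet_derivative f (at x)) (at x)"
  using assms by (simp add: frechet_derivative_works[symmetric])

lemma Ck_const: "Ck n S (\<lambda>x. c)"
proof (induction n arbitrary: c)
  case (Suc n)
  then show ?case by (simp add: frechet_derivative_const)
qed simp

lemma Ck_add:
  assumes "open S" "Ck n S f" "Ck n S g"
  shows "Ck n S (\<lambda>x. f x + g x)"
  using assms(2,3)
proof (induction n arbitrary: f g)
  case (Suc n)
  have "Ck n S (\<lambda>x. frechet_derivative f (at x) v)" "Ck n S (\<lambda>x. frechet_derivative g (at x) v)" for v
    using Suc.prems by simp_all
  from Suc.IH[OF this] show ?case
    by (intro Ck_SucI[OF assms(1), where f' = "\<lambda>x v. frechet_derivative f (at x) v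
      + frechet_derivative g (at x) v"] has_derivative_add
      Ck_derivative[OF Suc.prems(1)] Ck_derivative[OF Suc.prems(2)])
qed simp

lemma Ck_bounded_linear:
  assumes "bounded_linear L" "open S" "Ck n S f"
  shows "Ck n S (\<lambda>x. L (f x))"
  using assms(3)
proof (induction n arbitrary: f)
  case (Suc n)
  have "Ck n S (\<lambda>x. frechet_derivative f (at x) v)" for v using Suc.prems by simp
  from Suc.IH[OF this] show ?case
    by (intro Ck_SucI[OF assms(2), where f' = "\<lambda>x v. L (frechet_derivative f (at x) v)"]
      bounded_linear.has_derivative[OF assms(1)] Ck_derivative[OF Suc.prems])
qed simp

lemma Ck_bilinear:
  assumes "bounded_bilinear m" "open S" "Ck n S f" "Ck n S g"
  shows "Ck n S (\<lambda>x. m (f x) (g x))"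
  using assms(3,4)
proof (induction n arbitrary: f g)
  case (Suc n)
  have "Ck n S (\<lambda>x. frechet_derivative g (at x) v)" for v using Suc.prems(2) by simp
  from Suc.IH[OF Ck_SucD[OF Suc.prems(1)] this]
  have 1: "Ck n S (\<lambda>x. m (f x) (frechet_derivative g (at x) v))" for v .
  have "Ck n S (\<lambda>x. frechet_derivative f (at x) v)" for v using Suc.prems(1) by simp
  from Suc.IH[OF this Ck_SucD[OF Suc.prems(2)]]
  have 2: "Ck n S (\<lambda>x. m (frechet_derivative f (at x) v) (g x))" for v .
  show ?case
  proof (rule Ck_SucI[OF assms(2), where f' = "\<lambda>x v. m (f x) (frechet_derivative g (at x) v)
            + m (frechet_derivative f (at x) v) (g x)"])
    show "((\<lambda>x. m (f x) (g x)) has_derivative (\<lambda>v. m (f x) (frechet_derivative g (at x) v)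
            + m (frechet_derivative f (at x) v) (g x))) (at x)" if "x \<in> S" for x
      by (rule bounded_bilinear.FDERIV[OF assms(1) Ck_derivative[OF Suc.prems(1) that]
            Ck_derivative[OF Suc.prems(2) that]])
    show "Ck n S (\<lambda>x. m (f x) (frechet_derivative g (at x) v)
            + m (frechet_derivative f (at x) v) (g x))" for v
      by (rule Ck_add[OF assms(2) 1 2])
  qed
qed simp

lemma smooth_on_cong:
  assumes "open S" "\<And>x. x \<in> S \<Longrightarrow> f x = g x" "smooth_on S f"
  shows "smooth_on S g"
  unfolding smooth_on_iff_Ck
proof
  show "Ck n S g" for n
    using Ck_cong[OF assms(1), of f g n] assms(2,3) by (simp add: smooth_on_iff_Ck)
qed

lemma smooth_on_add:
  assumes "open S" "smooth_on S f" "smooth_on S g"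
  shows "smooth_on S (\<lambda>x. f x + g x)"
  unfolding smooth_on_iff_Ck
proof
  show "Ck n S (\<lambda>x. f x + g x)" for n
    by (rule Ck_add[OF assms(1)]) (use assms(2,3) in \<open>simp_all add: smooth_on_iff_Ck\<close>)
qed

lemma smooth_on_bounded_linear:
  assumes "bounded_linear L" "open S" "smooth_on S f"
  shows "smooth_on S (\<lambda>x. L (f x))"
  unfolding smooth_on_iff_Ck
proof
  show "Ck n S (\<lambda>x. L (f x))" for n
    by (rule Ck_bounded_linear[OF assms(1,2)]) (use assms(3) in \<open>simp add: smooth_on_iff_Ck\<close>)
qed

lemma smooth_on_bilinear:
  assumes "bounded_bilinear m" "open S" "smooth_on S f" "smooth_on S g"
  shows "smooth_on S (\<lambda>x. m (f x) (g x))"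
  unfolding smooth_on_iff_Ck
proof
  show "Ck n S (\<lambda>x. m (f x) (g x))" for n
    by (rule Ck_bilinear[OF assms(1,2)]) (use assms(3,4) in \<open>simp_all add: smooth_on_iff_Ck\<close>)
qed

section \<open>Matrices\<close>

lemma bounded_bilinear_matrix_mult:
  "bounded_bilinear ((**) :: real^'n^'m \<Rightarrow> real^'k^'n \<Rightarrow> real^'k^'m)"
  unfolding bilinear_conv_bounded_bilinear[symmetric] bilinear_def
  by (auto intro!: linearI simp: matrix_matrix_mult_def vec_eq_iff sum.distrib
        sum_distrib_left algebra_simps)

lemmas matrix_mult_linear =
  bounded_bilinear.add_left[OF bounded_bilinear_matrix_mult] bounded_bilinear.add_right[OF bounded_bilinear_matrix_mult]
  bounded_bilinear.diff_left[OF bounded_bilinear_matrix_mult] bounded_bilinear.diff_right[OF bounded_bilinear_matrix_mult]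
  bounded_bilinear.minus_left[OF bounded_bilinear_matrix_mult] bounded_bilinear.minus_right[OF bounded_bilinear_matrix_mult]
  bounded_bilinear.scaleR_left[OF bounded_bilinear_matrix_mult] bounded_bilinear.scaleR_right[OF bounded_bilinear_matrix_mult]

lemma matrix_vector_mul_bounded_bilinear:
  "bounded_bilinear ((*v) :: real^'n^'m \<Rightarrow> real^'n \<Rightarrow> real^'m)"
  unfolding bilinear_conv_bounded_bilinear[symmetric] bilinear_def
  by (auto intro!: linearI simp: matrix_vector_mult_def vec_eq_iff sum.distrib
        sum_distrib_left algebra_simps)

lemmas has_derivative_matrix_mult = bounded_bilinear.FDERIV[OF bounded_bilinear_matrix_mult]
lemmas continuous_on_matrix_mult [continuous_intros] =
  bounded_bilinear.continuous_on[OF bounded_bilinear_matrix_mult]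

lemma bounded_linear_trace: "bounded_linear (trace :: real^'n^'n \<Rightarrow> real)"
  by (intro linear_conv_bounded_linear[THEN iffD1] linearI)
     (auto simp: trace_def sum.distrib sum_distrib_left)

lemma matrix_inv_works:
  assumes "invertible A"
  shows "A ** matrix_inv A = mat 1" "matrix_inv A ** A = mat 1"
  using someI_ex[OF assms[unfolded invertible_def]] unfolding matrix_inv_def by auto

lemma matrix_inv_unique:
  fixes A B :: "real^'n^'n"
  assumes "A ** B = mat 1"
  shows "invertible A" "matrix_inv A = B"
proof -
  show inv: "invertible A" using assms by (auto simp: invertible_right_inverse)
  have "matrix_inv A ** (A ** B) = B"
    by (simp add: matrix_mul_assoc matrix_inv_works[OF inv])
  then show "matrix_inv A = B" using assms by simp
qed

lemma entry_has_derivative: "((\<lambda>A::real^'n^'m. A $ i $ j) has_derivative (\<lambda>H. H $ i $ j)) (at A within S)"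
  by (rule bounded_linear_imp_has_derivative)
     (rule bounded_linear_compose[OF bounded_linear_vec_nth bounded_linear_vec_nth])

text \<open>In the Leibniz expansion only the identity permutation contributes: any other permutation moves
  at least two indices, so a vanishing off-diagonal entry survives after one factor has been
  differentiated.\<close>

lemma has_derivative_det_mat_1:
  "(det has_derivative (trace :: real^'n^'n \<Rightarrow> real)) (at (mat 1))"
proof -
  let ?D = "\<lambda>(A::real^'n^'n) H. \<Sum>p\<in>{p. p permutes (UNIV::'n set)}. of_int (sign p) *
      (\<Sum>i\<in>UNIV. H$i$p i * (\<Prod>j\<in>UNIV-{i}. A$j$p j))"
  have "(det has_derivative ?D (mat 1)) (at (mat 1))"
    unfolding det_def[abs_def]
    by (intro has_derivative_sum has_derivative_mult_right has_derivative_prod entry_has_derivative)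
  moreover have "?D (mat 1) H = trace H" for H
  proof -
    have "of_int (sign p) * (\<Sum>i\<in>UNIV. H$i$p i * (\<Prod>j\<in>UNIV-{i}. (mat 1 :: real^'n^'n)$j$p j))
        = (if p = id then trace H else 0)" if p: "p permutes (UNIV::'n set)" for p
    proof (cases "p = id")
      case True then show ?thesis by (simp add: trace_def mat_def)
    next
      case False
      have "(\<Prod>j\<in>UNIV-{i}. (mat 1 :: real^'n^'n)$j$p j) = 0" for i
      proof -
        have "\<exists>j. j \<noteq> i \<and> p j \<noteq> j"
        proof (rule ccontr)
          assume "\<not> ?thesis"
          then have fix_: "p j = j" if "j \<noteq> i" for j using that by auto
          then have "p i = i" using permutes_inj[OF p] by (metis injD)
          with fix_ False show False by (metis ext id_apply)
        qed
        then obtain j where "j \<noteq> i" "p j \<noteq> j" by blast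
        then show ?thesis by (intro prod_zero bexI[of _ j]) (auto simp: mat_def)
      qed
      then show ?thesis using False by (simp del: prod_zero_iff)
    qed
    then have "?D (mat 1) H = (\<Sum>p\<in>{p. p permutes (UNIV::'n set)}. if p = id then trace H else 0)"
      by (intro sum.cong) auto
    then show ?thesis by (simp add: sum.delta permutes_id finite_permutations)
  qed
  ultimately show ?thesis by (metis (no_types, lifting) ext)
qed

text \<open>Jacobi's formula; the case of the unit matrix suffices because
  \<open>det X = det A * det (A\<^sup>-\<^sup>1 X)\<close>.\<close>

lemma has_derivative_det:
  fixes A :: "real^'n^'n"
  assumes "invertible A"
  shows "(det has_derivative (\<lambda>H. det A * trace (matrix_inv A ** H))) (at A)"
proof -
  note inv = matrix_inv_works[OF assms]
  have "((\<lambda>X. matrix_inv A ** X) has_derivative (\<lambda>H. matrix_inv A ** H)) (at A)"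
    by (rule bounded_linear_imp_has_derivative)
       (rule bounded_bilinear.bounded_linear_right[OF bounded_bilinear_matrix_mult])
  from diff_chain_at[OF this, of det trace]
  have "((\<lambda>X. det (matrix_inv A ** X)) has_derivative (\<lambda>H. trace (matrix_inv A ** H))) (at A)"
    using has_derivative_det_mat_1 by (simp add: inv o_def)
  from has_derivative_mult_right[OF this, of "det A"]
  have "((\<lambda>X. det A * det (matrix_inv A ** X)) has_derivative (\<lambda>H. det A * trace (matrix_inv A ** H))) (at A)" .
  moreover have "(\<lambda>X. det A * det (matrix_inv A ** X)) = det"
    by (rule ext) (simp add: det_mul[symmetric] matrix_mul_assoc inv del: det_mul)
  ultimately show ?thesis by simp
qed

lemma differentiable_det_comp:
  fixes f :: "'v::real_normed_vector \<Rightarrow> real^'n^'n"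
  assumes "\<And>i j. (\<lambda>x. f x $ i $ j) differentiable (at x)"
  shows "(\<lambda>x. det (f x)) differentiable (at x)"
proof -
  obtain D where "\<And>i j. ((\<lambda>x. f x $ i $ j) has_derivative D i j) (at x)"
    using assms unfolding differentiable_def by metis
  then have "((\<lambda>x. det (f x)) has_derivative (\<lambda>H. \<Sum>p\<in>{p. p permutes UNIV}. of_int (sign p) *
      (\<Sum>i\<in>UNIV. D i (p i) H * (\<Prod>j\<in>UNIV-{i}. f x $ j $ p j)))) (at x)"
    unfolding det_def
    by (intro has_derivative_sum has_derivative_mult_right has_derivative_prod)
  then show ?thesis by (rule differentiableI)
qed

lemma matrix_inv_entry:
  fixes A :: "real^'n^'n"
  assumes "det A \<noteq> 0"
  shows "matrix_inv A $ k $ j = det (\<chi> i l. if l = k then axis j 1 $ i else A $ i $ l) / det A"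
proof -
  have inv: "invertible A" using assms by (simp add: invertible_det_nz)
  have "A *v (matrix_inv A *v axis j 1) = axis j 1"
    by (simp add: matrix_vector_mul_assoc matrix_inv_works[OF inv])
  then have "matrix_inv A *v axis j 1 = (\<chi> k. det (\<chi> i l. if l = k then axis j 1 $ i else A $ i $ l) / det A)"
    using cramer[OF assms] by blast
  then have "(matrix_inv A *v axis j 1) $ k = det (\<chi> i l. if l = k then axis j 1 $ i else A $ i $ l) / det A"
    by simp
  then show ?thesis by (simp add: matrix_vector_mult_basis column_def)
qed

lemma open_invertible: "open {A::real^'n^'n. invertible A}"
proof -
  have "{A::real^'n^'n. invertible A} = det -` (- {0})" by (auto simp: invertible_det_nz)
  moreover have "open (det -` (- {0}) :: (real^'n^'n) set)"
    by (intro continuous_open_vimage continuous_at_imp_continuous_on ballI)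
       (auto intro!: differentiable_imp_continuous_within differentiable_det_comp
         differentiableI[OF entry_has_derivative])
  ultimately show ?thesis by simp
qed

text \<open>Cramer's rule shows that the inverse is differentiable; its derivative is then found by
  differentiating \<open>X X\<^sup>-\<^sup>1 = 1\<close>.\<close>

lemma has_derivative_matrix_inv:
  fixes A :: "real^'n^'n"
  assumes "invertible A"
  shows "(matrix_inv has_derivative (\<lambda>H. - (matrix_inv A ** H ** matrix_inv A))) (at A)"
proof -
  have ent: "(\<lambda>X::real^'n^'n. X $ i $ j) differentiable (at A)" for i j
    by (rule differentiableI[OF entry_has_derivative])
  have "matrix_inv differentiable (at A)"
    unfolding differentiable_componentwise_within[of matrix_inv]
  proof
    fix b :: "real^'n^'n" assume "b \<in> Basis"
    then obtain k j where b: "b = axis k (axis j 1)" by (auto simp: Basis_vec_def)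
    have "(\<lambda>X::real^'n^'n. if l = k then axis j 1 $ i else X $ i $ l) differentiable (at A)" for i l
      using ent by (cases "l = k") auto
    then have "(\<lambda>X::real^'n^'n. det (\<chi> i l. if l = k then axis j 1 $ i else X $ i $ l) / det X) differentiable (at A)"
      using assms ent by (intro differentiable_divide differentiable_det_comp) (auto simp: invertible_det_nz)
    then have "(\<lambda>X::real^'n^'n. matrix_inv X $ k $ j) differentiable (at A)"
      by (subst frechet_derivative_cong_open(1)[OF open_invertible, of A _
           "\<lambda>X. det (\<chi> i l. if l = k then axis j 1 $ i else X $ i $ l) / det X"])
         (use assms in \<open>auto simp: matrix_inv_entry invertible_det_nz\<close>)
    then show "(\<lambda>X. matrix_inv X \<bullet> b) differentiable (at A)"
      by (simp add: b inner_axis)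
  qed
  then obtain D where D: "(matrix_inv has_derivative D) (at A)" by (auto simp: differentiable_def)
  note inv = matrix_inv_works[OF assms]
  have "((\<lambda>X. X ** matrix_inv X) has_derivative (\<lambda>H. A ** D H + H ** matrix_inv A)) (at A)"
    by (rule has_derivative_matrix_mult[OF has_derivative_ident D])
  moreover have "((\<lambda>X. X ** matrix_inv X) has_derivative (\<lambda>H. 0)) (at A)"
    by (rule has_derivative_transform_within_open[OF has_derivative_const[of "mat 1"] open_invertible])
       (use assms in \<open>auto simp: matrix_inv_works\<close>)
  ultimately have eq: "(\<lambda>H. A ** D H + H ** matrix_inv A) = (\<lambda>H. 0)"
    by (rule has_derivative_unique)
  have "D H = - (matrix_inv A ** H ** matrix_inv A)" for H
  proof -
    have "A ** D H = - (H ** matrix_inv A)"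
      using fun_cong[OF eq, of H] by (simp add: eq_neg_iff_add_eq_0)
    then have "matrix_inv A ** (A ** D H) = - (matrix_inv A ** (H ** matrix_inv A))"
      by (simp add: bounded_bilinear.minus_right[OF bounded_bilinear_matrix_mult])
    then show ?thesis by (simp add: matrix_mul_assoc inv)
  qed
  then have "D = (\<lambda>H. - (matrix_inv A ** H ** matrix_inv A))" by (rule ext)
  with D show ?thesis by simp
qed

lemma continuous_on_matrix_inv [continuous_intros]:
  fixes f :: "'v::topological_space \<Rightarrow> real^'n^'n"
  assumes "continuous_on S f" "\<And>x. x \<in> S \<Longrightarrow> invertible (f x)"
  shows "continuous_on S (\<lambda>x. matrix_inv (f x))"
proof -
  have "continuous_on {A::real^'n^'n. invertible A} matrix_inv"
    by (intro continuous_at_imp_continuous_on ballI has_derivative_continuous[OF has_derivative_matrix_inv]) auto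
  then show ?thesis by (rule continuous_on_compose2) (use assms in auto)
qed

lemma continuous_on_det [continuous_intros]:
  fixes f :: "'v::topological_space \<Rightarrow> real^'n^'n"
  assumes "continuous_on S f"
  shows "continuous_on S (\<lambda>x. det (f x))"
  unfolding det_def using assms by (intro continuous_intros)

lemmas continuous_on_trace [continuous_intros] = bounded_linear.continuous_on[OF bounded_linear_trace]

lemma Ck_matrix_inv:
  fixes f :: "'v::real_normed_vector \<Rightarrow> real^'n^'n"
  assumes "open S" "\<And>x. x \<in> S \<Longrightarrow> invertible (f x)"
  shows "Ck n S f \<Longrightarrow> Ck n S (\<lambda>x. matrix_inv (f x))"
proof (induction n)
  case (Suc n)
  have d: "((\<lambda>x. matrix_inv (f x)) has_derivative
      (\<lambda>v. - (matrix_inv (f x) ** frechet_derivative f (at x) v ** matrix_inv (f x)))) (at x)" if "x \<in> S" for x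
    using diff_chain_at[OF Ck_derivative[OF Suc.prems that] has_derivative_matrix_inv[OF assms(2)[OF that]]]
    by (simp add: o_def)
  have inv: "Ck n S (\<lambda>x. matrix_inv (f x))"
    using Suc.IH Ck_SucD[OF Suc.prems] by simp
  have "Ck n S (\<lambda>x. - (matrix_inv (f x) ** frechet_derivative f (at x) v ** matrix_inv (f x)))" for v
    by (rule Ck_bounded_linear[OF bounded_linear_minus[OF bounded_linear_ident] assms(1)
          Ck_bilinear[OF bounded_bilinear_matrix_mult assms(1)
            Ck_bilinear[OF bounded_bilinear_matrix_mult assms(1) inv] inv]])
       (use Suc.prems in simp)
  then show ?case
    by (intro Ck_SucI[OF assms(1), where f' = "\<lambda>x v. - (matrix_inv (f x) **
      frechet_derivative f (at x) v ** matrix_inv (f x))"] d)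
qed simp

lemma smooth_on_matrix_inv:
  fixes f :: "'v::real_normed_vector \<Rightarrow> real^'n^'n"
  assumes "open S" "smooth_on S f" "\<And>x. x \<in> S \<Longrightarrow> invertible (f x)"
  shows "smooth_on S (\<lambda>x. matrix_inv (f x))"
  unfolding smooth_on_iff_Ck
proof
  show "Ck n S (\<lambda>x. matrix_inv (f x))" for n
    by (rule Ck_matrix_inv[OF assms(1,3)]) (use assms(2) in \<open>simp_all add: smooth_on_iff_Ck\<close>)
qed

definition posdef :: "real^'n^'n \<Rightarrow> bool" where
  "posdef A \<longleftrightarrow> (\<forall>v. v \<noteq> 0 \<longrightarrow> v \<bullet> (A *v v) > 0)"

lemma posdef_invertible:
  fixes A :: "real^'n^'n"
  assumes "posdef A"
  shows "invertible A"
proof -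
  have "v = 0" if "A *v v = 0" for v
    using assms that unfolding posdef_def by (metis inner_zero_right less_irrefl)
  then show ?thesis by (simp add: invertible_left_inverse matrix_left_invertible_ker)
qed

lemma posdef_convex:
  fixes A B :: "real^'n^'n"
  assumes "posdef A" "posdef B" "0 \<le> r" "r \<le> 1"
  shows "posdef ((1 - r) *\<^sub>R A + r *\<^sub>R B)"
  unfolding posdef_def
proof (intro allI impI)
  fix v :: "real^'n" assume "v \<noteq> 0"
  then have p: "v \<bullet> (A *v v) > 0" "v \<bullet> (B *v v) > 0" using assms by (auto simp: posdef_def)
  have "v \<bullet> (((1 - r) *\<^sub>R A + r *\<^sub>R B) *v v) = (1 - r) * (v \<bullet> (A *v v)) + r * (v \<bullet> (B *v v))"
    by (simp add: matrix_vector_mult_add_rdistrib scaleR_matrix_vector_assoc[symmetric] inner_add_right)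
  also have "\<dots> > 0"
    using p assms(3,4) by (cases "r = 0") (auto intro: add_nonneg_pos)
  finally show "v \<bullet> (((1 - r) *\<^sub>R A + r *\<^sub>R B) *v v) > 0" .
qed

lemma posdef_mat_1: "posdef (mat 1 :: real^'n^'n)"
  by (simp add: posdef_def)

text \<open>The determinant does not vanish on the segment joining \<open>A\<close> to the unit matrix, which consists
  of positive definite matrices.\<close>

lemma posdef_det_pos:
  fixes A :: "real^'n^'n"
  assumes "posdef A"
  shows "det A > 0"
proof (rule ccontr)
  assume "\<not> det A > 0"
  let ?d = "\<lambda>r. det ((1 - r) *\<^sub>R mat 1 + r *\<^sub>R A)"
  have "continuous_on {0..1} ?d" by (intro continuous_intros)
  then have "\<exists>r\<ge>0. r \<le> 1 \<and> ?d r = 0"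
    using \<open>\<not> det A > 0\<close> by (intro IVT2') auto
  then obtain r where "0 \<le> r" "r \<le> 1" "?d r = 0" by auto
  with posdef_invertible[OF posdef_convex[OF posdef_mat_1 assms]] show False
    by (auto simp: invertible_det_nz)
qed

text \<open>A positive definite form is bounded below by a positive constant on the compact unit sphere,
  hence a small perturbation keeps it positive.\<close>

lemma open_posdef: "open {A::real^'n^'n. posdef A}"
proof (rule openI)
  fix A :: "real^'n^'n" assume "A \<in> {A. posdef A}"
  then have A: "posdef A" by simp
  let ?S = "sphere (0::real^'n) 1"
  have cont: "continuous_on ?S (\<lambda>v. v \<bullet> (A *v v))"
    by (intro continuous_intros)
  have "compact ?S" "?S \<noteq> {}" by auto
  from continuous_attains_inf[OF this cont]
  obtain u where u: "u \<in> ?S" "\<And>v. v \<in> ?S \<Longrightarrow> u \<bullet> (A *v u) \<le> v \<bullet> (A *v v)"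
    by blast
  define d where "d = u \<bullet> (A *v u)"
  have "u \<noteq> 0" using u(1) by auto
  then have "d > 0" using A by (simp add: d_def posdef_def)
  obtain K where K: "K > 0" "\<And>(B::real^'n^'n) v. norm (B *v v) \<le> norm B * norm v * K"
    using bounded_bilinear.pos_bounded[OF matrix_vector_mul_bounded_bilinear] by metis
  show "\<exists>e>0. ball A e \<subseteq> {A. posdef A}"
  proof (intro exI conjI subsetI)
    show "d / K > 0" using \<open>d > 0\<close> \<open>K > 0\<close> by simp
    fix B assume B: "B \<in> ball A (d / K)"
    have unit: "v \<bullet> (B *v v) > 0" if v: "norm v = 1" for v
    proof -
      have "\<bar>v \<bullet> ((B - A) *v v)\<bar> \<le> norm v * norm ((B - A) *v v)" by (rule Cauchy_Schwarz_ineq2)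
      also have "\<dots> \<le> norm (B - A) * K" using K(2)[of "B - A" v] v by simp
      also have "\<dots> < d" using B K(1) by (simp add: dist_norm norm_minus_commute field_simps)
      finally have "\<bar>v \<bullet> (B *v v) - v \<bullet> (A *v v)\<bar> < d"
        by (simp add: matrix_vector_mult_diff_rdistrib inner_diff_right)
      moreover have "d \<le> v \<bullet> (A *v v)" using u v by (simp add: d_def)
      ultimately show ?thesis by linarith
    qed
    have "v \<bullet> (B *v v) > 0" if "v \<noteq> 0" for v
    proof -
      have "0 < (v /\<^sub>R norm v) \<bullet> (B *v (v /\<^sub>R norm v))" using unit[of "v /\<^sub>R norm v"] that by simp
      also have "\<dots> = (v \<bullet> (B *v v)) / (norm v)^2"
        by (simp add: matrix_vector_mult_scaleR power2_eq_square divide_inverse)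
      finally show ?thesis using that by (simp add: zero_less_divide_iff)
    qed
    then show "B \<in> {A. posdef A}" by (simp add: posdef_def)
  qed
qed

lemma posdef_congruence:
  fixes A J :: "real^'n^'n"
  assumes "invertible J" "posdef A"
  shows "posdef (transpose J ** A ** J)"
  unfolding posdef_def
proof (intro allI impI)
  fix v :: "real^'n" assume "v \<noteq> 0"
  then have "J *v v \<noteq> 0" using assms(1)
    by (metis invertible_left_inverse matrix_left_invertible_ker)
  then have "(J *v v) \<bullet> (A *v (J *v v)) > 0" using assms(2) by (auto simp: posdef_def)
  then show "v \<bullet> ((transpose J ** A ** J) *v v) > 0"
    by (simp add: matrix_vector_mul_assoc[symmetric] dot_lmul_matrix inner_commute)
       (metis dot_lmul_matrix inner_commute)
qed

text \<open>If a (0,2)-tensor transforms by \<open>J\<close>, its inverse is a (2,0)-tensor and transforms by the inverse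
  rule.\<close>

lemma matrix_inv_congruence:
  fixes J A :: "real^'n^'n"
  assumes "invertible J" "invertible A"
  shows "J ** matrix_inv (transpose J ** A ** J) ** transpose J = matrix_inv A"
proof -
  let ?K = "matrix_inv J"
  have J: "J ** ?K = mat 1" "?K ** J = mat 1" using matrix_inv_works[OF assms(1)] by auto
  then have JT: "transpose J ** transpose ?K = mat 1" "transpose ?K ** transpose J = mat 1"
    by (metis matrix_transpose_mul transpose_mat)+
  have A: "A ** matrix_inv A = mat 1" using matrix_inv_works[OF assms(2)] by auto
  have "(transpose J ** A ** J) ** (?K ** matrix_inv A ** transpose ?K)
      = transpose J ** (A ** (J ** ?K) ** matrix_inv A) ** transpose ?K"
    by (simp add: matrix_mul_assoc)
  also have "\<dots> = mat 1" by (simp add: J JT A)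
  finally have "matrix_inv (transpose J ** A ** J) = ?K ** matrix_inv A ** transpose ?K"
    by (rule matrix_inv_unique)
  then have "J ** matrix_inv (transpose J ** A ** J) ** transpose J
      = (J ** ?K) ** matrix_inv A ** (transpose ?K ** transpose J)"
    by (simp add: matrix_mul_assoc)
  then show ?thesis by (simp add: J JT)
qed

lemma transpose_matrix_inv:
  fixes A :: "real^'n^'n"
  assumes "invertible A"
  shows "transpose (matrix_inv A) = matrix_inv (transpose A)"
proof -
  have "transpose A ** transpose (matrix_inv A) = mat 1"
    using matrix_inv_works(2)[OF assms] by (metis matrix_transpose_mul transpose_mat)
  then show ?thesis by (simp add: matrix_inv_unique(2))
qed


section \<open>Change of variables\<close>

text \<open>The formula for real integrals says that both sides have the same finite values; if neither
  side is finite, both are infinite.\<close>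

lemma nn_integral_change_of_variables_wellorder:
  fixes \<tau> :: "real^'m::{finite,wellorder} \<Rightarrow> real^'m::_" and F :: "real^'m::_ \<Rightarrow> real"
  assumes B: "B \<in> sets borel"
    and der: "\<And>x. x \<in> B \<Longrightarrow> (\<tau> has_derivative \<tau>' x) (at x)"
    and inj: "inj_on \<tau> B"
    and F: "\<And>x. F x \<ge> 0"
    and m1: "(\<lambda>x. indicator B x * (\<bar>det (matrix (\<tau>' x))\<bar> * F (\<tau> x))) \<in> borel_measurable borel"
    and m2: "(\<lambda>y. indicator (\<tau> ` B) y * F y) \<in> borel_measurable borel"
  shows "(\<integral>\<^sup>+x. ennreal (indicator B x * (\<bar>det (matrix (\<tau>' x))\<bar> * F (\<tau> x))) \<partial>lborel)
       = (\<integral>\<^sup>+y. ennreal (indicator (\<tau> ` B) y * F y) \<partial>lborel)"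
    (is "?L = ?R")
proof -
  let ?G = "\<lambda>x. \<bar>det (matrix (\<tau>' x))\<bar> * F (\<tau> x)"
  have "(\<lambda>x. \<bar>det (matrix (\<tau>' x))\<bar> *\<^sub>R vec (F (\<tau> x)) :: real^1) absolutely_integrable_on B \<and>
           integral B (\<lambda>x. \<bar>det (matrix (\<tau>' x))\<bar> *\<^sub>R vec (F (\<tau> x))) = (vec r :: real^1)
         \<longleftrightarrow> (\<lambda>x. vec (F x) :: real^1) absolutely_integrable_on (\<tau> ` B) \<and>
           integral (\<tau> ` B) (\<lambda>x. vec (F x)) = (vec r :: real^1)" for r
    using B by (intro has_absolute_integral_change_of_variables has_derivative_at_withinI[OF der] inj) auto
  then have "?G absolutely_integrable_on B \<and> integral B ?G = r \<longleftrightarrow>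
      F absolutely_integrable_on (\<tau> ` B) \<and> integral (\<tau> ` B) F = r" for r
    by (simp add: absolutely_integrable_on_1_iff integral_on_1_eq)
  moreover have "?G absolutely_integrable_on B \<longleftrightarrow> ?G integrable_on B"
    "F absolutely_integrable_on (\<tau> ` B) \<longleftrightarrow> F integrable_on (\<tau> ` B)"
    using F by (auto simp: absolutely_integrable_on_def abs_mult)
  ultimately have eq: "(?G has_integral r) B \<longleftrightarrow> (F has_integral r) (\<tau> ` B)" for r
    unfolding has_integral_integrable_integral by simp
  have res: "(f has_integral r) S \<longleftrightarrow> ((\<lambda>x. indicator S x * f x) has_integral r) UNIV"
    for f :: "real^'m::_ \<Rightarrow> real" and S r
    by (simp add: indicator_def of_bool_def if_distrib[of "\<lambda>x. x * f y" for y] has_integral_restrict_UNIV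
          cong: if_cong)
  have nn: "(\<integral>\<^sup>+x. ennreal (f x) \<partial>lborel) = ennreal r \<longleftrightarrow> (f has_integral r) UNIV"
    if "f \<in> borel_measurable borel" "\<And>x. f x \<ge> 0" "r \<ge> 0" for f :: "real^'m::_ \<Rightarrow> real" and r
    using nn_integral_has_integral[of f r] nn_integral_has_integral_lborel[of f r] that by auto
  have LR: "?L = ennreal r \<longleftrightarrow> ?R = ennreal r" if "r \<ge> 0" for r
    using nn[OF m1 _ that] nn[OF m2 _ that] eq[of r] F
    unfolding res[of ?G] res[of F] by simp
  show ?thesis
  proof (cases ?L rule: ennreal_cases)
    case (real r)
    then show ?thesis using LR[of r] by metis
  next
    case L: top
    show ?thesis
    proof (cases ?R rule: ennreal_cases)
      case (real r)
      then show ?thesis using LR[of r] by metis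
    qed (simp only: L)
  qed
qed

text \<open>A well-ordered copy of an arbitrary finite index type.  The change of variables formula over a
  well-ordered index type is carried over to any finite index type by relabelling coordinates, which
  preserves Lebesgue measure and Jacobian determinants.\<close>

typedef (overloaded) ('n::finite) idx = "{..<CARD('n)}" by (rule exI[of _ 0]) (simp add: zero_less_card_finite)

instantiation idx :: (finite) linorder
begin
definition less_eq_idx :: "'a idx \<Rightarrow> 'a idx \<Rightarrow> bool" where "less_eq_idx i j \<longleftrightarrow> Rep_idx i \<le> Rep_idx j"
definition less_idx :: "'a idx \<Rightarrow> 'a idx \<Rightarrow> bool" where "less_idx i j \<longleftrightarrow> Rep_idx i < Rep_idx j"
instance
  by standard (auto simp: less_eq_idx_def less_idx_def Rep_idx_inject)
end

instance idx :: (finite) wellorder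
proof
  fix P :: "'a idx \<Rightarrow> bool" and a
  assume *: "\<And>x. (\<And>y. y < x \<Longrightarrow> P y) \<Longrightarrow> P x"
  show "P a"
  proof (induction "Rep_idx a" arbitrary: a rule: less_induct)
    case less
    show ?case by (rule *, rule less.hyps) (simp add: less_idx_def)
  qed
qed

lemma bij_betw_Rep_idx: "bij_betw (Rep_idx :: 'a::finite idx \<Rightarrow> nat) UNIV {..<CARD('a)}"
proof (rule bij_betwI')
  show "\<exists>x\<in>(UNIV :: 'a idx set). k = Rep_idx x" if "k \<in> {..<CARD('a)}" for k
    by (rule bexI[of _ "Abs_idx k"]) (simp_all add: Abs_idx_inverse[OF that])
qed (use Rep_idx in \<open>auto simp: Rep_idx_inject\<close>)

instance idx :: (finite) finite
  by standard (use bij_betw_finite[OF bij_betw_Rep_idx] in simp)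

lemma obtain_bij_idx:
  obtains b :: "'n::finite idx \<Rightarrow> 'n" where "bij b"
proof -
  have "CARD('n idx) = CARD('n)"
    using bij_betw_same_card[OF bij_betw_Rep_idx[where 'a='n]] by simp
  then obtain b :: "'n idx \<Rightarrow> 'n" where "bij_betw b UNIV UNIV"
    using finite_same_card_bij[of "UNIV :: 'n idx set" "UNIV :: 'n set"] by auto
  then show ?thesis by (intro that)
qed

lemma det_reindex:
  fixes b :: "'m::finite \<Rightarrow> 'n::finite" and M :: "real^'n^'n"
  assumes "bij b"
  shows "det (\<chi> i j. M $ b i $ b j) = det M"
proof -
  note b = bij_is_inj[OF assms] bij_is_surj[OF assms]
  have conj: "map_permutation UNIV b p = b \<circ> p \<circ> inv b" for p
    by (simp add: map_permutation_def b restrict_id_def fun_eq_iff)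
  show ?thesis
    unfolding det_def
  proof (rule sum.reindex_bij_witness[of _ "\<lambda>q. inv b \<circ> q \<circ> b" "\<lambda>p. b \<circ> p \<circ> inv b"], goal_cases)
    case (1 p) then show ?case using b by (simp add: fun_eq_iff)
  next
    case (2 p)
    then show ?case
      using map_permutation_permutes[of b UNIV UNIV p] assms by (simp add: conj)
  next
    case (3 q) then show ?case using b by (simp add: fun_eq_iff surj_f_inv_f)
  next
    case (4 q)
    then have "bij q" by (simp add: permutes_bij)
    then show ?case
      using assms by (auto intro!: bij_imp_permutes bij_comp bij_imp_bij_inv)
  next
    case (5 p)
    have "sign (b \<circ> p \<circ> inv b) = sign p"
      using sign_map_permutation[of b UNIV p] 5 b by (simp add: conj)
    moreover have "(\<Prod>i\<in>UNIV. M $ i $ (b \<circ> p \<circ> inv b) i) = (\<Prod>i\<in>UNIV. (\<chi> i j. M $ b i $ b j) $ i $ p i)"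
      by (rule prod.reindex_bij_witness[of _ b "inv b"]) (use b in \<open>auto simp: surj_f_inv_f\<close>)
    ultimately show ?case by simp
  qed
qed

definition reindex :: "('m \<Rightarrow> 'n) \<Rightarrow> real^'n \<Rightarrow> real^'m" where
  "reindex b x = (\<chi> i. x $ b i)"

lemma bounded_linear_reindex: "bounded_linear (reindex b :: real^'n::finite \<Rightarrow> real^'m::finite)"
  by (intro linear_conv_bounded_linear[THEN iffD1] linearI) (auto simp: reindex_def vec_eq_iff)

lemma reindex_measurable [measurable]:
  "(reindex b :: real^'n::finite \<Rightarrow> real^'m::finite) \<in> borel_measurable borel"
  by (intro borel_measurable_continuous_onI linear_continuous_on bounded_linear_reindex)

lemma reindex_inv:
  assumes "bij b"
  shows "reindex (inv b) (reindex b x) = x" "reindex b (reindex (inv b) y) = y"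
  using bij_is_inj[OF assms] bij_is_surj[OF assms] by (auto simp: reindex_def vec_eq_iff surj_f_inv_f)

lemma lborel_reindex:
  fixes b :: "'m::finite \<Rightarrow> 'n::finite"
  assumes "bij b"
  shows "(lborel :: (real^'m) measure) = distr lborel borel (reindex b)"
proof (rule lborel_eqI)
  fix l u :: "real^'m" assume le: "\<And>c. c \<in> Basis \<Longrightarrow> l \<bullet> c \<le> u \<bullet> c"
  have le': "l $ i \<le> u $ i" for i using le[of "axis i 1"] by (simp add: inner_axis axis_in_Basis_iff)
  have inv: "inv b (b i) = i" "b (inv b j) = j" for i j
    using bij_is_inj[OF assms] bij_is_surj[OF assms] by (auto simp: surj_f_inv_f)
  have vim: "reindex b -` box l u = box (reindex (inv b) l) (reindex (inv b) u)"
    by (auto simp: reindex_def mem_box_cart inv) (metis inv)+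
  have "emeasure (distr lborel borel (reindex b)) (box l u)
      = emeasure lborel (box (reindex (inv b) l) (reindex (inv b) u))"
    by (simp add: emeasure_distr vim)
  also have "\<dots> = (\<Prod>c\<in>Basis. (reindex (inv b) u - reindex (inv b) l) \<bullet> c)"
    by (rule emeasure_lborel_box)
       (use le' in \<open>auto simp: Basis_vec_def inner_axis reindex_def\<close>)
  also have "(\<Prod>c\<in>Basis. (reindex (inv b) u - reindex (inv b) l) \<bullet> c)
      = (\<Prod>j\<in>UNIV. u $ inv b j - l $ inv b j)"
    by (simp add: Basis_vec_def reindex_def inner_axis prod.reindex inj_on_def axis_eq_axis
        UNION_singleton_eq_range)
  also have "\<dots> = (\<Prod>i\<in>UNIV. u $ i - l $ i)"
    by (rule prod.reindex_bij_witness[of _ b "inv b"]) (auto simp: inv)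
  also have "\<dots> = (\<Prod>c\<in>Basis. (u - l) \<bullet> c)"
    by (simp add: Basis_vec_def inner_axis prod.reindex inj_on_def axis_eq_axis
        UNION_singleton_eq_range)
  finally show "emeasure (distr lborel borel (reindex b)) (box l u) = (\<Prod>c\<in>Basis. (u - l) \<bullet> c)" .
qed simp

lemma nn_integral_reindex:
  fixes b :: "'m::finite \<Rightarrow> 'n::finite"
  assumes "bij b" "(\<lambda>x. h (reindex b x)) \<in> borel_measurable borel"
  shows "(\<integral>\<^sup>+y. h y \<partial>lborel) = (\<integral>\<^sup>+x. h (reindex b x) \<partial>lborel)"
proof -
  have "h = (\<lambda>y. h (reindex b (reindex (inv b) y)))" by (simp add: reindex_inv[OF assms(1)])
  also have "\<dots> \<in> borel_measurable borel"
    by (rule measurable_compose[OF reindex_measurable assms(2)])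
  finally show ?thesis
    by (subst lborel_reindex[OF assms(1)], subst nn_integral_distr) auto
qed

theorem nn_integral_change_of_variables:
  fixes \<tau> :: "real^'n \<Rightarrow> real^'n" and F :: "real^'n \<Rightarrow> real"
  assumes B: "B \<in> sets borel"
    and der: "\<And>x. x \<in> B \<Longrightarrow> (\<tau> has_derivative \<tau>' x) (at x)"
    and inj: "inj_on \<tau> B"
    and F: "\<And>x. F x \<ge> 0"
    and m1: "(\<lambda>x. indicator B x * (\<bar>det (matrix (\<tau>' x))\<bar> * F (\<tau> x))) \<in> borel_measurable borel"
    and m2: "(\<lambda>y. indicator (\<tau> ` B) y * F y) \<in> borel_measurable borel"
  shows "(\<integral>\<^sup>+x. ennreal (indicator B x * (\<bar>det (matrix (\<tau>' x))\<bar> * F (\<tau> x))) \<partial>lborel)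
       = (\<integral>\<^sup>+y. ennreal (indicator (\<tau> ` B) y * F y) \<partial>lborel)"
proof -
  obtain b :: "'n idx \<Rightarrow> 'n" where b: "bij b" by (rule obtain_bij_idx)
  let ?T = "reindex b" and ?S = "reindex (inv b)"
  note TS = reindex_inv[OF b]
  have injT: "inj ?T" by (metis TS(1) injI)
  define \<sigma> where "\<sigma> = ?T \<circ> \<tau> \<circ> ?S"
  define \<sigma>' where "\<sigma>' x = ?T \<circ> \<tau>' (?S x) \<circ> ?S" for x
  have img: "\<sigma> ` ?T ` B = ?T ` \<tau> ` B" by (auto simp: \<sigma>_def TS image_image)
  have ind: "indicator (?T ` C) (?T x) = (indicator C x :: real)" for C x
    using injT by (auto simp: indicator_def dest: injD)
  have "det (matrix (\<sigma>' (?T x))) = det (matrix (\<tau>' x))" if "x \<in> B" for x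
  proof -
    have "?S (axis j 1) = axis (b j) 1" for j
      using bij_is_inj[OF b] bij_is_surj[OF b]
      by (auto simp: reindex_def vec_eq_iff axis_def surj_f_inv_f)
    then have "matrix (\<sigma>' (?T x)) = (\<chi> i j. matrix (\<tau>' x) $ b i $ b j)"
      by (simp add: matrix_def \<sigma>'_def TS vec_eq_iff) (simp add: reindex_def)
    then show ?thesis by (simp add: det_reindex[OF b])
  qed
  then have eq: "indicator (?T ` B) (?T x) * (\<bar>det (matrix (\<sigma>' (?T x)))\<bar> * F (?S (\<sigma> (?T x))))
      = indicator B x * (\<bar>det (matrix (\<tau>' x))\<bar> * F (\<tau> x))" for x
    unfolding ind by (auto simp: \<sigma>_def TS indicator_def)
  have eq2: "indicator (\<sigma> ` ?T ` B) (?T y) * F (?S (?T y)) = indicator (\<tau> ` B) y * F y" for y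
    unfolding img ind by (simp add: TS)
  have mT: "h \<in> borel_measurable borel" if "(\<lambda>x. h (?T x)) \<in> borel_measurable borel" for h :: "_ \<Rightarrow> real"
    using measurable_compose[OF reindex_measurable[of "inv b"] that] by (simp add: TS)
  have "?T ` B = ?S -` B" 
    by (auto simp: TS) (metis TS(2) imageI)
  then have TB: "?T ` B \<in> sets borel"
    using measurable_sets[OF reindex_measurable[of "inv b"] B] by simp
  have "(\<integral>\<^sup>+x. ennreal (indicator B x * (\<bar>det (matrix (\<tau>' x))\<bar> * F (\<tau> x))) \<partial>lborel)
      = (\<integral>\<^sup>+x. ennreal (indicator (?T ` B) x * (\<bar>det (matrix (\<sigma>' x))\<bar> * F (?S (\<sigma> x)))) \<partial>lborel)"
    by (subst nn_integral_reindex[OF b]) (use m1 in \<open>simp_all add: eq\<close>)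
  also have "\<dots> = (\<integral>\<^sup>+y. ennreal (indicator (\<sigma> ` ?T ` B) y * F (?S y)) \<partial>lborel)"
  proof (rule nn_integral_change_of_variables_wellorder[OF TB, of \<sigma> \<sigma>' "\<lambda>y. F (?S y)"])
    show "(\<sigma> has_derivative \<sigma>' x) (at x)" if "x \<in> ?T ` B" for x
    proof -
      have "?S x \<in> B" using that by (auto simp: TS)
      have "(?S has_derivative ?S) (at x)"
        by (rule bounded_linear_imp_has_derivative[OF bounded_linear_reindex])
      from diff_chain_at[OF this der[OF \<open>?S x \<in> B\<close>]]
      have "(\<tau> \<circ> ?S has_derivative \<tau>' (?S x) \<circ> ?S) (at x)" .
      from diff_chain_at[OF this bounded_linear_imp_has_derivative[OF bounded_linear_reindex, of b]]
      show ?thesis by (simp add: \<sigma>_def \<sigma>'_def o_assoc)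
    qed
    show "inj_on \<sigma> (?T ` B)"
      using inj injT by (auto simp: inj_on_def \<sigma>_def TS dest: injD)
  qed (use F mT m1 m2 eq eq2 in simp_all)
  also have "\<dots> = (\<integral>\<^sup>+y. ennreal (indicator (\<tau> ` B) y * F y) \<partial>lborel)"
    by (subst nn_integral_reindex[OF b]) (use m2 in \<open>simp_all add: eq2\<close>)
  finally show ?thesis .
qed


section \<open>Charts and components\<close>

lemma matrix_works_real:
  fixes f :: "real^'n \<Rightarrow> real^'m"
  shows "linear f \<Longrightarrow> matrix f *v x = f x"
  by (rule matrix_works) (simp add: linear_def scalar_mult_eq_scaleR)

locale compact_manifold =
  fixes A :: "('a::t2_space, 'n::finite) chart set"
  assumes manifold: "compact_smooth_manifold A"
begin

lemma compact_UNIV': "compact (UNIV :: 'a set)"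
  using manifold by (simp add: compact_smooth_manifold_def)

lemma chart_exists: "\<exists>c\<in>A. x \<in> fst c"
proof -
  have "x \<in> (\<Union>c\<in>A. fst c)" using manifold by (simp add: compact_smooth_manifold_def)
  then show ?thesis by simp
qed

lemma chart_at: "chart_at A x \<in> A" "x \<in> fst (chart_at A x)"
proof -
  have "\<exists>c. c \<in> A \<and> x \<in> fst c" using chart_exists by blast
  from someI_ex[OF this] show "chart_at A x \<in> A" "x \<in> fst (chart_at A x)"
    unfolding chart_at_def by blast+
qed

lemma chart_open: "c \<in> A \<Longrightarrow> open (fst c)" "c \<in> A \<Longrightarrow> open (chart_range c)"
  and chart_homeo: "c \<in> A \<Longrightarrow> homeomorphism (fst c) (chart_range c) (snd c) (chart_inv c)"
  using manifold by (auto simp: compact_smooth_manifold_def is_chart_def)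

lemma chart_cont: "c \<in> A \<Longrightarrow> continuous_on (fst c) (snd c)"
  and chart_inv_cont: "c \<in> A \<Longrightarrow> continuous_on (chart_range c) (chart_inv c)"
  using chart_homeo by (auto simp: homeomorphism_def)

lemma chart_simps [simp]:
  "c \<in> A \<Longrightarrow> x \<in> fst c \<Longrightarrow> chart_inv c (snd c x) = x"
  "c \<in> A \<Longrightarrow> y \<in> chart_range c \<Longrightarrow> snd c (chart_inv c y) = y"
  "c \<in> A \<Longrightarrow> y \<in> chart_range c \<Longrightarrow> chart_inv c y \<in> fst c"
  "x \<in> fst c \<Longrightarrow> snd c x \<in> chart_range c"
  using chart_homeo[of c] by (auto simp: homeomorphism_def chart_range_def)

lemma overlap_eq:
  assumes "c \<in> A"
  shows "snd c ` (fst c \<inter> W) = chart_range c \<inter> chart_inv c -` W"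
proof
  show "snd c ` (fst c \<inter> W) \<subseteq> chart_range c \<inter> chart_inv c -` W"
    using assms by auto
  show "chart_range c \<inter> chart_inv c -` W \<subseteq> snd c ` (fst c \<inter> W)"
    using assms by (intro subsetI rev_image_eqI[of "chart_inv c x" for x]) auto
qed

lemma overlap_open: "c \<in> A \<Longrightarrow> open W \<Longrightarrow> open (chart_range c \<inter> chart_inv c -` W)"
  by (intro continuous_open_preimage chart_inv_cont chart_open)

definition jac :: "('a, 'n) chart \<Rightarrow> ('a, 'n) chart \<Rightarrow> real^'n \<Rightarrow> real^'n^'n" where
  "jac c d y = matrix (frechet_derivative (snd d \<circ> chart_inv c) (at y))"

lemma transition_has_derivative:
  assumes "c \<in> A" "d \<in> A" "y \<in> chart_range c" "chart_inv c y \<in> fst d"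
  shows "(snd d \<circ> chart_inv c has_derivative (*v) (jac c d y)) (at y)"
proof -
  have "charts_compatible c d"
    using manifold assms(1,2) by (auto simp: compact_smooth_manifold_def)
  then have "smooth_on (chart_range c \<inter> chart_inv c -` fst d) (snd d \<circ> chart_inv c)"
    by (simp add: charts_compatible_def overlap_eq[OF assms(1)])
  then have "snd d \<circ> chart_inv c differentiable (at y)"
    by (rule smooth_on_differentiable) (use assms in auto)
  then have *: "(snd d \<circ> chart_inv c has_derivative frechet_derivative (snd d \<circ> chart_inv c) (at y)) (at y)"
    by (simp add: frechet_derivative_works[symmetric])
  have "frechet_derivative (snd d \<circ> chart_inv c) (at y) = (*v) (jac c d y)"
    unfolding jac_def using matrix_works_real[OF has_derivative_linear[OF *]] by auto
  with * show ?thesis by simp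
qed

lemma jac_unique:
  assumes "(f has_derivative (*v) M) (at y)" "open S" "y \<in> S"
    and "\<And>z. z \<in> S \<Longrightarrow> f z = (snd d \<circ> chart_inv c) z"
  shows "jac c d y = M"
proof -
  have "(snd d \<circ> chart_inv c has_derivative (*v) M) (at y)"
    using has_derivative_transform_within_open[OF assms(1,2,3)] assms(4) by blast
  then have "frechet_derivative (snd d \<circ> chart_inv c) (at y) = (*v) M"
    by (rule frechet_derivative_at[symmetric])
  then show ?thesis by (simp add: jac_def matrix_of_matrix_vector_mul)
qed

lemma jac_compose:
  assumes "c \<in> A" "d \<in> A" "e \<in> A" "y \<in> chart_range c" "chart_inv c y \<in> fst d" "chart_inv c y \<in> fst e"
  shows "jac c e y = jac d e (snd d (chart_inv c y)) ** jac c d y"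
proof (rule jac_unique)
  let ?S = "chart_range c \<inter> chart_inv c -` (fst d \<inter> fst e)"
  let ?z = "snd d (chart_inv c y)"
  have "(snd e \<circ> chart_inv d has_derivative (*v) (jac d e ?z)) (at ((snd d \<circ> chart_inv c) y))"
    using transition_has_derivative[of d e ?z] assms by simp
  from diff_chain_at[OF transition_has_derivative[OF assms(1,2,4,5)] this]
  show "((snd e \<circ> chart_inv d) \<circ> (snd d \<circ> chart_inv c) has_derivative
      (*v) (jac d e ?z ** jac c d y)) (at y)"
    by (simp add: o_def matrix_vector_mul_assoc)
  show "open ?S" using assms by (intro overlap_open chart_open open_Int)
qed (use assms in auto)

lemma jac_self:
  assumes "c \<in> A" "y \<in> chart_range c"
  shows "jac c c y = mat 1"
proof (rule jac_unique[where S = "chart_range c"])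
  show "((\<lambda>z. z) has_derivative (*v) (mat 1)) (at y)"
  proof -
    have "(*v) (mat 1) = (\<lambda>z::real^'n. z)" by (simp add: fun_eq_iff)
    then show ?thesis by simp
  qed
qed (use assms chart_open in auto)

lemma jac_invertible:
  assumes "c \<in> A" "d \<in> A" "y \<in> chart_range c" "chart_inv c y \<in> fst d"
  shows "invertible (jac c d y)"
proof -
  have "jac d c (snd d (chart_inv c y)) ** jac c d y = mat 1"
    using jac_compose[of c d c y] jac_self assms by simp
  then show ?thesis by (auto simp: invertible_left_inverse)
qed

text \<open>The coordinate basis of \<open>c\<close> expressed in the basis that was chosen at the point: the Jacobian
  that occurs in \<open>components\<close>.\<close>

definition frame :: "('a, 'n) chart \<Rightarrow> real^'n \<Rightarrow> real^'n^'n" where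
  "frame c y = jac c (chart_at A (chart_inv c y)) y"

lemma components_frame:
  "components A c h y = transpose (frame c y) ** h (chart_inv c y) ** frame c y"
  by (simp add: components_def frame_def jac_def Let_def)

lemma frame_invertible: "c \<in> A \<Longrightarrow> y \<in> chart_range c \<Longrightarrow> invertible (frame c y)"
  unfolding frame_def by (intro jac_invertible chart_at) auto

lemma components_transition:
  assumes "c \<in> A" "d \<in> A" "y \<in> chart_range c" "chart_inv c y \<in> fst d"
  shows "components A c h y =
    transpose (jac c d y) ** components A d h (snd d (chart_inv c y)) ** jac c d y"
proof -
  have "frame c y = frame d (snd d (chart_inv c y)) ** jac c d y"
    using assms jac_compose[of c d "chart_at A (chart_inv c y)" y] chart_at
    by (simp add: frame_def)
  then show ?thesis
    using assms by (simp add: components_frame matrix_transpose_mul matrix_mul_assoc)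
qed

lemma components_add: "components A c (\<lambda>x. h x + k x) y = components A c h y + components A c k y"
  by (simp add: components_frame matrix_mult_linear)

lemma components_scaleR: "components A c (\<lambda>x. f x *\<^sub>R h x) y = f (chart_inv c y) *\<^sub>R components A c h y"
  by (simp add: components_frame matrix_mult_linear)

text \<open>The Jacobians inside the product cancel, so that contracting two (0,2)-tensors with an inverse
  metric gives a (0,2)-tensor again.\<close>

lemma components_contract:
  assumes "c \<in> A" "y \<in> chart_range c" "invertible (g (chart_inv c y))"
  shows "components A c (\<lambda>x. h x ** matrix_inv (g x) ** k x) y
    = components A c h y ** matrix_inv (components A c g y) ** components A c k y"
proof -
  let ?J = "frame c y" and ?x = "chart_inv c y"
  have "components A c h y ** matrix_inv (components A c g y) ** components A c k y
     = transpose ?J ** h ?x ** (?J ** matrix_inv (transpose ?J ** g ?x ** ?J) ** transpose ?J) ** k ?x ** ?J"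
    by (simp add: components_frame matrix_mul_assoc)
  also have "\<dots> = components A c (\<lambda>x. h x ** matrix_inv (g x) ** k x) y"
    by (subst matrix_inv_congruence[OF frame_invertible[OF assms(1,2)] assms(3)])
       (simp add: components_frame matrix_mul_assoc)
  finally show ?thesis by simp
qed

text \<open>The trace is that of an endomorphism, so it does not depend on the chart.\<close>

lemma trace_components:
  assumes "c \<in> A" "y \<in> chart_range c" "invertible (g (chart_inv c y))"
  shows "trace (matrix_inv (components A c g y) ** components A c h y)
    = trace (matrix_inv (g (chart_inv c y)) ** h (chart_inv c y))"
proof -
  let ?J = "frame c y" and ?x = "chart_inv c y"
  have "trace (matrix_inv (components A c g y) ** components A c h y)
      = trace ((matrix_inv (transpose ?J ** g ?x ** ?J) ** transpose ?J ** h ?x) ** ?J)"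
    by (simp add: components_frame matrix_mul_assoc)
  also have "\<dots> = trace ((?J ** matrix_inv (transpose ?J ** g ?x ** ?J) ** transpose ?J) ** h ?x)"
    by (subst trace_mul_sym) (simp add: matrix_mul_assoc)
  also have "\<dots> = trace (matrix_inv (g ?x) ** h ?x)"
    by (subst matrix_inv_congruence[OF frame_invertible[OF assms(1,2)] assms(3)]) simp
  finally show ?thesis .
qed

lemma components_posdef:
  "c \<in> A \<Longrightarrow> y \<in> chart_range c \<Longrightarrow> posdef (g (chart_inv c y)) \<Longrightarrow> posdef (components A c g y)"
  unfolding components_frame by (intro posdef_congruence frame_invertible)

lemma posdef_componentsD:
  assumes "c \<in> A" "y \<in> chart_range c" "posdef (components A c g y)"
  shows "posdef (g (chart_inv c y))"
proof -
  let ?J = "frame c y"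
  let ?K = "matrix_inv ?J"
  note J = matrix_inv_works[OF frame_invertible[OF assms(1,2)]]
  have JT: "transpose ?K ** transpose ?J = mat 1"
    by (metis J(1) matrix_transpose_mul transpose_mat)
  have "posdef (transpose ?K ** components A c g y ** ?K)"
    by (intro posdef_congruence assms) (use J in \<open>auto simp: invertible_right_inverse\<close>)
  also have "transpose ?K ** components A c g y ** ?K
      = (transpose ?K ** transpose ?J) ** g (chart_inv c y) ** (?J ** ?K)"
    by (simp add: components_frame matrix_mul_assoc)
  also have "\<dots> = g (chart_inv c y)" by (simp add: J JT)
  finally show ?thesis .
qed

text \<open>Each determinant depends on the chart through the square of the Jacobian determinant, which
  cancels in the quotient; quotients of volume densities are therefore functions on the manifold.\<close>

lemma det_components_ratio:
  assumes "c \<in> A" "y \<in> chart_range c"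
  shows "det (components A c g y) / det (components A c h y) = det (g (chart_inv c y)) / det (h (chart_inv c y))"
  using frame_invertible[OF assms] by (simp add: components_frame det_mul invertible_det_nz)

lemma metricsD:
  assumes "g \<in> metrics A"
  shows "g \<in> sym_tensor_fields A" "posdef (g x)" "invertible (g x)"
  using assms posdef_invertible[of "g x"] by (auto simp: metrics_def posdef_def)

lemma components_cont:
  assumes "h \<in> sym_tensor_fields A" "c \<in> A"
  shows "continuous_on (chart_range c) (components A c h)"
  using smooth_on_continuous_iter[of "chart_range c" "components A c h" "[]"] assms
  by (simp add: sym_tensor_fields_def)

lemma continuous_on_charts:
  assumes "\<And>c. c \<in> A \<Longrightarrow> continuous_on (fst c) f"
  shows "continuous_on (UNIV :: 'a set) f"
proof -
  have "continuous_on (\<Union>c\<in>A. fst c) f"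
    by (intro continuous_on_open_UN chart_open assms)
  moreover have "(\<Union>c\<in>A. fst c) = UNIV" using chart_exists by auto
  ultimately show ?thesis by simp
qed

section \<open>The volume measure\<close>

text \<open>The Riemannian volume of one chart, transported to the manifold.  The default value off the chart
  range carries no mass.\<close>

definition chart_measure :: "('a, 'n) tensor_field \<Rightarrow> ('a, 'n) chart \<Rightarrow> 'a measure" where
  "chart_measure g c = distr
     (density lborel (\<lambda>y. ennreal (sqrt (det (components A c g y))) * indicator (chart_range c) y)) borel
     (\<lambda>y. if y \<in> chart_range c then chart_inv c y else undefined)"

lemma chart_inv_measurable:
  assumes "c \<in> A"
  shows "(\<lambda>y. if y \<in> chart_range c then chart_inv c y else undefined) \<in> borel_measurable borel"
  using assms chart_open chart_inv_cont by (intro borel_measurable_continuous_on_if) auto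

lemma chart_image_measurable:
  assumes "c \<in> A" "B \<in> sets borel" "B \<subseteq> fst c"
  shows "snd c ` B \<in> sets borel"
proof -
  let ?i = "\<lambda>y. if y \<in> chart_range c then chart_inv c y else undefined"
  have "snd c ` B = chart_range c \<inter> ?i -` B"
    using overlap_eq[OF assms(1), of B] assms(3) by (auto simp: Int_absorb1)
  also have "\<dots> \<in> sets borel"
    using measurable_sets[OF chart_inv_measurable[OF assms(1)] assms(2)] chart_open[OF assms(1)]
    by (intro sets.Int) auto
  finally show ?thesis .
qed

lemma dens_measurable:
  assumes "c \<in> A" "g \<in> sym_tensor_fields A" "S \<in> sets borel" "S \<subseteq> chart_range c"
  shows "(\<lambda>y. indicator S y * sqrt (det (components A c g y))) \<in> borel_measurable borel"
proof -
  have "(\<lambda>y. if y \<in> S then sqrt (det (components A c g y)) else 0) \<in> borel_measurable borel"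
    by (intro borel_measurable_continuous_on_if assms continuous_intros
          continuous_on_subset[OF components_cont[OF assms(2,1)]])
  also have "(\<lambda>y. if y \<in> S then sqrt (det (components A c g y)) else 0)
      = (\<lambda>y. indicator S y * sqrt (det (components A c g y)))" by (auto simp: indicator_def)
  finally show ?thesis .
qed

lemma ennreal_dens_measurable:
  assumes "c \<in> A" "g \<in> sym_tensor_fields A"
  shows "(\<lambda>y. ennreal (sqrt (det (components A c g y))) * indicator (chart_range c) y) \<in> borel_measurable borel"
proof -
  have "(\<lambda>y. ennreal (indicator (chart_range c) y * sqrt (det (components A c g y)))) \<in> borel_measurable borel"
    using dens_measurable[OF assms, of "chart_range c"] chart_open[OF assms(1)] by simp
  also have "(\<lambda>y. ennreal (indicator (chart_range c) y * sqrt (det (components A c g y))))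
     = (\<lambda>y. ennreal (sqrt (det (components A c g y))) * indicator (chart_range c) y)"
    by (auto simp: indicator_def)
  finally show ?thesis .
qed

lemma nn_integral_chart_measure:
  assumes "c \<in> A" "g \<in> sym_tensor_fields A" "f \<in> borel_measurable borel" "B \<in> sets borel" "B \<subseteq> fst c"
  shows "(\<integral>\<^sup>+x. f x * indicator B x \<partial>chart_measure g c)
    = (\<integral>\<^sup>+y. ennreal (sqrt (det (components A c g y))) * f (chart_inv c y) * indicator (snd c ` B) y \<partial>lborel)"
proof -
  let ?i = "\<lambda>y. if y \<in> chart_range c then chart_inv c y else undefined"
  have *: "snd c ` B = chart_range c \<inter> chart_inv c -` B"
    using overlap_eq[OF assms(1), of B] assms(5) by (auto simp: Int_absorb1)
  have [measurable]: "?i \<in> borel_measurable borel" by (rule chart_inv_measurable[OF assms(1)])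
  note [measurable] = assms(3,4) ennreal_dens_measurable[OF assms(1,2)]
  have "(\<integral>\<^sup>+x. f x * indicator B x \<partial>chart_measure g c)
     = (\<integral>\<^sup>+y. ennreal (sqrt (det (components A c g y))) * indicator (chart_range c) y *
         (f (?i y) * indicator B (?i y)) \<partial>lborel)"
    unfolding chart_measure_def by (subst nn_integral_distr) (auto simp: nn_integral_density)
  also have "\<dots> = (\<integral>\<^sup>+y. ennreal (sqrt (det (components A c g y))) * f (chart_inv c y) * indicator (snd c ` B) y \<partial>lborel)"
    unfolding * by (intro nn_integral_cong) (auto simp: indicator_def)
  finally show ?thesis .
qed

lemma emeasure_chart_measure:
  assumes "c \<in> A" "g \<in> sym_tensor_fields A" "B \<in> sets borel" "B \<subseteq> fst c"
  shows "emeasure (chart_measure g c) B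
    = (\<integral>\<^sup>+y. ennreal (sqrt (det (components A c g y))) * indicator (snd c ` B) y \<partial>lborel)"
proof -
  have "emeasure (chart_measure g c) B = (\<integral>\<^sup>+x. 1 * indicator B x \<partial>chart_measure g c)"
    using assms by (simp add: chart_measure_def)
  then show ?thesis
    by (subst (asm) nn_integral_chart_measure) (use assms in auto)
qed

text \<open>The volume densities of two charts differ by the factor \<open>\<bar>det J\<bar>\<close> that the change of variables
  produces.\<close>

lemma chart_measure_overlap:
  assumes c: "c \<in> A" and d: "d \<in> A" and g: "g \<in> metrics A"
    and B: "B \<in> sets borel" "B \<subseteq> fst c" "B \<subseteq> fst d"
  shows "emeasure (chart_measure g c) B = emeasure (chart_measure g d) B"
proof -
  let ?\<tau> = "snd d \<circ> chart_inv c"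
  let ?dens = "\<lambda>c y. sqrt (det (components A c g y))"
  define F where "F z = (if z \<in> chart_range d then ?dens d z else 0)" for z
  have gE: "g \<in> sym_tensor_fields A" by (rule metricsD[OF g])
  have mB: "snd c ` B \<in> sets borel" "snd d ` B \<in> sets borel"
    by (rule chart_image_measurable; use c d B in simp)+
  have sub: "snd c ` B \<subseteq> chart_range c" "snd d ` B \<subseteq> chart_range d"
    using B(2,3) by (auto simp: chart_range_def)
  have img: "?\<tau> ` snd c ` B = snd d ` B"
    using B(2) c by (force simp: image_image)
  have pos: "det (components A e g y) > 0" if "e \<in> A" "y \<in> chart_range e" for e y
    by (intro posdef_det_pos components_posdef metricsD that g)
  have mem: "y \<in> chart_range c" "chart_inv c y \<in> fst d" "?\<tau> y \<in> chart_range d" if "y \<in> snd c ` B" for y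
  proof -
    obtain x where x: "y = snd c x" "x \<in> B" using \<open>y \<in> snd c ` B\<close> by auto
    then have "x \<in> fst c" "x \<in> fst d" using B by auto
    then show "y \<in> chart_range c" "chart_inv c y \<in> fst d" "?\<tau> y \<in> chart_range d"
      using x c d by auto
  qed
  have dens: "\<bar>det (matrix ((*v) (jac c d y)))\<bar> * F (?\<tau> y) = ?dens c y" if "y \<in> snd c ` B" for y
    using components_transition[OF c d mem(1,2)[OF that], of g] mem(3)[OF that]
    by (simp add: F_def det_mul real_sqrt_mult matrix_of_matrix_vector_mul)
  have "emeasure (chart_measure g c) B = (\<integral>\<^sup>+y. ennreal (indicator (snd c ` B) y *
      (\<bar>det (matrix ((*v) (jac c d y)))\<bar> * F (?\<tau> y))) \<partial>lborel)"
    unfolding emeasure_chart_measure[OF c gE B(1,2)]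
    using dens by (intro nn_integral_cong) (auto simp: indicator_def)
  also have "\<dots> = (\<integral>\<^sup>+z. ennreal (indicator (?\<tau> ` snd c ` B) z * F z) \<partial>lborel)"
  proof (rule nn_integral_change_of_variables[where B = "snd c ` B" and \<tau> = ?\<tau> and F = F
        and \<tau>' = "\<lambda>y. (*v) (jac c d y)"])
    show "(?\<tau> has_derivative (*v) (jac c d y)) (at y)" if "y \<in> snd c ` B" for y
      using mem[OF that] by (intro transition_has_derivative c d)
    show "inj_on ?\<tau> (snd c ` B)"
    proof (rule inj_onI)
      fix y z assume "y \<in> snd c ` B" "z \<in> snd c ` B" and eq: "?\<tau> y = ?\<tau> z"
      then show "y = z"
        using mem c d by (metis chart_simps(1,2) comp_apply)
    qed
    show "F x \<ge> 0" for x using pos[OF d] by (simp add: F_def less_imp_le)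
    show "(\<lambda>x. indicat_real (snd c ` B) x * (\<bar>det (matrix ((*v) (jac c d x)))\<bar> * F (?\<tau> x))) \<in> borel_measurable borel"
      by (rule measurable_cong[THEN iffD2, OF _ dens_measurable[OF c gE mB(1) sub(1)]])
         (use dens in \<open>auto simp: indicator_def\<close>)
    show "(\<lambda>y. indicat_real (?\<tau> ` snd c ` B) y * F y) \<in> borel_measurable borel"
      unfolding img
      by (rule measurable_cong[THEN iffD2, OF _ dens_measurable[OF d gE mB(2) sub(2)]])
         (use sub in \<open>auto simp: indicator_def F_def\<close>)
  qed (rule mB)
  also have "\<dots> = emeasure (chart_measure g d) B"
    unfolding img emeasure_chart_measure[OF d gE B(1,3)]
    using sub by (intro nn_integral_cong) (auto simp: indicator_def F_def)
  finally show ?thesis .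
qed

text \<open>The property of which \<open>vol A g\<close> is the definite description; the description denotes because
  there is exactly one such measure.\<close>

definition is_vol :: "('a, 'n) tensor_field \<Rightarrow> 'a measure \<Rightarrow> bool" where
  "is_vol g \<mu> \<longleftrightarrow> sets \<mu> = sets borel \<and>
     (\<forall>c\<in>A. \<forall>B\<in>sets borel. B \<subseteq> fst c \<longrightarrow>
        emeasure \<mu> B =
          (\<integral>\<^sup>+ y. ennreal (sqrt (det (components A c g y))) * indicator (snd c ` B) y \<partial>lborel))"

lemma is_volD:
  "is_vol g \<mu> \<Longrightarrow> c \<in> A \<Longrightarrow> B \<in> sets borel \<Longrightarrow> B \<subseteq> fst c \<Longrightarrow> emeasure \<mu> B =
     (\<integral>\<^sup>+ y. ennreal (sqrt (det (components A c g y))) * indicator (snd c ` B) y \<partial>lborel)"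
  by (simp add: is_vol_def)

lemma chart_partition:
  obtains N :: nat and cs :: "nat \<Rightarrow> ('a, 'n) chart" and D :: "nat \<Rightarrow> 'a set"
  where "\<forall>i<N. cs i \<in> A \<and> D i \<in> sets borel \<and> D i \<subseteq> fst (cs i)"
    "disjoint_family_on D {..<N}" "(\<Union>i<N. D i) = UNIV"
proof -
  have "UNIV \<subseteq> (\<Union>c\<in>A. fst c)" using chart_exists by auto
  then obtain C where C: "C \<subseteq> A" "finite C" "UNIV \<subseteq> (\<Union>c\<in>C. fst c)"
    using compactE_image[OF compact_UNIV', of A fst] chart_open by metis
  obtain cs N where cs: "C = cs ` {i. i < (N::nat)}"
    using finite_imp_nat_seg_image_inj_on[OF C(2)] by metis
  define D where "D i = fst (cs i) - (\<Union>j<i. fst (cs j))" for i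
  have csA: "cs i \<in> A" if "i < N" for i using that C(1) cs by auto
  show ?thesis
  proof (rule that[of N cs D])
    have "D i \<in> sets borel" if "i < N" for i
      unfolding D_def using that csA chart_open(1)
      by (intro sets.Diff borel_open open_UN ballI) auto
    then show "\<forall>i<N. cs i \<in> A \<and> D i \<in> sets borel \<and> D i \<subseteq> fst (cs i)"
      using csA by (auto simp: D_def)
    show "disjoint_family_on D {..<N}"
      unfolding disjoint_family_on_def
    proof (intro ballI impI)
      fix m n :: nat assume "m \<noteq> n"
      then consider "m < n" | "n < m" by linarith
      then show "D m \<inter> D n = {}" by cases (auto simp: D_def)
    qed
    show "(\<Union>i<N. D i) = UNIV"
    proof (intro equalityI subset_UNIV subsetI)
      fix x :: 'a
      have "x \<in> (\<Union>c\<in>C. fst c)" using C(3) by blast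
      then have ex: "\<exists>i. i < N \<and> x \<in> fst (cs i)" by (auto simp: cs)
      define i where "i = (LEAST i. i < N \<and> x \<in> fst (cs i))"
      have i: "i < N" "x \<in> fst (cs i)" using LeastI_ex[OF ex] by (auto simp: i_def)
      moreover have "x \<notin> fst (cs j)" if "j < i" for j
        using not_less_Least[of j "\<lambda>i. i < N \<and> x \<in> fst (cs i)"] that i(1) by (auto simp: i_def)
      ultimately show "x \<in> (\<Union>i<N. D i)" by (auto simp: D_def)
    qed
  qed
qed

lemma is_vol_unique:
  assumes "is_vol g \<mu>" "is_vol g \<nu>"
  shows "\<mu> = \<nu>"
proof -
  obtain N :: nat and cs :: "nat \<Rightarrow> ('a, 'n) chart" and D :: "nat \<Rightarrow> 'a set" where P0: "\<forall>i<N. cs i \<in> A \<and> D i \<in> sets borel \<and> D i \<subseteq> fst (cs i)"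
    and P45: "disjoint_family_on D {..<N}" "(\<Union>i<N. D i) = UNIV"
    by (rule chart_partition)
  have P: "cs i \<in> A" "D i \<in> sets borel" "D i \<subseteq> fst (cs i)" if "i < N" for i using P0 that by auto
  have disj: "disjoint_family_on (\<lambda>i. B \<inter> D i) {..<N}" for B
    using P45(1) unfolding disjoint_family_on_def by blast
  have sum: "emeasure \<kappa> B = (\<Sum>i<N. emeasure \<kappa> (B \<inter> D i))"
    if "sets \<kappa> = sets borel" "B \<in> sets borel" for \<kappa> B
  proof -
    have "(\<Sum>i<N. emeasure \<kappa> (B \<inter> D i)) = emeasure \<kappa> (\<Union>i<N. B \<inter> D i)"
      using that P(2) disj[of B] by (intro sum_emeasure) auto
    also have "(\<Union>i<N. B \<inter> D i) = B" using P45(2) by auto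
    finally show ?thesis by simp
  qed
  show ?thesis
  proof (rule measure_eqI)
    show "sets \<mu> = sets \<nu>" using assms by (simp add: is_vol_def)
    fix B assume "B \<in> sets \<mu>"
    then have B: "B \<in> sets borel" using assms by (simp add: is_vol_def)
    have "emeasure \<mu> (B \<inter> D i) = emeasure \<nu> (B \<inter> D i)" if "i < N" for i
    proof -
      have "B \<inter> D i \<in> sets borel" "B \<inter> D i \<subseteq> fst (cs i)" using B P(2,3)[OF that] by auto
      then show ?thesis
        using is_volD[OF assms(1) P(1)[OF that]] is_volD[OF assms(2) P(1)[OF that]] by simp
    qed
    then show "emeasure \<mu> B = emeasure \<nu> B"
      using sum B assms by (simp add: is_vol_def)
  qed
qed

text \<open>The chart measures are glued along a finite partition subordinate to the charts; by the overlap
  property the result restricts to the measure of every chart, not only of those used.\<close>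

lemma is_vol_exists:
  assumes g: "g \<in> metrics A"
  shows "\<exists>\<mu>. is_vol g \<mu>"
proof -
  obtain N :: nat and cs :: "nat \<Rightarrow> ('a, 'n) chart" and D :: "nat \<Rightarrow> 'a set" where P0: "\<forall>i<N. cs i \<in> A \<and> D i \<in> sets borel \<and> D i \<subseteq> fst (cs i)"
    and P45: "disjoint_family_on D {..<N}" "(\<Union>i<N. D i) = UNIV"
    by (rule chart_partition)
  have P: "cs i \<in> A" "D i \<in> sets borel" "D i \<subseteq> fst (cs i)" if "i < N" for i using P0 that by auto
  have disj: "disjoint_family_on (\<lambda>i. B \<inter> D i) {..<N}" for B
    using P45(1) unfolding disjoint_family_on_def by blast
  have gE: "g \<in> sym_tensor_fields A" by (rule metricsD[OF g])
  let ?m = "\<lambda>i. chart_measure g (cs i)"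
  let ?f = "\<lambda>B. \<Sum>i<N. emeasure (?m i) (B \<inter> D i)"
  have sets_m [simp]: "sets (?m i) = sets borel" for i by (simp add: chart_measure_def)
  define \<mu> where "\<mu> = measure_of UNIV (sets (borel :: 'a measure)) ?f"
  have sets_\<mu>: "sets \<mu> = sets borel"
    unfolding \<mu>_def using sets.space_closed[of borel] sets.sigma_sets_eq[of borel] by (simp add: sets_measure_of)
  have em: "emeasure \<mu> B = ?f B" if "B \<in> sets borel" for B
  proof (rule emeasure_measure_of[OF \<mu>_def])
    show "sets (borel :: 'a measure) \<subseteq> Pow UNIV" by simp
    show "B \<in> sets \<mu>" using that sets_\<mu> by simp
    show "positive (sets \<mu>) ?f" by (simp add: positive_def)
    show "countably_additive (sets \<mu>) ?f"
      unfolding countably_additive_def sets_\<mu>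
    proof (intro allI impI)
      fix X :: "nat \<Rightarrow> 'a set"
      assume X: "range X \<subseteq> sets borel" "disjoint_family X"
      have "(\<Sum>n. ?f (X n)) = (\<Sum>i<N. \<Sum>n. emeasure (?m i) (X n \<inter> D i))"
        by (rule suminf_sum) auto
      also have "\<dots> = (\<Sum>i<N. emeasure (?m i) (\<Union>n. X n \<inter> D i))"
      proof (intro sum.cong refl suminf_emeasure)
        fix i assume "i \<in> {..<N}"
        then show "range (\<lambda>n. X n \<inter> D i) \<subseteq> sets (?m i)" using X(1) P(2) by auto
        show "disjoint_family (\<lambda>n. X n \<inter> D i)" using X(2) by (auto simp: disjoint_family_on_def)
      qed
      finally show "(\<Sum>n. ?f (X n)) = ?f (\<Union>n. X n)" by simp
    qed
  qed
  have "is_vol g \<mu>"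
    unfolding is_vol_def
  proof (intro conjI ballI impI sets_\<mu>)
    fix c B assume c: "c \<in> A" and B: "B \<in> sets borel" "B \<subseteq> fst c"
    have "emeasure \<mu> B = (\<Sum>i<N. emeasure (chart_measure g c) (B \<inter> D i))"
      unfolding em[OF B(1)]
    proof (intro sum.cong refl)
      fix i assume "i \<in> {..<N}"
      then show "emeasure (?m i) (B \<inter> D i) = emeasure (chart_measure g c) (B \<inter> D i)"
        using P(1-3)[of i] B c g by (intro chart_measure_overlap) auto
    qed
    also have "\<dots> = emeasure (chart_measure g c) (\<Union>i<N. B \<inter> D i)"
      using B P(2) disj[of B] by (intro sum_emeasure) (auto simp: chart_measure_def)
    also have "(\<Union>i<N. B \<inter> D i) = B" using P45(2) by auto
    finally show "emeasure \<mu> B =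
          (\<integral>\<^sup>+ y. ennreal (sqrt (det (components A c g y))) * indicator (snd c ` B) y \<partial>lborel)"
      by (simp add: emeasure_chart_measure[OF c gE B])
  qed
  then show ?thesis by blast
qed

lemma is_vol_vol:
  assumes "g \<in> metrics A"
  shows "is_vol g (vol A g)"
proof -
  obtain \<mu> where \<mu>: "is_vol g \<mu>" using is_vol_exists[OF assms] by blast
  have "is_vol g (THE \<mu>. is_vol g \<mu>)"
    by (rule theI[of "is_vol g", OF \<mu>]) (rule is_vol_unique[OF _ \<mu>])
  then show ?thesis unfolding vol_def is_vol_def .
qed

lemma vol_eqI: "g \<in> metrics A \<Longrightarrow> is_vol g \<mu> \<Longrightarrow> vol A g = \<mu>"
  using is_vol_vol is_vol_unique by blast

lemma sets_vol [simp]: "g \<in> metrics A \<Longrightarrow> sets (vol A g) = sets borel"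
  using is_vol_vol by (simp add: is_vol_def)

lemma space_vol [simp]: "g \<in> metrics A \<Longrightarrow> space (vol A g) = UNIV"
  using sets_eq_imp_space_eq[OF sets_vol] by simp

lemma emeasure_vol:
  assumes "g \<in> metrics A" "c \<in> A" "B \<in> sets borel" "B \<subseteq> fst c"
  shows "emeasure (vol A g) B = emeasure (chart_measure g c) B"
  using is_volD[OF is_vol_vol[OF assms(1)] assms(2-)]
    emeasure_chart_measure[OF assms(2) metricsD(1)[OF assms(1)] assms(3,4)] by simp

lemma nn_integral_vol:
  assumes g: "g \<in> metrics A" and c: "c \<in> A" and f: "f \<in> borel_measurable borel"
    and B: "B \<in> sets borel" "B \<subseteq> fst c"
  shows "(\<integral>\<^sup>+x. f x * indicator B x \<partial>vol A g)
    = (\<integral>\<^sup>+y. ennreal (sqrt (det (components A c g y))) * f (chart_inv c y) * indicator (snd c ` B) y \<partial>lborel)"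
proof -
  have "density (vol A g) (indicator B) = density (chart_measure g c) (indicator B)"
  proof (rule measure_eqI)
    fix X assume "X \<in> sets (density (vol A g) (indicator B))"
    then have X: "X \<in> sets borel" using g by simp
    have BX: "B \<inter> X \<in> sets borel" "B \<inter> X \<subseteq> fst c" using X B by auto
    have *: "emeasure (density \<kappa> (indicator B)) X = emeasure \<kappa> (B \<inter> X)"
      if "sets \<kappa> = sets borel" for \<kappa> :: "'a measure"
    proof -
      have "emeasure (density \<kappa> (indicator B)) X = (\<integral>\<^sup>+x. indicator B x * indicator X x \<partial>\<kappa>)"
        by (rule emeasure_density) (use that X B measurable_cong_sets[OF that refl] in auto)
      also have "\<dots> = (\<integral>\<^sup>+x. indicator (B \<inter> X) x \<partial>\<kappa>)"
        by (simp add: indicator_inter_arith)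
      finally show ?thesis using that BX by simp
    qed
    show "emeasure (density (vol A g) (indicator B)) X = emeasure (density (chart_measure g c) (indicator B)) X"
      using emeasure_vol[OF g c BX] g by (simp add: * chart_measure_def)
  qed (simp add: g chart_measure_def)
  moreover have int: "(\<integral>\<^sup>+x. f x \<partial>density \<kappa> (indicator B)) = (\<integral>\<^sup>+x. f x * indicator B x \<partial>\<kappa>)"
    if "sets \<kappa> = sets borel" for \<kappa> :: "'a measure"
    by (subst nn_integral_density)
       (use f B that measurable_cong_sets[OF that refl] in
         \<open>auto simp: mult.commute intro!: borel_measurable_indicator\<close>)
  ultimately have "(\<integral>\<^sup>+x. f x * indicator B x \<partial>vol A g) = (\<integral>\<^sup>+x. f x * indicator B x \<partial>chart_measure g c)"
    using int[OF sets_vol[OF g]] int[of "chart_measure g c"] by (simp add: chart_measure_def)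
  then show ?thesis
    by (simp add: nn_integral_chart_measure[OF c metricsD(1)[OF g] f B])
qed

lemma continuous_on_det_ratio:
  assumes "g \<in> metrics A" "g0 \<in> metrics A"
  shows "continuous_on UNIV (\<lambda>x. sqrt (det (g x) / det (g0 x)))"
proof (rule continuous_on_charts)
  fix c assume c: "c \<in> A"
  have comp: "continuous_on (fst c) (\<lambda>x. components A c h (snd c x))" if "h \<in> metrics A" for h
    by (rule continuous_on_compose2[OF components_cont[OF metricsD(1)[OF that] c] chart_cont[OF c]]) auto
  have "continuous_on (fst c) (\<lambda>x. sqrt (det (components A c g (snd c x)) / det (components A c g0 (snd c x))))"
  proof (intro continuous_intros)
    from comp show "continuous_on (fst c) (\<lambda>x. components A c g (snd c x))"
       "continuous_on (fst c) (\<lambda>x. components A c g0 (snd c x))" using assms by auto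
    show "\<forall>x\<in>fst c. det (components A c g0 (snd c x)) \<noteq> 0"
      using assms c by (metis chart_simps(4) components_posdef less_irrefl metricsD(2) posdef_det_pos)
  qed
  then show "continuous_on (fst c) (\<lambda>x. sqrt (det (g x) / det (g0 x)))"
    by (rule continuous_on_eq) (use c in \<open>simp add: det_components_ratio\<close>)
qed

text \<open>All volume measures are densities with respect to a fixed one.  Dependence on the metric is thus
  moved from the measure into the integrand.\<close>

lemma vol_density:
  assumes g: "g \<in> metrics A" and g0: "g0 \<in> metrics A"
  shows "vol A g = density (vol A g0) (\<lambda>x. ennreal (sqrt (det (g x) / det (g0 x))))"
proof (rule vol_eqI[OF g])
  let ?\<rho> = "\<lambda>x. ennreal (sqrt (det (g x) / det (g0 x)))"
  have m: "?\<rho> \<in> borel_measurable borel"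
    using borel_measurable_continuous_onI[OF continuous_on_det_ratio[OF g g0]] by measurable
  have m': "?\<rho> \<in> borel_measurable (vol A g0)"
    using m measurable_cong_sets[OF sets_vol[OF g0] refl] by blast
  show "is_vol g (density (vol A g0) ?\<rho>)"
    unfolding is_vol_def
  proof (intro conjI ballI impI)
    fix c B assume c: "c \<in> A" and B: "B \<in> sets borel" "B \<subseteq> fst c"
    have "emeasure (density (vol A g0) ?\<rho>) B = (\<integral>\<^sup>+x. ?\<rho> x * indicator B x \<partial>vol A g0)"
      using m' B g0 by (intro emeasure_density) auto
    also have "\<dots> = (\<integral>\<^sup>+y. ennreal (sqrt (det (components A c g0 y))) * ?\<rho> (chart_inv c y) * indicator (snd c ` B) y \<partial>lborel)"
      by (rule nn_integral_vol[OF g0 c m B])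
    also have "\<dots> = (\<integral>\<^sup>+ y. ennreal (sqrt (det (components A c g y))) * indicator (snd c ` B) y \<partial>lborel)"
    proof (rule nn_integral_cong)
      fix y
      show "ennreal (sqrt (det (components A c g0 y))) * ?\<rho> (chart_inv c y) * indicator (snd c ` B) y
          = ennreal (sqrt (det (components A c g y))) * indicator (snd c ` B) y"
      proof (cases "y \<in> snd c ` B")
        case True
        then have y: "y \<in> chart_range c" using B(2) by (auto simp: chart_range_def)
        have pos: "det (components A c h y) > 0" if "h \<in> metrics A" for h
          by (intro posdef_det_pos components_posdef metricsD that c y)
        have "sqrt (det (components A c g0 y)) * sqrt (det (components A c g y) / det (components A c g0 y))
            = sqrt (det (components A c g y))"
          using pos[OF g0] by (simp add: real_sqrt_mult[symmetric])
        then show ?thesis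
          using pos[OF g] pos[OF g0]
          by (simp add: ennreal_mult[symmetric] det_components_ratio[OF c y, symmetric])
      qed simp
    qed
    finally show "emeasure (density (vol A g0) ?\<rho>) B = (\<integral>\<^sup>+ y. ennreal (sqrt (det (components A c g y))) * indicator (snd c ` B) y \<partial>lborel)" .
  qed (simp add: g0)
qed

lemma finite_measure_vol:
  assumes g: "g \<in> metrics A"
  shows "finite_measure (vol A g)"
proof
  have "\<exists>U. open U \<and> x \<in> U \<and> emeasure (vol A g) U < \<infinity>" for x
  proof -
    obtain c where c: "c \<in> A" "x \<in> fst c" using chart_exists by blast
    obtain r where r: "r > 0" "cball (snd c x) r \<subseteq> chart_range c"
      using chart_open(2)[OF c(1)] chart_simps(4)[OF c(2)] by (meson open_contains_cball)
    let ?f = "\<lambda>y. sqrt (det (components A c g y))"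
    have "continuous_on (cball (snd c x) r) ?f"
      by (intro continuous_intros continuous_on_subset[OF components_cont[OF metricsD(1)[OF g] c(1)] r(2)])
    then have "bounded (?f ` cball (snd c x) r)"
      by (intro compact_imp_bounded compact_continuous_image) auto
    then obtain K where "\<forall>y\<in>cball (snd c x) r. \<bar>?f y\<bar> \<le> K"
      by (auto simp: bounded_iff)
    then have K: "\<bar>?f y\<bar> \<le> K" if "y \<in> cball (snd c x) r" for y using that by blast
    define U where "U = fst c \<inter> snd c -` ball (snd c x) r"
    have U: "open U" "x \<in> U" "U \<subseteq> fst c"
      unfolding U_def using r c
      by (auto intro!: continuous_open_preimage chart_cont chart_open)
    have "emeasure (vol A g) U = (\<integral>\<^sup>+ y. ennreal (?f y) * indicator (snd c ` U) y \<partial>lborel)"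
      using emeasure_chart_measure[OF c(1) metricsD(1)[OF g], of U] emeasure_vol[OF g c(1), of U] U
      by auto
    also have "\<dots> \<le> (\<integral>\<^sup>+ y. ennreal K * indicator (cball (snd c x) r) y \<partial>lborel)"
    proof (rule nn_integral_mono)
      fix y
      show "ennreal (?f y) * indicator (snd c ` U) y \<le> ennreal K * indicator (cball (snd c x) r) y"
      proof (cases "y \<in> snd c ` U")
        case True
        then have y: "y \<in> cball (snd c x) r" by (auto simp: U_def)
        then have "?f y \<le> K" using K[of y] by linarith
        then show ?thesis using y True by (simp add: ennreal_leI)
      qed simp
    qed
    also have "\<dots> = ennreal K * emeasure lborel (cball (snd c x) r)"
      by (rule nn_integral_cmult_indicator) simp
    also have "\<dots> < \<infinity>"
      using emeasure_lborel_cball_finite[of "snd c x" r] by (simp add: ennreal_mult_less_top)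
    finally show ?thesis using U by blast
  qed
  then obtain U where U: "\<And>x. open (U x)" "\<And>x. x \<in> U x" "\<And>x. emeasure (vol A g) (U x) < \<infinity>" by metis
  have "(UNIV :: 'a set) \<subseteq> (\<Union>x\<in>UNIV. U x)" using U(2) by auto
  then obtain C where C: "finite C" "UNIV \<subseteq> (\<Union>x\<in>C. U x)"
    using compactE_image[OF compact_UNIV', of UNIV U] U(1) by metis
  have "emeasure (vol A g) (space (vol A g)) \<le> emeasure (vol A g) (\<Union>x\<in>C. U x)"
    using C(2) g U(1) C(1) by (intro emeasure_mono) auto
  also have "\<dots> \<le> (\<Sum>x\<in>C. emeasure (vol A g) (U x))"
    using C(1) U(1) g by (intro emeasure_subadditive_finite) auto
  also have "\<dots> < \<infinity>" using U(3) C(1) by (simp add: less_top[symmetric])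
  finally show "emeasure (vol A g) (space (vol A g)) \<noteq> \<infinity>" by simp
qed

end


lemma has_vector_derivative_iff_quotient:
  fixes f :: "real \<Rightarrow> 'b::real_normed_vector"
  shows "(f has_vector_derivative D) (at t) \<longleftrightarrow> ((\<lambda>s. (1 / s) *\<^sub>R (f (t + s) - f t)) \<longlongrightarrow> D) (at 0)"
proof -
  have "(f has_vector_derivative D) (at t) \<longleftrightarrow>
      ((\<lambda>h. norm (f (t + h) - f t - h *\<^sub>R D) / norm h) \<longlongrightarrow> 0) (at 0)"
    by (simp add: has_vector_derivative_def has_derivative_at bounded_linear_scaleR_left)
  also have "\<dots> \<longleftrightarrow> ((\<lambda>s. norm ((1 / s) *\<^sub>R (f (t + s) - f t) - D)) \<longlongrightarrow> 0) (at 0)"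
  proof (rule filterlim_cong[OF refl refl], rule eventually_at_filter[THEN iffD2], rule always_eventually, safe)
    fix s :: real assume "s \<noteq> 0"
    then have "norm ((1 / s) *\<^sub>R (f (t + s) - f t) - D) = norm ((1 / s) *\<^sub>R (f (t + s) - f t - s *\<^sub>R D))"
      by (simp add: algebra_simps)
    also have "\<dots> = norm (f (t + s) - f t - s *\<^sub>R D) / norm s"
      by simp
    finally show "norm (f (t + s) - f t - s *\<^sub>R D) / norm s = norm ((1 / s) *\<^sub>R (f (t + s) - f t) - D)" ..
  qed
  also have "\<dots> \<longleftrightarrow> ((\<lambda>s. (1 / s) *\<^sub>R (f (t + s) - f t)) \<longlongrightarrow> D) (at 0)"
    by (simp add: tendsto_norm_zero_iff flip: LIM_zero_iff[of _ D])
  finally show ?thesis .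
qed

context compact_manifold
begin

section \<open>The space of symmetric tensor fields\<close>

abbreviation "E \<equiv> sym_tensor_fields A"
abbreviation "TT \<equiv> tensor_topology A"

definition tensor_smooth :: "('a, 'n) tensor_field \<Rightarrow> bool" where
  "tensor_smooth h \<longleftrightarrow> (\<forall>c\<in>A. smooth_on (chart_range c) (components A c h))"

definition scalar_smooth :: "('a \<Rightarrow> real) \<Rightarrow> bool" where
  "scalar_smooth f \<longleftrightarrow> (\<forall>c\<in>A. smooth_on (chart_range c) (\<lambda>y. f (chart_inv c y)))"

lemma E_iff: "h \<in> E \<longleftrightarrow> (\<forall>x. transpose (h x) = h x) \<and> tensor_smooth h"
  by (auto simp: sym_tensor_fields_def tensor_smooth_def)

lemma E_sym: "h \<in> E \<Longrightarrow> transpose (h x) = h x"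
  by (simp add: E_iff)

lemma tensor_smooth_add:
  assumes "tensor_smooth h" "tensor_smooth k"
  shows "tensor_smooth (\<lambda>x. h x + k x)"
  unfolding tensor_smooth_def
proof
  fix c assume c: "c \<in> A"
  have "smooth_on (chart_range c) (\<lambda>y. components A c h y + components A c k y)"
    by (rule smooth_on_add) (use assms c chart_open in \<open>auto simp: tensor_smooth_def\<close>)
  moreover have "components A c (\<lambda>x. h x + k x) = (\<lambda>y. components A c h y + components A c k y)"
    by (rule ext) (rule components_add)
  ultimately show "smooth_on (chart_range c) (components A c (\<lambda>x. h x + k x))" by simp
qed

lemma tensor_smooth_scale:
  assumes "scalar_smooth f" "tensor_smooth h"
  shows "tensor_smooth (\<lambda>x. f x *\<^sub>R h x)"
  unfolding tensor_smooth_def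
proof
  fix c assume c: "c \<in> A"
  have "smooth_on (chart_range c) (\<lambda>y. f (chart_inv c y) *\<^sub>R components A c h y)"
    by (rule smooth_on_bilinear[OF bounded_bilinear_scaleR])
       (use assms c chart_open in \<open>auto simp: tensor_smooth_def scalar_smooth_def\<close>)
  moreover have "components A c (\<lambda>x. f x *\<^sub>R h x) = (\<lambda>y. f (chart_inv c y) *\<^sub>R components A c h y)"
    by (rule ext) (rule components_scaleR)
  ultimately show "smooth_on (chart_range c) (components A c (\<lambda>x. f x *\<^sub>R h x))" by simp
qed

lemma components_invertible:
  assumes "c \<in> A" "y \<in> chart_range c" "invertible (g (chart_inv c y))"
  shows "invertible (components A c g y)"
  using frame_invertible[OF assms(1,2)] assms(3)
  by (simp add: components_frame invertible_det_nz det_mul)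

lemma tensor_smooth_contract:
  assumes "tensor_smooth h" "tensor_smooth k" "g \<in> metrics A"
  shows "tensor_smooth (\<lambda>x. h x ** matrix_inv (g x) ** k x)"
  unfolding tensor_smooth_def
proof
  fix c assume c: "c \<in> A"
  have g: "smooth_on (chart_range c) (components A c g)"
    using metricsD(1)[OF assms(3)] c by (auto simp: E_iff tensor_smooth_def)
  have "smooth_on (chart_range c)
      (\<lambda>y. components A c h y ** matrix_inv (components A c g y) ** components A c k y)"
    by (intro smooth_on_bilinear[OF bounded_bilinear_matrix_mult] smooth_on_matrix_inv g
          components_invertible metricsD(3) assms(3) chart_open(2) c)
       (use assms(1,2) c in \<open>auto simp: tensor_smooth_def\<close>)
  then show "smooth_on (chart_range c) (components A c (\<lambda>x. h x ** matrix_inv (g x) ** k x))"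
    by (rule smooth_on_cong[OF chart_open(2)[OF c], rotated])
       (simp add: components_contract c metricsD(3)[OF assms(3)])
qed

lemma scalar_smooth_trace:
  assumes "tensor_smooth h" "g \<in> metrics A"
  shows "scalar_smooth (\<lambda>x. trace (matrix_inv (g x) ** h x))"
  unfolding scalar_smooth_def
proof
  fix c assume c: "c \<in> A"
  have g: "smooth_on (chart_range c) (components A c g)"
    using metricsD(1)[OF assms(2)] c by (auto simp: E_iff tensor_smooth_def)
  have "smooth_on (chart_range c)
      (\<lambda>y. trace (matrix_inv (components A c g y) ** components A c h y))"
    by (intro smooth_on_bounded_linear[OF bounded_linear_trace]
          smooth_on_bilinear[OF bounded_bilinear_matrix_mult] smooth_on_matrix_inv g
          components_invertible metricsD(3) assms(2) chart_open(2) c)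
       (use assms(1) c in \<open>auto simp: tensor_smooth_def\<close>)
  then show "smooth_on (chart_range c) (\<lambda>y. trace (matrix_inv (g (chart_inv c y)) ** h (chart_inv c y)))"
    by (rule smooth_on_cong[OF chart_open(2)[OF c], rotated])
       (simp add: trace_components c metricsD(3)[OF assms(2)])
qed

lemma scalar_smooth_const: "scalar_smooth (\<lambda>x. r)"
  by (simp add: scalar_smooth_def smooth_on_iff_Ck Ck_const)

lemma scalar_smooth_cmult:
  assumes "scalar_smooth f"
  shows "scalar_smooth (\<lambda>x. r * f x)"
  unfolding scalar_smooth_def
proof
  fix c assume c: "c \<in> A"
  show "smooth_on (chart_range c) (\<lambda>y. r * f (chart_inv c y))"
    by (rule smooth_on_bounded_linear[OF bounded_linear_mult_right chart_open(2)[OF c]])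
       (use assms c in \<open>simp add: scalar_smooth_def\<close>)
qed

lemma E_add: "h \<in> E \<Longrightarrow> k \<in> E \<Longrightarrow> (\<lambda>x. h x + k x) \<in> E"
  by (auto simp: E_iff tensor_smooth_add transpose_def vec_eq_iff)

lemma E_scale: "scalar_smooth f \<Longrightarrow> h \<in> E \<Longrightarrow> (\<lambda>x. f x *\<^sub>R h x) \<in> E"
  by (auto simp: E_iff tensor_smooth_scale transpose_def vec_eq_iff)

lemma E_plus: "h \<in> E \<Longrightarrow> k \<in> E \<Longrightarrow> h + k \<in> E"
  by (simp add: plus_fun_def E_add)

lemma E_scaleR: "h \<in> E \<Longrightarrow> r *\<^sub>R h \<in> E"
  unfolding scaleR_fun_def by (intro E_scale scalar_smooth_const)

lemma E_minus: "h \<in> E \<Longrightarrow> k \<in> E \<Longrightarrow> h - k \<in> E"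
  using E_plus[of h "(-1) *\<^sub>R k"] E_scaleR[of k "-1"] by simp

lemma E_diff: "h \<in> E \<Longrightarrow> k \<in> E \<Longrightarrow> (\<lambda>x. h x - k x) \<in> E"
  using E_minus[of h k] by (simp add: fun_diff_def)

lemma E_zero: "h \<in> E \<Longrightarrow> 0 \<in> E"
  using E_scaleR[of h 0] by simp

text \<open>Neither summand is symmetric by itself; transposition interchanges them.\<close>

lemma E_sym_contract:
  assumes "h \<in> E" "k \<in> E" "g \<in> metrics A"
  shows "(\<lambda>x. h x ** matrix_inv (g x) ** k x + k x ** matrix_inv (g x) ** h x) \<in> E"
proof -
  have "transpose (matrix_inv (g x)) = matrix_inv (g x)" for x
    using transpose_matrix_inv[OF metricsD(3)[OF assms(3)]] E_sym[OF metricsD(1)[OF assms(3)]] by simp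
  then have "transpose (h x ** matrix_inv (g x) ** k x) = k x ** matrix_inv (g x) ** h x"
    "transpose (k x ** matrix_inv (g x) ** h x) = h x ** matrix_inv (g x) ** k x" for x
    using E_sym[OF assms(1)] E_sym[OF assms(2)] by (simp_all add: matrix_transpose_mul matrix_mul_assoc)
  moreover have "transpose (X + Y) = transpose X + transpose Y" for X Y :: "real^'n^'n"
    by (simp add: transpose_def vec_eq_iff)
  ultimately show ?thesis
    using assms by (auto simp: E_iff add.commute intro!: tensor_smooth_add tensor_smooth_contract)
qed

lemma metrics_convex:
  assumes "g \<in> metrics A" "g' \<in> metrics A" "0 \<le> r" "r \<le> 1"
  shows "g + r *\<^sub>R (g' - g) \<in> metrics A"
proof -
  have "g + r *\<^sub>R (g' - g) \<in> E"
    using assms by (intro E_plus E_scaleR E_minus metricsD)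
  moreover have "posdef ((1 - r) *\<^sub>R g x + r *\<^sub>R g' x)" for x
    using assms by (intro posdef_convex metricsD)
  ultimately show ?thesis
    by (simp add: metrics_def posdef_def scaleR_fun_def algebra_simps)
qed

section \<open>The Frechet topology\<close>

definition cpart :: "('a, 'n) chart \<Rightarrow> (real^'n) list \<Rightarrow> ('a, 'n) tensor_field \<Rightarrow> real^'n \<Rightarrow> real^'n^'n" where
  "cpart c vs h y = iter_partial vs (components A c h) y"

lemma cpart_Nil [simp]: "cpart c [] h y = components A c h y"
  by (simp add: cpart_def)

lemma E_smooth: "h \<in> E \<Longrightarrow> c \<in> A \<Longrightarrow> smooth_on (chart_range c) (components A c h)"
  by (simp add: sym_tensor_fields_def)

lemma cpart_cont: "h \<in> E \<Longrightarrow> c \<in> A \<Longrightarrow> continuous_on (chart_range c) (cpart c vs h)"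
  using smooth_on_continuous_iter[OF E_smooth, of h c vs] by (simp add: cpart_def[abs_def])

lemma cpart_add:
  assumes "h \<in> E" "k \<in> E" "c \<in> A" "y \<in> chart_range c"
  shows "cpart c vs (h + k) y = cpart c vs h y + cpart c vs k y"
proof -
  have "components A c (h + k) = (\<lambda>y. components A c h y + components A c k y)"
    by (rule ext) (simp add: plus_fun_def components_add)
  then show ?thesis
    unfolding cpart_def using iter_partial_add[OF chart_open(2) E_smooth E_smooth] assms by simp
qed

lemma cpart_scaleR:
  assumes "h \<in> E" "c \<in> A" "y \<in> chart_range c"
  shows "cpart c vs (r *\<^sub>R h) y = r *\<^sub>R cpart c vs h y"
proof -
  have "components A c (r *\<^sub>R h) = (\<lambda>y. r *\<^sub>R components A c h y)"
    by (rule ext) (simp add: scaleR_fun_def components_scaleR)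
  then show ?thesis
    unfolding cpart_def using iter_partial_scaleR[OF chart_open(2) E_smooth] assms by simp
qed

lemma cpart_diff:
  assumes "h \<in> E" "k \<in> E" "c \<in> A" "y \<in> chart_range c"
  shows "cpart c vs (h - k) y = cpart c vs h y - cpart c vs k y"
  using cpart_add[of h "(-1) *\<^sub>R k" c y vs] cpart_scaleR[of k c y vs "-1"] assms E_scaleR[of k "-1"]
  by simp

abbreviation nbhds :: "('a, 'n) tensor_field set set" where
  "nbhds \<equiv> {{h \<in> E. \<forall>y\<in>K. norm (iter_partial vs (components A c h) y - iter_partial vs (components A c u) y) < e}
      | c K vs u e. c \<in> A \<and> compact K \<and> K \<subseteq> chart_range c \<and> u \<in> E \<and> e > 0}"

lemma nbhdsI:
  "c \<in> A \<Longrightarrow> compact K \<Longrightarrow> K \<subseteq> chart_range c \<Longrightarrow> u \<in> E \<Longrightarrow> e > 0 \<Longrightarrow>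
    {h \<in> E. \<forall>y\<in>K. norm (cpart c vs h y - cpart c vs u y) < e} \<in> nbhds"
  unfolding cpart_def by blast

text \<open>The empty compact set gives the whole space as a subbasic set.\<close>

lemma topspace_TT: "topspace TT = E"
proof -
  have "\<Union> nbhds = E"
  proof
    show "E \<subseteq> \<Union> nbhds"
    proof
      fix u assume u: "u \<in> E"
      then have "{h \<in> E. \<forall>y\<in>{}. norm (cpart (chart_at A undefined) [] h y - cpart (chart_at A undefined) [] u y) < 1} \<in> nbhds"
        by (intro nbhdsI chart_at) auto
      then show "u \<in> \<Union> nbhds" using u by (intro UnionI) auto
    qed
  qed blast
  then show ?thesis by (simp only: tensor_topology_def topology_generated_by_topspace)
qed

text \<open>All later arguments about the Frechet topology use this description of limits.  A subbasic set
  centred at \<open>u\<close> contains, with each of its points, a set of the same kind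
  centred at that point, because the supremum over the compact set \<open>K\<close> is attained.\<close>

lemma limitin_TT:
  "limitin TT f l F \<longleftrightarrow> l \<in> E \<and> (\<forall>\<^sub>F i in F. f i \<in> E) \<and>
     (\<forall>c\<in>A. \<forall>K vs. compact K \<longrightarrow> K \<subseteq> chart_range c \<longrightarrow>
        uniform_limit K (\<lambda>i. cpart c vs (f i)) (cpart c vs l) F)"
    (is "?L \<longleftrightarrow> ?R")
proof
  assume L: ?L
  then have l: "l \<in> E" by (simp add: limitin_def topspace_TT)
  have open_ev: "\<forall>\<^sub>F i in F. f i \<in> U" if "openin TT U" "l \<in> U" for U
    using L that by (auto simp: limitin_def)
  have "openin TT E" by (subst topspace_TT[symmetric], rule openin_topspace)
  from open_ev[OF this l] have "\<forall>\<^sub>F i in F. f i \<in> E" .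
  moreover have "uniform_limit K (\<lambda>i. cpart c vs (f i)) (cpart c vs l) F"
    if "c \<in> A" "compact K" "K \<subseteq> chart_range c" for c K vs
    unfolding uniform_limit_iff
  proof (intro allI impI)
    fix e :: real assume "e > 0"
    let ?U = "{h \<in> E. \<forall>y\<in>K. norm (cpart c vs h y - cpart c vs l y) < e}"
    have "openin TT ?U"
      unfolding tensor_topology_def
      by (intro topology_generated_by_Basis nbhdsI that l \<open>e > 0\<close>)
    then have "\<forall>\<^sub>F i in F. f i \<in> ?U" by (rule open_ev) (use l \<open>e > 0\<close> in auto)
    then show "\<forall>\<^sub>F i in F. \<forall>y\<in>K. dist (cpart c vs (f i) y) (cpart c vs l y) < e"
      by eventually_elim (simp add: dist_norm)
  qed
  ultimately show ?R using l by blast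
next
  assume R: ?R
  have gen: "\<forall>\<^sub>F i in F. f i \<in> U" if "generate_topology_on nbhds U" "l \<in> U" for U
    using that
  proof (induction rule: generate_topology_on.induct)
    case (Int a b)
    then show ?case by (simp add: eventually_conj_iff)
  next
    case (UN K)
    then obtain k where "k \<in> K" "l \<in> k" by blast
    then have "\<forall>\<^sub>F i in F. f i \<in> k" using UN by blast
    then show ?case by eventually_elim (use \<open>k \<in> K\<close> in blast)
  next
    case (Basis s)
    then obtain c K vs u e where s: "s = {h \<in> E. \<forall>y\<in>K. norm (cpart c vs h y - cpart c vs u y) < e}"
      and c: "c \<in> A" "compact K" "K \<subseteq> chart_range c" "u \<in> E" "e > 0"
      unfolding cpart_def by blast
    have l: "l \<in> E" "\<And>y. y \<in> K \<Longrightarrow> norm (cpart c vs l y - cpart c vs u y) < e"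
      using Basis s by auto
    obtain d where d: "d < e" "\<And>y. y \<in> K \<Longrightarrow> norm (cpart c vs l y - cpart c vs u y) \<le> d"
    proof (cases "K = {}")
      case True then show ?thesis using that[of "e - 1"] by simp
    next
      case False
      have "continuous_on K (\<lambda>y. norm (cpart c vs l y - cpart c vs u y))"
        by (intro continuous_intros continuous_on_subset[OF cpart_cont c(3)] l c)
      from continuous_attains_sup[OF c(2) False this] obtain y0 where
        "y0 \<in> K" "\<And>y. y \<in> K \<Longrightarrow> norm (cpart c vs l y - cpart c vs u y) \<le> norm (cpart c vs l y0 - cpart c vs u y0)"
        by blast
      then show ?thesis using l(2) that by blast
    qed
    have "\<forall>\<^sub>F i in F. \<forall>y\<in>K. dist (cpart c vs (f i) y) (cpart c vs l y) < e - d"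
      using R c d(1) by (auto simp: uniform_limit_iff)
    moreover have "\<forall>\<^sub>F i in F. f i \<in> E" using R by blast
    ultimately show ?case
    proof eventually_elim
      case (elim i)
      have "norm (cpart c vs (f i) y - cpart c vs u y) < e" if "y \<in> K" for y
      proof -
        have "dist (cpart c vs (f i) y) (cpart c vs l y) < e - d" using elim(1) that by blast
        with dist_triangle[of "cpart c vs (f i) y" "cpart c vs u y" "cpart c vs l y"] d(2)[OF that]
        show ?thesis by (simp add: dist_norm)
      qed
      then show ?case using elim(2) by (simp add: s)
    qed
  qed simp
  show ?L
    unfolding limitin_def
  proof (intro conjI allI impI)
    show "l \<in> topspace TT" using R topspace_TT by blast
    fix U assume U: "openin TT U \<and> l \<in> U"
    then have "generate_topology_on nbhds U"
      unfolding tensor_topology_def openin_topology_generated_by_iff by (rule conjunct1)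
    from gen[OF this] U show "\<forall>\<^sub>F i in F. f i \<in> U" by blast
  qed
qed

lemma limitin_TT_D:
  assumes "limitin TT f l F"
  shows "l \<in> E" "\<forall>\<^sub>F i in F. f i \<in> E"
    and "c \<in> A \<Longrightarrow> compact K \<Longrightarrow> K \<subseteq> chart_range c \<Longrightarrow>
      uniform_limit K (\<lambda>i. cpart c vs (f i)) (cpart c vs l) F"
  using assms by (auto simp: limitin_TT)

lemma limitin_const: "l \<in> E \<Longrightarrow> limitin TT (\<lambda>i. l) l F"
  by (simp add: limitin_def topspace_TT)

lemma limitin_add:
  assumes f: "limitin TT f l F" and g: "limitin TT g m F"
  shows "limitin TT (\<lambda>i. f i + g i) (l + m) F"
  unfolding limitin_TT
proof (intro conjI ballI allI impI)
  show "l + m \<in> E" using f g by (intro E_plus limitin_TT_D(1))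
  have ev: "\<forall>\<^sub>F i in F. f i \<in> E \<and> g i \<in> E"
    using limitin_TT_D(2)[OF f] limitin_TT_D(2)[OF g] by (simp add: eventually_conj_iff)
  then show "\<forall>\<^sub>F i in F. f i + g i \<in> E" by eventually_elim (auto intro: E_plus)
  fix c K vs assume c: "c \<in> A" "compact K" "K \<subseteq> chart_range c"
  have "uniform_limit K (\<lambda>i y. cpart c vs (f i) y + cpart c vs (g i) y) (\<lambda>y. cpart c vs l y + cpart c vs m y) F"
    by (intro uniform_limit_add limitin_TT_D(3)[OF f] limitin_TT_D(3)[OF g] c)
  then show "uniform_limit K (\<lambda>i. cpart c vs (f i + g i)) (cpart c vs (l + m)) F"
  proof (rule uniform_limit_cong[THEN iffD1, rotated 2])
    show "\<forall>\<^sub>F i in F. \<forall>y\<in>K. cpart c vs (f i) y + cpart c vs (g i) y = cpart c vs (f i + g i) y"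
      using ev by eventually_elim (use c in \<open>auto simp: cpart_add\<close>)
    show "cpart c vs l y + cpart c vs m y = cpart c vs (l + m) y" if "y \<in> K" for y
      using c that f g limitin_TT_D(1) by (subst cpart_add) auto
  qed
qed

lemma limitin_scaleR:
  assumes a: "(a \<longlongrightarrow> \<alpha>) F" and f: "limitin TT f l F"
  shows "limitin TT (\<lambda>i. a i *\<^sub>R f i) (\<alpha> *\<^sub>R l) F"
  unfolding limitin_TT
proof (intro conjI ballI allI impI)
  show "\<alpha> *\<^sub>R l \<in> E" using f by (intro E_scaleR limitin_TT_D(1))
  note ev = limitin_TT_D(2)[OF f]
  then show "\<forall>\<^sub>F i in F. a i *\<^sub>R f i \<in> E" by eventually_elim (auto intro: E_scaleR)
  fix c K vs assume c: "c \<in> A" "compact K" "K \<subseteq> chart_range c"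
  have bdd: "bounded (cpart c vs l ` K)"
    using c limitin_TT_D(1)[OF f]
    by (intro compact_imp_bounded compact_continuous_image continuous_on_subset[OF cpart_cont])
  have "uniform_limit K (\<lambda>i y. a i *\<^sub>R cpart c vs (f i) y) (\<lambda>y. \<alpha> *\<^sub>R cpart c vs l y) F"
  proof (rule bounded_bilinear.bounded_uniform_limit[OF bounded_bilinear_scaleR _ limitin_TT_D(3)[OF f c] bdd])
    show "uniform_limit K (\<lambda>i y. a i) (\<lambda>y. \<alpha>) F"
      using a by (auto simp: uniform_limit_iff tendsto_iff elim!: eventually_mono)
    show "bounded ((\<lambda>y. \<alpha>) ` K)" by (rule bounded_subset[of "{\<alpha>}"]) auto
  qed
  then show "uniform_limit K (\<lambda>i. cpart c vs (a i *\<^sub>R f i)) (cpart c vs (\<alpha> *\<^sub>R l)) F"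
  proof (rule uniform_limit_cong[THEN iffD1, rotated 2])
    show "\<forall>\<^sub>F i in F. \<forall>y\<in>K. a i *\<^sub>R cpart c vs (f i) y = cpart c vs (a i *\<^sub>R f i) y"
      using ev by eventually_elim (use c in \<open>auto simp: cpart_scaleR\<close>)
    show "\<alpha> *\<^sub>R cpart c vs l y = cpart c vs (\<alpha> *\<^sub>R l) y" if "y \<in> K" for y
      using c that f limitin_TT_D(1) by (subst cpart_scaleR) auto
  qed
qed

lemma components_recover:
  assumes "c \<in> A" "y \<in> chart_range c"
  shows "h (chart_inv c y) = transpose (matrix_inv (frame c y)) ** components A c h y ** matrix_inv (frame c y)"
proof -
  let ?J = "frame c y"
  note J = matrix_inv_works[OF frame_invertible[OF assms]]
  have JT: "transpose (matrix_inv ?J) ** transpose ?J = mat 1"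
    by (metis J(1) matrix_transpose_mul transpose_mat)
  have "transpose (matrix_inv ?J) ** components A c h y ** matrix_inv ?J
      = (transpose (matrix_inv ?J) ** transpose ?J) ** h (chart_inv c y) ** (?J ** matrix_inv ?J)"
    by (simp add: components_frame matrix_mul_assoc)
  then show ?thesis by (simp add: J JT)
qed

text \<open>Evaluation at a point is continuous; hence limits are unique, and \<open>tvs_deriv\<close> picks out the
  derivative whenever it exists.\<close>

lemma limitin_pointwise:
  assumes "limitin TT f l F"
  shows "((\<lambda>i. f i x) \<longlongrightarrow> l x) F"
proof -
  obtain c where c: "c \<in> A" "x \<in> fst c" using chart_exists by blast
  let ?y = "snd c x"
  have "uniform_limit {?y} (\<lambda>i. cpart c [] (f i)) (cpart c [] l) F"
    using c by (intro limitin_TT_D(3)[OF assms]) auto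
  then have "((\<lambda>i. components A c (f i) ?y) \<longlongrightarrow> components A c l ?y) F"
    by (auto dest: tendsto_uniform_limitI)
  then have "((\<lambda>i. transpose (matrix_inv (frame c ?y)) ** components A c (f i) ?y ** matrix_inv (frame c ?y))
      \<longlongrightarrow> transpose (matrix_inv (frame c ?y)) ** components A c l ?y ** matrix_inv (frame c ?y)) F"
    by (intro bounded_bilinear.tendsto[OF bounded_bilinear_matrix_mult] tendsto_const)
  then show ?thesis
    using c components_recover[of c ?y] by simp
qed

lemma limitin_unique:
  assumes "limitin TT f l F" "limitin TT f m F" "F \<noteq> bot"
  shows "l = m"
  using tendsto_unique[OF assms(3) limitin_pointwise[OF assms(1)] limitin_pointwise[OF assms(2)]]
  by (auto simp: fun_eq_iff)

lemma tvs_deriv_eq: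
  assumes "limitin TT (\<lambda>s. (1 / s) *\<^sub>R (c (t + s) - c t)) l (at 0)"
  shows "tvs_deriv TT c t = l"
  unfolding tvs_deriv_def
  by (rule the_equality[of "\<lambda>l. limitin TT _ l (at 0)", OF assms]) (rule limitin_unique[OF _ assms], simp_all)

lemma pointwise_derivative:
  assumes "limitin TT (\<lambda>s. (1 / s) *\<^sub>R (c (t + s) - c t)) l (at 0)"
  shows "((\<lambda>s. c s x) has_vector_derivative l x) (at t)"
  using limitin_pointwise[OF assms, of x]
  by (simp add: has_vector_derivative_iff_quotient scaleR_fun_def)

end


section \<open>Integrals over the manifold depending on parameters\<close>

lemma has_vector_derivative_matrix_inv:
  fixes B :: "real \<Rightarrow> real^'n^'n"
  assumes "(B has_vector_derivative B') (at s)" "invertible (B s)"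
  shows "((\<lambda>s. matrix_inv (B s)) has_vector_derivative - (matrix_inv (B s) ** B' ** matrix_inv (B s))) (at s)"
  using vector_derivative_diff_chain_within[OF assms(1)
      has_derivative_at_withinI[OF has_derivative_matrix_inv[OF assms(2)]]]
  by (simp add: o_def)

lemma has_real_derivative_det:
  fixes B :: "real \<Rightarrow> real^'n^'n"
  assumes "(B has_vector_derivative B') (at s)" "invertible (B s)"
  shows "((\<lambda>s. det (B s)) has_real_derivative det (B s) * trace (matrix_inv (B s) ** B')) (at s)"
  using vector_derivative_diff_chain_within[OF assms(1)
      has_derivative_at_withinI[OF has_derivative_det[OF assms(2)]]]
  by (simp add: o_def has_real_derivative_iff_has_vector_derivative)

lemma continuous_on_integral:
  fixes f :: "'t::topological_space \<Rightarrow> 'a::topological_space \<Rightarrow> real"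
  assumes M: "finite_measure M" "sets M = sets borel" and C: "compact (UNIV :: 'a set)"
    and f: "continuous_on (T \<times> UNIV) (\<lambda>(\<tau>, x). f \<tau> x)"
  shows "\<tau> \<in> T \<Longrightarrow> integrable M (f \<tau>)" "continuous_on T (\<lambda>\<tau>. integral\<^sup>L M (f \<tau>))"
proof -
  interpret finite_measure M by (rule M(1))
  have int: "integrable M (f \<tau>)" if "\<tau> \<in> T" for \<tau>
  proof -
    have "continuous_on UNIV (\<lambda>x. (\<tau>, x))" by (intro continuous_intros)
    from continuous_on_compose2[OF f this] that
    have cont: "continuous_on UNIV (f \<tau>)" by auto
    then have "bounded (range (f \<tau>))"
      using C by (intro compact_imp_bounded compact_continuous_image)
    then obtain B where "\<forall>x. \<bar>f \<tau> x\<bar> \<le> B" by (auto simp: bounded_iff)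
    moreover have "f \<tau> \<in> borel_measurable M"
      using borel_measurable_continuous_onI[OF cont] measurable_cong_sets[OF M(2) refl] by blast
    ultimately show ?thesis by (intro integrable_const_bound[where B = B]) auto
  qed
  then show "\<tau> \<in> T \<Longrightarrow> integrable M (f \<tau>)" .
  show "continuous_on T (\<lambda>\<tau>. integral\<^sup>L M (f \<tau>))"
    unfolding continuous_on_def
  proof (intro ballI tendstoI)
    fix \<tau>0 and e :: real assume \<tau>0: "\<tau>0 \<in> T" and "e > 0"
    let ?m = "measure M (space M)"
    define d where "d = e / (?m + 1)"
    have m: "?m \<ge> 0" by simp
    then have "?m + 1 > 0" by linarith
    then have "d > 0" unfolding d_def using \<open>e > 0\<close> by (intro divide_pos_pos)
    obtain X0 where X0: "\<tau>0 \<in> X0" "open X0"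
      "\<forall>\<tau>\<in>X0 \<inter> T. \<forall>x\<in>UNIV. dist (f \<tau> x) (f \<tau>0 x) \<le> d"
      by (rule continuous_on_prod_compactE[OF f C \<tau>0 \<open>d > 0\<close>, unfolded prod.case])
    have "dist (integral\<^sup>L M (f \<tau>)) (integral\<^sup>L M (f \<tau>0)) < e" if "\<tau> \<in> X0" "\<tau> \<in> T" for \<tau>
    proof -
      have "\<bar>integral\<^sup>L M (f \<tau>) - integral\<^sup>L M (f \<tau>0)\<bar> = \<bar>\<integral>x. f \<tau> x - f \<tau>0 x \<partial>M\<bar>"
        using int that \<tau>0 by simp
      also have "\<dots> \<le> (\<integral>x. \<bar>f \<tau> x - f \<tau>0 x\<bar> \<partial>M)" by (rule integral_abs_bound)
      also have "\<dots> \<le> (\<integral>x. d \<partial>M)"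
        using X0(3) that int \<tau>0 by (intro integral_mono) (auto simp: dist_real_def)
      also have "\<dots> = d * ?m" by simp
      also have "\<dots> < d * (?m + 1)" using \<open>d > 0\<close> by (simp add: distrib_left)
      also have "\<dots> = e" using \<open>?m + 1 > 0\<close> by (simp add: d_def)
      finally show ?thesis by (simp add: dist_real_def)
    qed
    then show "\<forall>\<^sub>F \<tau> in at \<tau>0 within T. dist (integral\<^sup>L M (f \<tau>)) (integral\<^sup>L M (f \<tau>0)) < e"
      unfolding eventually_at_topological using X0 by blast
  qed
qed

text \<open>By compactness the derivative of the integrand is continuous in the parameter uniformly over the
  space, so the mean value inequality bounds the error of linearization uniformly.\<close>

lemma has_real_derivative_integral:
  fixes f f' :: "real \<Rightarrow> 'a::topological_space \<Rightarrow> real"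
  assumes M: "finite_measure M" "sets M = sets borel" and C: "compact (UNIV :: 'a set)"
    and I: "open I" "s0 \<in> I"
    and f: "continuous_on (I \<times> UNIV) (\<lambda>(s, x). f s x)"
    and f': "continuous_on (I \<times> UNIV) (\<lambda>(s, x). f' s x)"
    and der: "\<And>s x. s \<in> I \<Longrightarrow> ((\<lambda>s. f s x) has_real_derivative f' s x) (at s)"
  shows "((\<lambda>s. integral\<^sup>L M (f s)) has_real_derivative integral\<^sup>L M (f' s0)) (at s0)"
proof -
  interpret finite_measure M by (rule M(1))
  note int = continuous_on_integral(1)[OF M C f] continuous_on_integral(1)[OF M C f']
  show ?thesis
    unfolding has_field_derivative_def has_derivative_within_alt
  proof (intro conjI allI impI)
    show "bounded_linear ((*) (integral\<^sup>L M (f' s0)))" by (rule bounded_linear_mult_right)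
    fix e :: real assume "e > 0"
    let ?m = "measure M (space M)"
    define d where "d = e / (?m + 1)"
    have m: "?m \<ge> 0" by simp
    then have "?m + 1 > 0" by linarith
    then have "d > 0" unfolding d_def using \<open>e > 0\<close> by (intro divide_pos_pos)
    obtain X0 where X0: "s0 \<in> X0" "open X0"
      "\<forall>s\<in>X0 \<inter> I. \<forall>x\<in>UNIV. dist (f' s x) (f' s0 x) \<le> d"
      by (rule continuous_on_prod_compactE[OF f' C I(2) \<open>d > 0\<close>, unfolded prod.case])
    then obtain r where r: "r > 0" "ball s0 r \<subseteq> X0 \<inter> I"
      using I by (metis open_Int open_contains_ball IntI)
    have "norm (integral\<^sup>L M (f s) - integral\<^sup>L M (f s0) - integral\<^sup>L M (f' s0) * (s - s0)) \<le> e * norm (s - s0)"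
      if s: "norm (s - s0) < r" for s
    proof -
      have sI: "s \<in> I" "s0 \<in> I" using r s I(2) by (auto simp: dist_norm norm_minus_commute subset_iff)
      have bnd: "\<bar>f s x - f s0 x - f' s0 x * (s - s0)\<bar> \<le> d * \<bar>s - s0\<bar>" for x
      proof -
        have "norm ((f s x - f' s0 x * s) - (f s0 x - f' s0 x * s0)) \<le> d * norm (s - s0)"
        proof (rule field_differentiable_bound[where S = "ball s0 r" and f' = "\<lambda>s. f' s x - f' s0 x"])
          show "((\<lambda>s. f s x - f' s0 x * s) has_field_derivative f' z x - f' s0 x) (at z within ball s0 r)"
            if "z \<in> ball s0 r" for z
          proof -
            have "((\<lambda>s. f s x) has_real_derivative f' z x) (at z within ball s0 r)"
              by (rule has_field_derivative_at_within[OF der]) (use that r in blast)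
            then show ?thesis by (auto intro!: derivative_eq_intros)
          qed
          show "norm (f' z x - f' s0 x) \<le> d" if "z \<in> ball s0 r" for z
          proof -
            have "z \<in> X0 \<inter> I" using that r by blast
            then show ?thesis using X0(3) by (simp add: dist_norm)
          qed
        qed (use r s in \<open>auto simp: dist_norm norm_minus_commute\<close>)
        then show ?thesis by (simp add: algebra_simps)
      qed
      have "norm (integral\<^sup>L M (f s) - integral\<^sup>L M (f s0) - integral\<^sup>L M (f' s0) * (s - s0))
          = \<bar>\<integral>x. f s x - f s0 x - f' s0 x * (s - s0) \<partial>M\<bar>"
        using int sI by simp
      also have "\<dots> \<le> (\<integral>x. \<bar>f s x - f s0 x - f' s0 x * (s - s0)\<bar> \<partial>M)" by (rule integral_abs_bound)
      also have "\<dots> \<le> (\<integral>x. d * \<bar>s - s0\<bar> \<partial>M)"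
        using bnd int sI by (intro integral_mono) auto
      also have "\<dots> = (d * ?m) * \<bar>s - s0\<bar>" by simp
      also have "\<dots> \<le> e * \<bar>s - s0\<bar>"
      proof (rule mult_right_mono)
        have "d * ?m \<le> d * (?m + 1)" using \<open>d > 0\<close> by (simp add: distrib_left)
        also have "\<dots> = e" using \<open>?m + 1 > 0\<close> by (simp add: d_def)
        finally show "d * ?m \<le> e" .
      qed simp
      finally show ?thesis by simp
    qed
    then show "\<exists>r>0. \<forall>s\<in>UNIV. norm (s - s0) < r \<longrightarrow>
        norm (integral\<^sup>L M (f s) - integral\<^sup>L M (f s0) - integral\<^sup>L M (f' s0) * (s - s0)) \<le> e * norm (s - s0)"
      using r(1) by blast
  qed
qed

context compact_manifold
begin

text \<open>Continuity jointly in the parameter and the point, with values taken in charts.  It is weaker than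
  continuity into the Frechet space, but it survives pointwise tensor algebra without any control of
  derivatives, and it suffices for continuity and differentiability of integrals.\<close>

definition joint_cont :: "'t::topological_space set \<Rightarrow> ('t \<Rightarrow> ('a, 'n) tensor_field) \<Rightarrow> bool" where
  "joint_cont T u \<longleftrightarrow> (\<forall>c\<in>A. continuous_on (T \<times> fst c) (\<lambda>(\<tau>, x). components A c (u \<tau>) (snd c x)))"

text \<open>Near a point, convergence is uniform on a compact coordinate ball, which allows the parameter and
  the point to vary together.\<close>

lemma joint_contI:
  assumes "\<And>\<tau>. \<tau> \<in> T \<Longrightarrow> limitin TT u (u \<tau>) (at \<tau> within T)"
  shows "joint_cont T u"
  unfolding joint_cont_def
proof
  fix c assume c: "c \<in> A"
  let ?w = "\<lambda>\<tau> x. components A c (u \<tau>) (snd c x)"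
  show "continuous_on (T \<times> fst c) (\<lambda>(\<tau>, x). ?w \<tau> x)"
    unfolding continuous_on_def
  proof (intro ballI tendstoI, clarify)
    fix \<tau>0 x0 and e :: real assume \<tau>0: "\<tau>0 \<in> T" and x0: "x0 \<in> fst c" and e: "e > 0"
    obtain r where r: "r > 0" "cball (snd c x0) r \<subseteq> chart_range c"
      using chart_open(2)[OF c] chart_simps(4)[OF x0] by (meson open_contains_cball)
    let ?K = "cball (snd c x0) r"
    have "uniform_limit ?K (\<lambda>\<tau>. cpart c [] (u \<tau>)) (cpart c [] (u \<tau>0)) (at \<tau>0 within T)"
      by (rule limitin_TT_D(3)[OF assms[OF \<tau>0] c _ r(2)]) simp
    then have "\<forall>\<^sub>F \<tau> in at \<tau>0 within T. \<forall>y\<in>?K. dist (cpart c [] (u \<tau>) y) (cpart c [] (u \<tau>0) y) < e/2"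
      using e unfolding uniform_limit_iff by (meson half_gt_zero)
    then obtain S where S: "open S" "\<tau>0 \<in> S"
      "\<And>\<tau> y. \<tau> \<in> S \<Longrightarrow> \<tau> \<in> T \<Longrightarrow> \<tau> \<noteq> \<tau>0 \<Longrightarrow> y \<in> ?K \<Longrightarrow> dist (cpart c [] (u \<tau>) y) (cpart c [] (u \<tau>0) y) < e/2"
      unfolding eventually_at_topological by auto
    have S': "dist (?w \<tau> x) (?w \<tau>0 x) < e/2" if "\<tau> \<in> S" "\<tau> \<in> T" "snd c x \<in> ?K" for \<tau> x
      using S(3)[of \<tau> "snd c x"] that e by (cases "\<tau> = \<tau>0") auto
    have "u \<tau>0 \<in> E" using limitin_TT_D(1)[OF assms[OF \<tau>0]] .
    then have cont: "continuous_on (fst c) (?w \<tau>0)"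
      by (intro continuous_on_compose2[OF components_cont chart_cont] c) auto
    define W where "W = (fst c \<inter> snd c -` ball (snd c x0) r) \<inter> (fst c \<inter> ?w \<tau>0 -` ball (?w \<tau>0 x0) (e/2))"
    have W: "open W" "x0 \<in> W"
      unfolding W_def
      by (rule open_Int; rule continuous_open_preimage; fact chart_cont[OF c] chart_open(1)[OF c] cont open_ball)
         (use r e x0 in auto)
    have "dist (?w \<tau> x) (?w \<tau>0 x0) < e" if "\<tau> \<in> S" "\<tau> \<in> T" "x \<in> W" for \<tau> x
    proof -
      have "dist (?w \<tau> x) (?w \<tau>0 x) < e/2" using S'[of \<tau> x] that by (auto simp: W_def)
      moreover have "dist (?w \<tau>0 x0) (?w \<tau>0 x) < e/2" using that(3) by (simp add: W_def)
      ultimately show ?thesis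
        using dist_triangle[of "?w \<tau> x" "?w \<tau>0 x0" "?w \<tau>0 x"] by (simp add: dist_commute)
    qed
    then show "\<forall>\<^sub>F p in at (\<tau>0, x0) within T \<times> fst c.
        dist (case p of (\<tau>, x) \<Rightarrow> ?w \<tau> x) (?w \<tau>0 x0) < e"
      unfolding eventually_at_topological
      using S(1,2) W by (intro exI[of _ "S \<times> W"]) (auto simp: open_Times)
  qed
qed

lemma joint_contD: "joint_cont T u \<Longrightarrow> c \<in> A \<Longrightarrow> continuous_on (T \<times> fst c) (\<lambda>p. components A c (u (fst p)) (snd c (snd p)))"
  by (simp add: joint_cont_def case_prod_unfold)

lemma joint_cont_add: "joint_cont T u \<Longrightarrow> joint_cont T v \<Longrightarrow> joint_cont T (\<lambda>\<tau> x. u \<tau> x + v \<tau> x)"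
  by (simp add: joint_cont_def components_add case_prod_unfold continuous_on_add)

lemma components_diff: "components A c (\<lambda>x. h x - k x) y = components A c h y - components A c k y"
  by (simp add: components_frame matrix_mult_linear)

lemma joint_cont_diff: "joint_cont T u \<Longrightarrow> joint_cont T v \<Longrightarrow> joint_cont T (\<lambda>\<tau> x. u \<tau> x - v \<tau> x)"
  by (simp add: joint_cont_def components_diff case_prod_unfold continuous_on_diff)

lemma joint_cont_cmult: "joint_cont T u \<Longrightarrow> joint_cont T (\<lambda>\<tau> x. r *\<^sub>R u \<tau> x)"
  by (simp add: joint_cont_def components_scaleR case_prod_unfold continuous_on_scaleR)

lemma joint_cont_compose:
  assumes "joint_cont T u" "continuous_on I \<phi>" "\<phi> ` I \<subseteq> T"
  shows "joint_cont I (\<lambda>s. u (\<phi> s))"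
  unfolding joint_cont_def
proof
  fix c assume c: "c \<in> A"
  have "continuous_on (I \<times> fst c) (\<lambda>p. (\<phi> (fst p), snd p))"
    by (intro continuous_intros continuous_on_compose2[OF assms(2)]) auto
  from continuous_on_compose2[OF joint_contD[OF assms(1) c] this] assms(3)
  show "continuous_on (I \<times> fst c) (\<lambda>(s, x). components A c (u (\<phi> s)) (snd c x))"
    by (force simp: case_prod_unfold)
qed

lemma joint_cont_contract:
  assumes "joint_cont T h" "joint_cont T g" "joint_cont T k" "\<And>\<tau>. \<tau> \<in> T \<Longrightarrow> g \<tau> \<in> metrics A"
  shows "joint_cont T (\<lambda>\<tau> x. h \<tau> x ** matrix_inv (g \<tau> x) ** k \<tau> x)"
  unfolding joint_cont_def
proof
  fix c assume c: "c \<in> A"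
  have "continuous_on (T \<times> fst c) (\<lambda>p. components A c (h (fst p)) (snd c (snd p)) **
     matrix_inv (components A c (g (fst p)) (snd c (snd p))) ** components A c (k (fst p)) (snd c (snd p)))"
    using assms c by (intro continuous_intros joint_contD components_invertible metricsD) auto
  then show "continuous_on (T \<times> fst c) (\<lambda>(\<tau>, x). components A c (\<lambda>x. h \<tau> x ** matrix_inv (g \<tau> x) ** k \<tau> x) (snd c x))"
    by (rule continuous_on_eq) (use c assms(4) in \<open>auto simp: components_contract metricsD(3)\<close>)
qed

lemma joint_cont_trace:
  assumes "joint_cont T h" "joint_cont T g" "\<And>\<tau>. \<tau> \<in> T \<Longrightarrow> g \<tau> \<in> metrics A" "c \<in> A"
  shows "continuous_on (T \<times> fst c) (\<lambda>p. trace (matrix_inv (g (fst p) (snd p)) ** h (fst p) (snd p)))"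
proof -
  have "continuous_on (T \<times> fst c) (\<lambda>p. trace (matrix_inv (components A c (g (fst p)) (snd c (snd p))) **
      components A c (h (fst p)) (snd c (snd p))))"
    using assms by (intro continuous_intros joint_contD components_invertible metricsD) auto
  then show ?thesis
    by (rule continuous_on_eq) (use assms(3,4) in \<open>auto simp: trace_components metricsD(3)\<close>)
qed

lemma joint_cont_scale_trace:
  assumes "joint_cont T h" "joint_cont T g" "joint_cont T k" "\<And>\<tau>. \<tau> \<in> T \<Longrightarrow> g \<tau> \<in> metrics A"
  shows "joint_cont T (\<lambda>\<tau> x. (r * trace (matrix_inv (g \<tau> x) ** h \<tau> x)) *\<^sub>R k \<tau> x)"
  unfolding joint_cont_def
proof
  fix c assume c: "c \<in> A"
  have "continuous_on (T \<times> fst c) (\<lambda>p. (r * trace (matrix_inv (g (fst p) (snd p)) ** h (fst p) (snd p))) *\<^sub>R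
      components A c (k (fst p)) (snd c (snd p)))"
    using assms c by (intro continuous_intros joint_contD joint_cont_trace) auto
  then show "continuous_on (T \<times> fst c) (\<lambda>(\<tau>, x). components A c (\<lambda>x. (r * trace (matrix_inv (g \<tau> x) ** h \<tau> x)) *\<^sub>R k \<tau> x) (snd c x))"
    by (rule continuous_on_eq) (use c in \<open>auto simp: components_scaleR\<close>)
qed

lemma continuous_on_charts_param:
  assumes "open T" "\<And>c. c \<in> A \<Longrightarrow> continuous_on (T \<times> fst c) f"
  shows "continuous_on (T \<times> UNIV) f"
proof -
  have "continuous_on (\<Union>c\<in>A. T \<times> fst c) f"
    using assms by (intro continuous_on_open_UN open_Times chart_open) auto
  moreover have "(\<Union>c\<in>A. T \<times> fst c) = T \<times> UNIV" using chart_exists by fastforce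
  ultimately show ?thesis by simp
qed

lemma tensor_inner_trace: "tensor_inner g h k x = trace (matrix_inv (g x) ** (h x ** matrix_inv (g x) ** k x))"
  by (simp add: tensor_inner_def matrix_mul_assoc)

lemma tensor_inner_cont:
  assumes "open T" "joint_cont T g" "joint_cont T h" "joint_cont T k" "\<And>\<tau>. \<tau> \<in> T \<Longrightarrow> g \<tau> \<in> metrics A"
  shows "continuous_on (T \<times> UNIV) (\<lambda>(\<tau>, x). tensor_inner (g \<tau>) (h \<tau>) (k \<tau>) x)"
  using assms
  by (auto simp: case_prod_unfold tensor_inner_trace
      intro!: continuous_on_charts_param
        joint_cont_trace[where h = "\<lambda>\<tau> x. h \<tau> x ** matrix_inv (g \<tau> x) ** k \<tau> x"] joint_cont_contract)

lemma joint_cont_const: "g \<in> E \<Longrightarrow> joint_cont T (\<lambda>\<tau>. g)"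
  by (rule joint_contI) (rule limitin_const)

lemma det_ratio_cont:
  assumes "open T" "joint_cont T g" "\<And>\<tau>. \<tau> \<in> T \<Longrightarrow> g \<tau> \<in> metrics A" "g0 \<in> metrics A"
  shows "continuous_on (T \<times> UNIV) (\<lambda>(\<tau>, x). sqrt (det (g \<tau> x) / det (g0 x)))"
proof (rule continuous_on_charts_param[OF assms(1)])
  fix c assume c: "c \<in> A"
  have "continuous_on (T \<times> fst c) (\<lambda>p. sqrt (det (components A c (g (fst p)) (snd c (snd p))) /
      det (components A c g0 (snd c (snd p)))))"
  proof (intro continuous_intros joint_contD[OF assms(2) c] ballI)
    show "continuous_on (T \<times> fst c) (\<lambda>p. components A c g0 (snd c (snd p)))"
      using joint_contD[OF joint_cont_const c] metricsD(1)[OF assms(4)] by blast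
    show "det (components A c g0 (snd c (snd p))) \<noteq> 0" if "p \<in> T \<times> fst c" for p
      using components_invertible[OF c, of "snd c (snd p)" g0] that metricsD(3)[OF assms(4)]
      by (auto simp: invertible_det_nz)
  qed
  then show "continuous_on (T \<times> fst c) (\<lambda>(\<tau>, x). sqrt (det (g \<tau> x) / det (g0 x)))"
    by (rule continuous_on_eq) (use c in \<open>auto simp: det_components_ratio\<close>)
qed

definition ip :: "('a, 'n) tensor_field \<Rightarrow> ('a, 'n) tensor_field \<Rightarrow> ('a, 'n) tensor_field \<Rightarrow> real" where
  "ip g h k = (LINT x|vol A g. tensor_inner g h k x)"

text \<open>The contribution of moving the metric in direction \<open>m\<close> to the derivative of the pairing of \<open>h\<close> with
  another field: one half of the trace comes from the volume density, the two other terms from the two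
  inverse metrics.\<close>

definition drift :: "('a, 'n) tensor_field \<Rightarrow> ('a, 'n) tensor_field \<Rightarrow> ('a, 'n) tensor_field \<Rightarrow> ('a, 'n) tensor_field" where
  "drift g m h = (\<lambda>x. (1/2 * trace (matrix_inv (g x) ** m x)) *\<^sub>R h x
     - m x ** matrix_inv (g x) ** h x - h x ** matrix_inv (g x) ** m x)"

lemma joint_cont_drift:
  assumes "joint_cont T g" "joint_cont T m" "joint_cont T h" "\<And>\<tau>. \<tau> \<in> T \<Longrightarrow> g \<tau> \<in> metrics A"
  shows "joint_cont T (\<lambda>\<tau>. drift (g \<tau>) (m \<tau>) (h \<tau>))"
  unfolding drift_def using assms
  by (intro joint_cont_diff joint_cont_scale_trace joint_cont_contract) auto

lemma tensor_inner_add_left: "tensor_inner g (\<lambda>x. h x + h' x) k x = tensor_inner g h k x + tensor_inner g h' k x"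
  and tensor_inner_diff_left: "tensor_inner g (\<lambda>x. h x - h' x) k x = tensor_inner g h k x - tensor_inner g h' k x"
  and tensor_inner_scaleR_left: "tensor_inner g (\<lambda>x. f x *\<^sub>R h x) k x = f x * tensor_inner g h k x"
  by (simp_all add: tensor_inner_def trace_add trace_sub
      matrix_mult_linear linear_cmul[OF bounded_linear.linear[OF bounded_linear_trace]])

lemma tensor_inner_commute: "tensor_inner g h k x = tensor_inner g k h x"
  unfolding tensor_inner_def
  using trace_mul_sym[of "matrix_inv (g x) ** h x" "matrix_inv (g x) ** k x"]
  by (simp add: matrix_mul_assoc)

lemma ip_reference:
  assumes "g \<in> metrics A" "g0 \<in> metrics A" "tensor_inner g h k \<in> borel_measurable borel"
  shows "ip g h k = (\<integral>x. sqrt (det (g x) / det (g0 x)) * tensor_inner g h k x \<partial>vol A g0)"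
proof -
  have "(\<lambda>x. sqrt (det (g x) / det (g0 x))) \<in> borel_measurable borel"
    by (intro borel_measurable_continuous_onI continuous_on_det_ratio assms)
  moreover have "sqrt (det (g x) / det (g0 x)) \<ge> 0" for x
    using posdef_det_pos[OF metricsD(2)[OF assms(1), of x]] posdef_det_pos[OF metricsD(2)[OF assms(2), of x]] by simp
  ultimately show ?thesis
    unfolding ip_def vol_density[OF assms(1,2)]
    by (subst integral_density)
       (use assms measurable_cong_sets[OF sets_vol[OF assms(2)] refl] in auto)
qed

lemma tensor_inner_measurable:
  assumes "open T" "joint_cont T g" "joint_cont T h" "joint_cont T k" "\<And>\<tau>. \<tau> \<in> T \<Longrightarrow> g \<tau> \<in> metrics A" "\<tau> \<in> T"
  shows "tensor_inner (g \<tau>) (h \<tau>) (k \<tau>) \<in> borel_measurable borel"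
proof -
  have "continuous_on UNIV (\<lambda>x. (\<tau>, x))" by (intro continuous_intros)
  from continuous_on_compose2[OF tensor_inner_cont[OF assms(1-5)] this] assms(6)
  show ?thesis by (intro borel_measurable_continuous_onI) auto
qed

lemma ip_cont:
  assumes "open T" "joint_cont T g" "joint_cont T h" "joint_cont T k" "\<And>\<tau>. \<tau> \<in> T \<Longrightarrow> g \<tau> \<in> metrics A"
  shows "continuous_on T (\<lambda>\<tau>. ip (g \<tau>) (h \<tau>) (k \<tau>))"
proof (cases "T = {}")
  case False
  then obtain \<tau>0 where g0: "g \<tau>0 \<in> metrics A" using assms(5) by blast
  have "continuous_on (T \<times> UNIV) (\<lambda>p. (case p of (\<tau>, x) \<Rightarrow> sqrt (det (g \<tau> x) / det (g \<tau>0 x))) *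
      (case p of (\<tau>, x) \<Rightarrow> tensor_inner (g \<tau>) (h \<tau>) (k \<tau>) x))"
    by (intro continuous_on_mult det_ratio_cont tensor_inner_cont assms g0)
  then have "continuous_on T (\<lambda>\<tau>. \<integral>x. sqrt (det (g \<tau> x) / det (g \<tau>0 x)) * tensor_inner (g \<tau>) (h \<tau>) (k \<tau>) x \<partial>vol A (g \<tau>0))"
    by (intro continuous_on_integral(2) finite_measure_vol g0 sets_vol compact_UNIV')
       (simp add: case_prod_unfold)
  then show ?thesis
    by (rule continuous_on_eq) (use assms g0 in \<open>auto simp: ip_reference tensor_inner_measurable\<close>)
qed simp

abbreviation cont_field :: "('a, 'n) tensor_field \<Rightarrow> bool" where
  "cont_field h \<equiv> joint_cont (UNIV::real set) (\<lambda>_. h)"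

lemma tensor_inner_integrable:
  assumes g: "g \<in> metrics A" and h: "cont_field h" "cont_field k"
  shows "integrable (vol A g) (tensor_inner g h k)"
proof -
  have "cont_field g" by (intro joint_cont_const metricsD g)
  then have "continuous_on ((UNIV::real set) \<times> UNIV) (\<lambda>(\<tau>, x). tensor_inner g h k x)"
    using tensor_inner_cont[of "UNIV::real set" "\<lambda>_. g" "\<lambda>_. h" "\<lambda>_. k"] h g by simp
  from continuous_on_integral(1)[OF finite_measure_vol[OF g] sets_vol[OF g] compact_UNIV' this]
  show ?thesis by simp
qed

lemma ip_add:
  assumes "g \<in> metrics A" "cont_field h" "cont_field h'"
    "cont_field k"
  shows "ip g (\<lambda>x. h x + h' x) k = ip g h k + ip g h' k"
    and "ip g (\<lambda>x. h x - h' x) k = ip g h k - ip g h' k"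
  using tensor_inner_integrable[OF assms(1)] assms(2-)
  by (simp_all add: ip_def tensor_inner_add_left tensor_inner_diff_left)

lemma ip_scaleR: "ip g (\<lambda>x. r *\<^sub>R h x) k = r * ip g h k"
  by (simp add: ip_def tensor_inner_scaleR_left)

lemma ip_commute: "ip g h k = ip g k h"
proof -
  have "tensor_inner g h k = tensor_inner g k h" by (rule ext) (rule tensor_inner_commute)
  then show ?thesis by (simp add: ip_def)
qed

lemma tensor_inner_drift:
  "tensor_inner g (drift g m h) k x = 1/2 * trace (matrix_inv (g x) ** m x) * tensor_inner g h k x
     - trace (matrix_inv (g x) ** m x ** matrix_inv (g x) ** h x ** matrix_inv (g x) ** k x)
     - trace (matrix_inv (g x) ** h x ** matrix_inv (g x) ** m x ** matrix_inv (g x) ** k x)"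
  unfolding drift_def tensor_inner_diff_left tensor_inner_scaleR_left
  by (simp add: tensor_inner_def matrix_mul_assoc)

text \<open>With the volume of \<open>g s\<^sub>0\<close> as reference measure, only the integrand depends on the parameter; it is
  differentiated by the product rule, with Jacobi's formula for the density.\<close>

lemma ip_has_derivative:
  assumes I: "open I" "s0 \<in> I"
    and met: "\<And>s. s \<in> I \<Longrightarrow> g s \<in> metrics A"
    and c: "joint_cont I g" "joint_cont I g'" "joint_cont I h" "joint_cont I h'" "joint_cont I k" "joint_cont I k'"
    and der: "\<And>s x. s \<in> I \<Longrightarrow> ((\<lambda>s. g s x) has_vector_derivative g' s x) (at s)"
      "\<And>s x. s \<in> I \<Longrightarrow> ((\<lambda>s. h s x) has_vector_derivative h' s x) (at s)"
      "\<And>s x. s \<in> I \<Longrightarrow> ((\<lambda>s. k s x) has_vector_derivative k' s x) (at s)"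
  shows "((\<lambda>s. ip (g s) (h s) (k s)) has_real_derivative
      ip (g s0) (\<lambda>x. h' s0 x + drift (g s0) (g' s0) (h s0) x) (k s0) + ip (g s0) (h s0) (k' s0)) (at s0)"
proof -
  note g0 = met[OF I(2)]
  let ?\<rho> = "\<lambda>s x. sqrt (det (g s x) / det (g s0 x))"
  let ?H = "\<lambda>s x. h' s x + drift (g s) (g' s) (h s) x"
  have H: "joint_cont I ?H" by (intro joint_cont_add joint_cont_drift c met)
  have ref: "ip (g s) (a s) (b s) = (\<integral>x. ?\<rho> s x * tensor_inner (g s) (a s) (b s) x \<partial>vol A (g s0))"
    if "joint_cont I a" "joint_cont I b" "s \<in> I" for a b s
    using that by (intro ip_reference tensor_inner_measurable[OF I(1) c(1)] met g0)
  have cont: "continuous_on (I \<times> UNIV) (\<lambda>(s, x). ?\<rho> s x * tensor_inner (g s) (a s) (b s) x)"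
    if "joint_cont I a" "joint_cont I b" for a b
    using continuous_on_mult[OF det_ratio_cont[OF I(1) c(1) met g0] tensor_inner_cont[OF I(1) c(1) that met]]
    by (simp add: case_prod_unfold)
  have "((\<lambda>s. \<integral>x. ?\<rho> s x * tensor_inner (g s) (h s) (k s) x \<partial>vol A (g s0)) has_real_derivative
      (\<integral>x. ?\<rho> s0 x * tensor_inner (g s0) (?H s0) (k s0) x + ?\<rho> s0 x * tensor_inner (g s0) (h s0) (k' s0) x
         \<partial>vol A (g s0))) (at s0)"
  proof (rule has_real_derivative_integral[OF finite_measure_vol[OF g0] sets_vol[OF g0] compact_UNIV' I cont[OF c(3,5)],
        where f' = "\<lambda>s x. ?\<rho> s x * tensor_inner (g s) (?H s) (k s) x
        + ?\<rho> s x * tensor_inner (g s) (h s) (k' s) x"])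
    show "continuous_on (I \<times> UNIV) (\<lambda>(s, x). ?\<rho> s x * tensor_inner (g s) (?H s) (k s) x
        + ?\<rho> s x * tensor_inner (g s) (h s) (k' s) x)"
      using continuous_on_add[OF cont[OF H c(5)] cont[OF c(3,6)]] by (simp add: case_prod_unfold)
    fix s x assume s: "s \<in> I"
    let ?G = "matrix_inv (g s x)"
    have inv: "invertible (g s x)" by (intro metricsD met s)
    have pos: "det (g s x) > 0" "det (g s0 x) > 0" by (intro posdef_det_pos metricsD met s I)+
    have Gd: "((\<lambda>s. matrix_inv (g s x)) has_vector_derivative - (?G ** g' s x ** ?G)) (at s)"
      by (rule has_vector_derivative_matrix_inv[OF der(1)[OF s] inv])
    note mm = bounded_bilinear.has_vector_derivative[OF bounded_bilinear_matrix_mult]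
    have tr: "((\<lambda>s. tensor_inner (g s) (h s) (k s) x) has_real_derivative
        trace (?G ** h s x ** ?G ** k' s x + (?G ** h s x ** (- (?G ** g' s x ** ?G))
          + (?G ** h' s x + (- (?G ** g' s x ** ?G)) ** h s x) ** ?G) ** k s x)) (at s)"
      unfolding tensor_inner_def has_real_derivative_iff_has_vector_derivative
      by (rule bounded_linear.has_vector_derivative[OF bounded_linear_trace
            mm[OF mm[OF mm[OF Gd der(2)[OF s]] Gd] der(3)[OF s]]])
    have "((\<lambda>s. det (g s x) / det (g s0 x)) has_real_derivative
        det (g s x) * trace (?G ** g' s x) / det (g s0 x)) (at s)"
      by (intro DERIV_cdivide has_real_derivative_det der s inv)
    from DERIV_chain2[OF DERIV_real_sqrt this]
    have "((\<lambda>s. ?\<rho> s x) has_real_derivative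
        inverse (?\<rho> s x) / 2 * (det (g s x) * trace (?G ** g' s x) / det (g s0 x))) (at s)"
      using pos by simp
    also have "inverse (?\<rho> s x) / 2 * (det (g s x) * trace (?G ** g' s x) / det (g s0 x))
        = inverse (?\<rho> s x) * (?\<rho> s x)\<^sup>2 * (1/2 * trace (?G ** g' s x))"
      using pos by simp
    also have "\<dots> = ?\<rho> s x * (1/2 * trace (?G ** g' s x))"
      by (simp only: power2_eq_square mult.assoc[symmetric]) (use pos in simp)
    finally have rho: "((\<lambda>s. ?\<rho> s x) has_real_derivative ?\<rho> s x * (1/2 * trace (?G ** g' s x))) (at s)" .
    have alg: "trace (?G ** h s x ** ?G ** k' s x + (?G ** h s x ** (- (?G ** g' s x ** ?G))
          + (?G ** h' s x + (- (?G ** g' s x ** ?G)) ** h s x) ** ?G) ** k s x)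
       + 1/2 * trace (?G ** g' s x) * tensor_inner (g s) (h s) (k s) x
       = tensor_inner (g s) (?H s) (k s) x + tensor_inner (g s) (h s) (k' s) x"
      unfolding tensor_inner_add_left tensor_inner_drift
      by (simp add: tensor_inner_def trace_add trace_sub matrix_mul_assoc
          matrix_mult_linear linear_neg[OF bounded_linear.linear[OF bounded_linear_trace]])
    show "((\<lambda>s. ?\<rho> s x * tensor_inner (g s) (h s) (k s) x) has_real_derivative
        ?\<rho> s x * tensor_inner (g s) (?H s) (k s) x + ?\<rho> s x * tensor_inner (g s) (h s) (k' s) x) (at s)"
      by (rule DERIV_cong[OF DERIV_mult[OF rho tr]])
         (simp only: alg[symmetric] distrib_left[symmetric], simp add: algebra_simps)
  qed
  also have "(\<integral>x. ?\<rho> s0 x * tensor_inner (g s0) (?H s0) (k s0) x + ?\<rho> s0 x * tensor_inner (g s0) (h s0) (k' s0) x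
         \<partial>vol A (g s0)) = ip (g s0) (?H s0) (k s0) + ip (g s0) (h s0) (k' s0)"
    using continuous_on_integral(1)[OF finite_measure_vol[OF g0] sets_vol[OF g0] compact_UNIV' cont[OF H c(5)] I(2)]
      continuous_on_integral(1)[OF finite_measure_vol[OF g0] sets_vol[OF g0] compact_UNIV' cont[OF c(3,6)] I(2)]
      ref[OF H c(5) I(2)] ref[OF c(3,6) I(2)] by simp
  finally show ?thesis
    by (rule has_field_derivative_transform_within_open[OF _ I]) (simp add: ref[OF c(3,5)])
qed

end


section \<open>Smooth maps between topological vector spaces\<close>

text \<open>\<open>D\<close> collects the iterated directional derivatives that witness smoothness of \<open>F\<close>.\<close>

definition derivative_family ::
  "'v::real_vector topology \<Rightarrow> 'v set \<Rightarrow> 'w::real_vector topology \<Rightarrow> ('v \<Rightarrow> 'w) \<Rightarrow> ('v list \<Rightarrow> 'v \<Rightarrow> 'w) \<Rightarrow> bool"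
  where "derivative_family X U Y F D \<longleftrightarrow>
     (\<forall>u\<in>U. D [] u = F u) \<and>
     (\<forall>vs\<in>lists (topspace X). \<forall>v\<in>topspace X. \<forall>u\<in>U.
        limitin Y (\<lambda>s::real. (1 / s) *\<^sub>R (D vs (u + s *\<^sub>R v) - D vs u)) (D (v # vs) u) (at 0)) \<and>
     (\<forall>k. continuous_map
        (prod_topology (subtopology X U) (product_topology (\<lambda>i::nat. X) {..<k})) Y
        (\<lambda>(u, f). D (map f [0..<k]) u))"

lemma tvs_smooth_iff: "tvs_smooth X U Y F \<longleftrightarrow> (\<exists>D. derivative_family X U Y F D)"
  unfolding tvs_smooth_def derivative_family_def by (rule refl)

lemma derivative_family_Nil: "derivative_family X U Y F D \<Longrightarrow> u \<in> U \<Longrightarrow> D [] u = F u"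
  by (simp add: derivative_family_def)

lemma derivative_family_Cons:
  "derivative_family X U Y F D \<Longrightarrow> vs \<in> lists (topspace X) \<Longrightarrow> v \<in> topspace X \<Longrightarrow> u \<in> U \<Longrightarrow>
     limitin Y (\<lambda>s::real. (1 / s) *\<^sub>R (D vs (u + s *\<^sub>R v) - D vs u)) (D (v # vs) u) (at 0)"
  by (simp add: derivative_family_def)

lemma derivative_family_limit:
  assumes D: "derivative_family X U Y F D"
    and w: "limitin X w u \<Phi>" "u \<in> U" "eventually (\<lambda>i. w i \<in> U) \<Phi>"
    and len: "length vs = length l" and vs: "\<And>j. j < length l \<Longrightarrow> limitin X (vs ! j) (l ! j) \<Phi>"
  shows "limitin Y (\<lambda>i. D (map (\<lambda>v. v i) vs) (w i)) (D l u) \<Phi>"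
proof -
  let ?k = "length l"
  have ev: "\<forall>\<^sub>F i in \<Phi>. \<forall>j\<in>{..<?k}. (vs ! j) i \<in> topspace X"
  proof (rule eventually_ball_finite)
    show "\<forall>j\<in>{..<?k}. \<forall>\<^sub>F i in \<Phi>. (vs ! j) i \<in> topspace X"
      using vs by (auto simp: limitin_def)
  qed simp
  have "limitin (product_topology (\<lambda>i::nat. X) {..<?k}) (\<lambda>i. \<lambda>j\<in>{..<?k}. (vs ! j) i) (\<lambda>j\<in>{..<?k}. l ! j) \<Phi>"
    unfolding limitin_componentwise using vs ev
    by (auto simp: PiE_iff elim: eventually_mono)
  then have "limitin (prod_topology (subtopology X U) (product_topology (\<lambda>i::nat. X) {..<?k}))
      (\<lambda>i. (w i, \<lambda>j\<in>{..<?k}. (vs ! j) i)) (u, \<lambda>j\<in>{..<?k}. l ! j) \<Phi>"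
    using w by (simp add: limitin_pairwise limitin_subtopology o_def)
  moreover have "continuous_map (prod_topology (subtopology X U) (product_topology (\<lambda>i::nat. X) {..<?k})) Y
      (\<lambda>(u, f). D (map f [0..<?k]) u)"
    using D by (simp add: derivative_family_def)
  ultimately have "limitin Y ((\<lambda>(u, f). D (map f [0..<?k]) u) \<circ> (\<lambda>i. (w i, \<lambda>j\<in>{..<?k}. (vs ! j) i)))
      ((\<lambda>(u, f). D (map f [0..<?k]) u) (u, \<lambda>j\<in>{..<?k}. l ! j)) \<Phi>"
    by (rule continuous_map_limit[rotated])
  then
  have "limitin Y (\<lambda>i. D (map (\<lambda>j\<in>{..<?k}. (vs ! j) i) [0..<?k]) (w i)) (D (map (\<lambda>j\<in>{..<?k}. l ! j) [0..<?k]) u) \<Phi>"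
    by (simp add: o_def)
  moreover have "map (\<lambda>j\<in>{..<?k}. (vs ! j) i) [0..<?k] = map (\<lambda>v. v i) vs" for i
    by (rule nth_equalityI) (use len in auto)
  moreover have "map (\<lambda>j\<in>{..<?k}. l ! j) [0..<?k] = l"
    by (rule nth_equalityI) auto
  ultimately show ?thesis by simp
qed

lemma vector_derivative_segment_bound:
  fixes f :: "real \<Rightarrow> 'b::real_normed_vector"
  assumes "\<And>x. x \<in> closed_segment a b \<Longrightarrow> (f has_vector_derivative f' x) (at x)"
    and "\<And>x. x \<in> closed_segment a b \<Longrightarrow> norm (f' x - w) \<le> B"
  shows "norm (f b - f a - (b - a) *\<^sub>R w) \<le> B * \<bar>b - a\<bar>"
proof -
  have "norm ((f b - b *\<^sub>R w) - (f a - a *\<^sub>R w)) \<le> B * norm (b - a)"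
  proof (rule differentiable_bound[OF convex_closed_segment])
    show "((\<lambda>x. f x - x *\<^sub>R w) has_derivative (\<lambda>h. h *\<^sub>R (f' x - w))) (at x within closed_segment a b)"
      if "x \<in> closed_segment a b" for x
    proof -
      have "((\<lambda>x. x *\<^sub>R w) has_vector_derivative w) (at x)"
        using has_vector_derivative_scaleR[OF DERIV_ident[of "at x"] has_vector_derivative_const[of w]] by simp
      from has_vector_derivative_diff[OF assms(1)[OF that] this]
      show ?thesis unfolding has_vector_derivative_def by (rule has_derivative_at_withinI)
    qed
    show "onorm (\<lambda>h. h *\<^sub>R (f' x - w)) \<le> B" if "x \<in> closed_segment a b" for x
    proof (rule onorm_le)
      fix h :: real
      have "norm (f' x - w) * \<bar>h\<bar> \<le> B * \<bar>h\<bar>" by (intro mult_right_mono assms(2) that) simp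
      then show "norm (h *\<^sub>R (f' x - w)) \<le> B * norm h" by (simp add: mult.commute)
    qed
  qed auto
  then show ?thesis by (simp add: algebra_simps)
qed

context compact_manifold
begin

lemma cpart_derivative:
  assumes lim: "limitin TT (\<lambda>s. (1 / s) *\<^sub>R (c (t + s) - c t)) l (at 0)" and ct: "c t \<in> E"
    and e: "e \<in> A" "y \<in> chart_range e"
  shows "((\<lambda>s. cpart e vs (c s) y) has_vector_derivative cpart e vs l y) (at t)"
  unfolding has_vector_derivative_iff_quotient
proof -
  have "((\<lambda>s. cpart e vs ((1 / s) *\<^sub>R (c (t + s) - c t)) y) \<longlongrightarrow> cpart e vs l y) (at 0)"
    by (rule tendsto_uniform_limitI[OF limitin_TT_D(3)[OF lim e(1), of "{y}"]]) (use e in auto)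
  moreover have "\<forall>\<^sub>F s in at 0. cpart e vs ((1 / s) *\<^sub>R (c (t + s) - c t)) y
      = (1 / s) *\<^sub>R (cpart e vs (c (t + s)) y - cpart e vs (c t) y)"
    using limitin_TT_D(2)[OF lim] eventually_neq_at_within[of 0]
  proof eventually_elim
    case (elim s)
    have "s *\<^sub>R ((1 / s) *\<^sub>R (c (t + s) - c t)) + c t \<in> E" by (intro E_plus E_scaleR elim(1) ct)
    then have "c (t + s) \<in> E" using elim(2) by simp
    then show ?case using ct e by (simp add: cpart_scaleR cpart_diff E_minus)
  qed
  ultimately show "((\<lambda>s. (1 / s) *\<^sub>R (cpart e vs (c (t + s)) y - cpart e vs (c t) y)) \<longlongrightarrow> cpart e vs l y) (at 0)"
    by (rule Lim_transform_eventually)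
qed

lemma derivative_imp_limitin:
  assumes "limitin TT (\<lambda>s. (1 / s) *\<^sub>R (c (t + s) - c t)) l (at 0)" "c t \<in> E"
  shows "limitin TT (\<lambda>s. c (t + s)) (c t) (at 0)"
proof -
  have "limitin TT (\<lambda>s. c t + s *\<^sub>R ((1 / s) *\<^sub>R (c (t + s) - c t))) (c t + 0 *\<^sub>R l) (at 0)"
    by (intro limitin_add limitin_scaleR limitin_const assms tendsto_ident_at)
  then have "limitin TT (\<lambda>s. c t + s *\<^sub>R ((1 / s) *\<^sub>R (c (t + s) - c t))) (c t) (at 0)" by simp
  then show ?thesis
    by (rule limitin_transform_eventually[rotated]) (use eventually_neq_at_within in \<open>eventually_elim, simp\<close>)
qed

lemma open_posdef_family:
  assumes "open T" "joint_cont T u"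
  shows "open {(\<tau>, x). \<tau> \<in> T \<and> posdef (u \<tau> x)}"
proof -
  have "{(\<tau>, x). \<tau> \<in> T \<and> posdef (u \<tau> x)} =
     (\<Union>c\<in>A. (T \<times> fst c) \<inter> (\<lambda>p. components A c (u (fst p)) (snd c (snd p))) -` {M. posdef M})" (is "?L = ?R")
  proof (intro equalityI subsetI)
    fix p assume "p \<in> ?L"
    then obtain \<tau> x where p: "p = (\<tau>, x)" "\<tau> \<in> T" "posdef (u \<tau> x)" by blast
    obtain c where c: "c \<in> A" "x \<in> fst c" using chart_exists by blast
    have "posdef (components A c (u \<tau>) (snd c x))"
      using components_posdef[OF c(1), of "snd c x" "u \<tau>"] c p by simp
    then show "p \<in> ?R" using c p by auto
  next
    fix p assume "p \<in> ?R"
    then obtain c \<tau> x where p: "p = (\<tau>, x)" "\<tau> \<in> T" and c: "c \<in> A" "x \<in> fst c"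
      and "posdef (components A c (u \<tau>) (snd c x))" by auto
    then have "posdef (u \<tau> x)"
      using posdef_componentsD[OF c(1), of "snd c x" "u \<tau>"] by simp
    then show "p \<in> ?L" using p by simp
  qed
  also have "open \<dots>"
    by (intro open_UN ballI continuous_open_preimage joint_contD assms open_Times chart_open open_posdef)
  finally show ?thesis .
qed

text \<open>Positive definiteness is an open condition on the parameter and the point; the tube lemma over the
  compact manifold makes the parameter range independent of the point.\<close>

lemma metrics_ray:
  assumes "g \<in> metrics A" "m \<in> E"
  shows "\<forall>\<^sub>F s in at (0::real). g + s *\<^sub>R m \<in> metrics A"
proof -
  have "joint_cont UNIV (\<lambda>s::real. g + s *\<^sub>R m)"
    by (intro joint_contI limitin_add limitin_scaleR limitin_const tendsto_ident_at assms metricsD)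
  from open_posdef_family[OF open_UNIV this]
  have op: "open {(s, x). posdef ((g + s *\<^sub>R m) x)}" by simp
  have "{0} \<times> UNIV \<subseteq> {(s::real, x). posdef ((g + s *\<^sub>R m) x)}"
    using metricsD(2)[OF assms(1)] by auto
  from Elementary_Topology.tube_lemma[OF compact_UNIV' op this]
  obtain X0 where X0: "0 \<in> X0" "open X0" "X0 \<times> UNIV \<subseteq> {(s::real, x). posdef ((g + s *\<^sub>R m) x)}"
    by (elim exE conjE)
  have "g + s *\<^sub>R m \<in> metrics A" if "s \<in> X0" for s
  proof -
    have "g + s *\<^sub>R m \<in> E" by (intro E_plus E_scaleR assms(2) metricsD(1)[OF assms(1)])
    moreover have "posdef ((g + s *\<^sub>R m) x)" for x using X0(3) that by auto
    ultimately show ?thesis by (simp add: metrics_def posdef_def)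
  qed
  then show ?thesis unfolding eventually_at_topological using X0(1,2) by blast
qed

end

section \<open>The operator family\<close>

locale operator_family = compact_manifold A for A :: "('a::t2_space, 'n::finite) chart set" +
  fixes m :: real and P :: "('a, 'n) tensor_field \<Rightarrow> ('a, 'n) tensor_field \<Rightarrow> ('a, 'n) tensor_field"
  assumes admissible: "admissible_operator_family A m P"
begin

lemma P_bij: "g \<in> metrics A \<Longrightarrow> bij_betw (P g) E E"
  using admissible by (simp add: admissible_operator_family_def)

lemma P_E: "g \<in> metrics A \<Longrightarrow> h \<in> E \<Longrightarrow> P g h \<in> E"
  using P_bij by (auto simp: bij_betw_def)

lemma P_linear: "g \<in> metrics A \<Longrightarrow> linear_on_subspace E (P g)"
  using admissible by (simp add: admissible_operator_family_def pseudo_diff_op_def)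

lemma P_add: "g \<in> metrics A \<Longrightarrow> h \<in> E \<Longrightarrow> k \<in> E \<Longrightarrow> P g (h + k) = P g h + P g k"
  and P_scaleR: "g \<in> metrics A \<Longrightarrow> h \<in> E \<Longrightarrow> P g (r *\<^sub>R h) = r *\<^sub>R P g h"
  using P_linear by (simp_all add: linear_on_subspace_def)

lemma P_diff: "g \<in> metrics A \<Longrightarrow> h \<in> E \<Longrightarrow> k \<in> E \<Longrightarrow> P g (h - k) = P g h - P g k"
  using P_add[of g h "(-1) *\<^sub>R k"] P_scaleR[of g k "-1"] E_scaleR[of k "-1"] by simp

lemma P_symmetric: "g \<in> metrics A \<Longrightarrow> h \<in> E \<Longrightarrow> k \<in> E \<Longrightarrow> ip g (P g h) k = ip g h (P g k)"
  using admissible by (simp add: admissible_operator_family_def ip_def)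

lemma P_positive: "g \<in> metrics A \<Longrightarrow> h \<in> E \<Longrightarrow> h \<noteq> 0 \<Longrightarrow> ip g (P g h) h > 0"
  using admissible unfolding admissible_operator_family_def ip_def by blast

text \<open>Positivity of \<open>P\<close> makes the \<open>L\<^sup>2\<close>-pairing on smooth fields non-degenerate: write \<open>X = P g h\<close>
  and test with \<open>h\<close>.\<close>

lemma ip_nondegenerate:
  assumes g: "g \<in> metrics A" and X: "X \<in> E" and zero: "\<And>k. k \<in> E \<Longrightarrow> ip g k X = 0"
  shows "X = 0"
proof -
  obtain h where h: "h \<in> E" "X = P g h"
    using P_bij[OF g] X by (auto simp: bij_betw_def)
  have "h = 0"
    using P_positive[OF g h(1)] zero[OF h(1)] h(2) by (auto simp: ip_commute)
  then show ?thesis using P_scaleR[OF g h(1), of 0] h(2) by simp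
qed

text \<open>\<open>D_operator\<close> is the derivative of \<open>(g, h) \<mapsto> P g h\<close> in the direction \<open>(k, 0)\<close>.  Since rays from \<open>g\<close>
  stay inside the metrics for a short time, the description in its definition denotes that derivative
  and inherits its joint continuity.\<close>

lemma D_operator_limits:
  shows D_operator_limit: "g \<in> metrics A \<Longrightarrow> k \<in> E \<Longrightarrow> h \<in> E \<Longrightarrow>
      limitin TT (\<lambda>s. (1 / s) *\<^sub>R (P (g + s *\<^sub>R k) h - P g h)) (D_operator A P g k h) (at 0)"
    and P_cont: "limitin TT gs g \<Phi> \<Longrightarrow> g \<in> metrics A \<Longrightarrow> eventually (\<lambda>i. gs i \<in> metrics A) \<Phi> \<Longrightarrow>
      limitin TT hs h \<Phi> \<Longrightarrow> limitin TT (\<lambda>i. P (gs i) (hs i)) (P g h) (\<Phi> :: 'i filter)"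
    and D_operator_cont: "limitin TT gs g \<Phi> \<Longrightarrow> g \<in> metrics A \<Longrightarrow> eventually (\<lambda>i. gs i \<in> metrics A) \<Phi> \<Longrightarrow>
      limitin TT ks k \<Phi> \<Longrightarrow> limitin TT hs h \<Phi> \<Longrightarrow>
      limitin TT (\<lambda>i. D_operator A P (gs i) (ks i) (hs i)) (D_operator A P g k h) (\<Phi> :: 'i filter)"
proof -
  let ?X = "prod_topology TT TT" and ?U = "metrics A \<times> E"
  have "tvs_smooth ?X ?U TT (\<lambda>(g, h). P g h)"
    using admissible by (simp add: admissible_operator_family_def)
  then obtain D where D: "derivative_family ?X ?U TT (\<lambda>(g, h). P g h) D"
    unfolding tvs_smooth_iff by blast
  note D0 = derivative_family_Nil[OF D] and D1 = derivative_family_Cons[OF D]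
    and D2 = derivative_family_limit[OF D]
  have zeroE: "0 \<in> E" if "h \<in> E" for h using that by (rule E_zero)
  have lim: "limitin TT (\<lambda>s. (1 / s) *\<^sub>R (P (g + s *\<^sub>R k) h - P g h)) (D [(k, 0)] (g, h)) (at 0)"
    if "g \<in> metrics A" "k \<in> E" "h \<in> E" for g k h
  proof -
    have "limitin TT (\<lambda>s::real. (1 / s) *\<^sub>R (D [] ((g, h) + s *\<^sub>R (k, 0)) - D [] (g, h))) (D [(k, 0)] (g, h)) (at 0)"
      using that zeroE by (intro D1) (auto simp: topspace_TT)
    moreover have "\<forall>\<^sub>F s in at 0. (1 / s) *\<^sub>R (D [] ((g, h) + s *\<^sub>R (k, 0)) - D [] (g, h))
        = (1 / s) *\<^sub>R (P (g + s *\<^sub>R k) h - P g h)"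
      using metrics_ray[OF that(1,2)] by eventually_elim (use that D0 in simp)
    ultimately show ?thesis by (rule limitin_transform_eventually[rotated])
  qed
  have Deq: "D_operator A P g k h = D [(k, 0)] (g, h)" if "g \<in> metrics A" "k \<in> E" "h \<in> E" for g k h
    unfolding D_operator_def
    by (rule tvs_deriv_eq) (use lim[OF that] in simp)
  show "g \<in> metrics A \<Longrightarrow> k \<in> E \<Longrightarrow> h \<in> E \<Longrightarrow>
      limitin TT (\<lambda>s. (1 / s) *\<^sub>R (P (g + s *\<^sub>R k) h - P g h)) (D_operator A P g k h) (at 0)"
    using lim Deq by simp
  show "limitin TT (\<lambda>i. P (gs i) (hs i)) (P g h) \<Phi>"
    if "limitin TT gs g \<Phi>" "g \<in> metrics A" "eventually (\<lambda>i. gs i \<in> metrics A) \<Phi>" "limitin TT hs h \<Phi>"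
  proof -
    note h = limitin_TT_D(1,2)[OF that(4)]
    have ev: "\<forall>\<^sub>F i in \<Phi>. gs i \<in> metrics A \<and> hs i \<in> E"
      using that(3) h(2) by (simp add: eventually_conj_iff)
    have "limitin TT (\<lambda>i. D (map (\<lambda>v. v i) []) (gs i, hs i)) (D [] (g, h)) \<Phi>"
      using that h ev by (intro D2) (auto simp: limitin_pairwise o_def)
    then have "limitin TT (\<lambda>i. D [] (gs i, hs i)) (P g h) \<Phi>" using D0 that(2) h by simp
    then show ?thesis
      by (rule limitin_transform_eventually[rotated]) (use ev in \<open>eventually_elim, use D0 in auto\<close>)
  qed
  show "limitin TT (\<lambda>i. D_operator A P (gs i) (ks i) (hs i)) (D_operator A P g k h) \<Phi>"
    if "limitin TT gs g \<Phi>" "g \<in> metrics A" "eventually (\<lambda>i. gs i \<in> metrics A) \<Phi>"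
      "limitin TT ks k \<Phi>" "limitin TT hs h \<Phi>"
  proof -
    note h = limitin_TT_D(1,2)[OF that(5)] and k = limitin_TT_D(1,2)[OF that(4)]
    have ev: "\<forall>\<^sub>F i in \<Phi>. gs i \<in> metrics A \<and> hs i \<in> E \<and> ks i \<in> E"
      using that(3) h(2) k(2) by (simp add: eventually_conj_iff)
    have "limitin TT (\<lambda>i. D (map (\<lambda>v. v i) [\<lambda>i. (ks i, 0)]) (gs i, hs i)) (D [(k, 0)] (g, h)) \<Phi>"
      using that h k ev zeroE[OF h(1)]
      by (intro D2) (auto simp: limitin_pairwise o_def topspace_TT elim: eventually_mono)
    then have "limitin TT (\<lambda>i. D [(ks i, 0)] (gs i, hs i)) (D_operator A P g k h) \<Phi>"
      using Deq that(2) h k by simp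
    then show ?thesis
      by (rule limitin_transform_eventually[rotated]) (use ev in \<open>eventually_elim, use Deq in auto\<close>)
  qed
qed

lemma D_operator_E: "g \<in> metrics A \<Longrightarrow> k \<in> E \<Longrightarrow> h \<in> E \<Longrightarrow> D_operator A P g k h \<in> E"
  by (rule limitin_TT_D(1)[OF D_operator_limit])

text \<open>The chain rule in the metric argument.  In every coordinate functional the mean value theorem
  compares the difference quotient with the derivative at points of the segment from \<open>c t\<close> to
  \<open>c (t + s)\<close>, uniformly in the functional; the segment consists of metrics by convexity.\<close>

lemma P_chain_metric:
  assumes met: "\<forall>\<^sub>F s in at 0. c (t + s) \<in> metrics A" "c t \<in> metrics A" and h: "h \<in> E"
    and lim: "limitin TT (\<lambda>s. (1 / s) *\<^sub>R (c (t + s) - c t)) v (at 0)"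
  shows "limitin TT (\<lambda>s. (1 / s) *\<^sub>R (P (c (t + s)) h - P (c t) h)) (D_operator A P (c t) v h) (at 0)"
proof -
  let ?q = "\<lambda>s. (1 / s) *\<^sub>R (c (t + s) - c t)"
  \<comment> \<open>The second component runs over all of \<open>{0..1}\<close>: limits along this filter are uniform on segments.\<close>
  let ?F = "at (0::real) \<times>\<^sub>F principal {0..1::real}"
  let ?g = "\<lambda>s r. c t + (s * r) *\<^sub>R ?q s"
  note v = limitin_TT_D(1)[OF lim]
  have seg: "?g s r \<in> metrics A" if "s \<noteq> 0" "c (t + s) \<in> metrics A" "0 \<le> r" "r \<le> 1" for s r
    using metrics_convex[OF met(2) that(2-4)] that(1) by (simp add: mult.commute)
  have fst_lim: "limitin TT (\<lambda>p. ?q (fst p)) v ?F"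
  proof -
    have "filterlim fst (at 0) ?F" by (rule filterlim_fst)
    then show ?thesis
      using lim unfolding limitin_def filterlim_iff by (auto simp: split_def)
  qed
  have ev: "\<forall>\<^sub>F p in ?F. ?g (fst p) (snd p) \<in> metrics A"
  proof -
    have "\<forall>\<^sub>F s in at 0. s \<noteq> 0 \<and> c (t + s) \<in> metrics A"
      using met(1) eventually_neq_at_within by eventually_elim simp
    moreover have "\<forall>\<^sub>F r in principal {0..1}. 0 \<le> r \<and> r \<le> (1::real)"
      by (simp add: eventually_principal)
    ultimately have "\<forall>\<^sub>F p in ?F. (fst p \<noteq> 0 \<and> c (t + fst p) \<in> metrics A) \<and> 0 \<le> snd p \<and> snd p \<le> 1"
      by (rule eventually_prodI)
    then show ?thesis by eventually_elim (use seg in blast)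
  qed
  have prod0: "((\<lambda>p. fst p * snd p) \<longlongrightarrow> 0) ?F"
  proof (rule Lim_null_comparison)
    have "\<forall>\<^sub>F p in ?F. True \<and> 0 \<le> snd p \<and> snd p \<le> (1::real)"
      by (rule eventually_prodI) (auto simp: eventually_principal)
    then show "\<forall>\<^sub>F p in ?F. norm (fst p * snd p) \<le> \<bar>fst p\<bar>"
      by eventually_elim (auto simp: abs_mult intro: mult_left_le)
    have "filterlim fst (at (0::real)) ?F" by (rule filterlim_fst)
    then have "(fst \<longlongrightarrow> (0::real)) ?F" by (rule filterlim_at[THEN iffD1, THEN conjunct2])
    then show "((\<lambda>p. \<bar>fst p\<bar>) \<longlongrightarrow> 0) ?F" by (rule tendsto_rabs_zero)
  qed
  have "limitin TT (\<lambda>p. ?g (fst p) (snd p)) (c t + 0 *\<^sub>R v) ?F"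
    by (intro limitin_add limitin_scaleR limitin_const metricsD met prod0 fst_lim)
  then have g_lim: "limitin TT (\<lambda>p. ?g (fst p) (snd p)) (c t) ?F" by simp
  have D_lim: "limitin TT (\<lambda>p. D_operator A P (?g (fst p) (snd p)) (?q (fst p)) h) (D_operator A P (c t) v h) ?F"
    by (rule D_operator_cont[OF g_lim met(2) ev fst_lim limitin_const[OF h]])
  show ?thesis
    unfolding limitin_TT
  proof (intro conjI ballI allI impI)
    show "D_operator A P (c t) v h \<in> E" by (intro D_operator_E met v h)
    have good: "\<forall>\<^sub>F s in at 0. s \<noteq> 0 \<and> c (t + s) \<in> metrics A \<and> ?q s \<in> E"
      using met(1) eventually_neq_at_within[of 0] limitin_TT_D(2)[OF lim] by eventually_elim simp
    then show "\<forall>\<^sub>F s in at 0. (1 / s) *\<^sub>R (P (c (t + s)) h - P (c t) h) \<in> E"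
      by eventually_elim (use met h in \<open>auto intro!: E_scaleR E_minus P_E\<close>)
    fix e K vs assume e: "e \<in> A" "compact K" "K \<subseteq> chart_range e"
    let ?w = "cpart e vs (D_operator A P (c t) v h)"
    show "uniform_limit K (\<lambda>s. cpart e vs ((1 / s) *\<^sub>R (P (c (t + s)) h - P (c t) h))) ?w (at 0)"
      unfolding uniform_limit_iff
    proof (intro allI impI)
      fix \<epsilon> :: real assume "\<epsilon> > 0"
      have "\<forall>\<^sub>F p in ?F. \<forall>y\<in>K. dist (cpart e vs (D_operator A P (?g (fst p) (snd p)) (?q (fst p)) h) y) (?w y) < \<epsilon>/2"
        using limitin_TT_D(3)[OF D_lim e] \<open>\<epsilon> > 0\<close> unfolding uniform_limit_iff by (meson half_gt_zero)
      then obtain Q R where QR: "eventually Q (at (0::real))" "eventually R (principal {0..1::real})"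
        "\<And>s r. Q s \<Longrightarrow> R r \<Longrightarrow> \<forall>y\<in>K. dist (cpart e vs (D_operator A P (?g s r) (?q s) h) y) (?w y) < \<epsilon>/2"
        unfolding eventually_prod_filter by auto
      show "\<forall>\<^sub>F s in at 0. \<forall>y\<in>K. dist (cpart e vs ((1 / s) *\<^sub>R (P (c (t + s)) h - P (c t) h)) y) (?w y) < \<epsilon>"
        using QR(1) good
      proof eventually_elim
        case (elim s)
        show ?case
        proof
          fix y assume y: "y \<in> K"
          then have yr: "y \<in> chart_range e" using e by auto
          let ?C = "\<lambda>\<rho>. P (c t + \<rho> *\<^sub>R ?q s) h"
          have seg': "\<exists>r. 0 \<le> r \<and> r \<le> 1 \<and> \<rho> = s * r" if "\<rho> \<in> closed_segment 0 s" for \<rho>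
            using that by (auto simp: in_segment mult.commute)
          have "norm (cpart e vs (?C s) y - cpart e vs (?C 0) y - (s - 0) *\<^sub>R ?w y) \<le> \<epsilon>/2 * \<bar>s - 0\<bar>"
          proof (rule vector_derivative_segment_bound)
            fix \<rho> assume \<rho>: "\<rho> \<in> closed_segment 0 s"
            obtain r where r: "0 \<le> r" "r \<le> 1" "\<rho> = s * r" using seg'[OF \<rho>] by blast
            have gm: "c t + \<rho> *\<^sub>R ?q s \<in> metrics A" using seg[of s r] elim r by simp
            have "limitin TT (\<lambda>\<sigma>. (1 / \<sigma>) *\<^sub>R (P (c t + \<rho> *\<^sub>R ?q s + \<sigma> *\<^sub>R ?q s) h - P (c t + \<rho> *\<^sub>R ?q s) h))
                (D_operator A P (c t + \<rho> *\<^sub>R ?q s) (?q s) h) (at 0)"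
              using gm elim h by (intro D_operator_limit) auto
            then have "limitin TT (\<lambda>\<sigma>. (1 / \<sigma>) *\<^sub>R (?C (\<rho> + \<sigma>) - ?C \<rho>))
                (D_operator A P (c t + \<rho> *\<^sub>R ?q s) (?q s) h) (at 0)"
              by (simp only: scaleR_add_left add.assoc)
            then show "((\<lambda>\<rho>. cpart e vs (?C \<rho>) y) has_vector_derivative
                cpart e vs (D_operator A P (c t + \<rho> *\<^sub>R ?q s) (?q s) h) y) (at \<rho>)"
              by (rule cpart_derivative[where c = ?C and t = \<rho>, OF _ P_E[OF gm h] e(1) yr])
            have "R r" using QR(2) r by (simp add: eventually_principal)
            then show "norm (cpart e vs (D_operator A P (c t + \<rho> *\<^sub>R ?q s) (?q s) h) y - ?w y) \<le> \<epsilon>/2"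
              using QR(3)[of s r] elim(1) y r(3) by (auto simp: dist_norm intro: less_imp_le)
          qed
          moreover have "?C s = P (c (t + s)) h" "?C 0 = P (c t) h" using elim by auto
          ultimately have bnd: "norm (cpart e vs (P (c (t + s)) h) y - cpart e vs (P (c t) h) y - s *\<^sub>R ?w y) \<le> \<epsilon>/2 * \<bar>s\<bar>"
            by simp
          have quot: "cpart e vs ((1 / s) *\<^sub>R (P (c (t + s)) h - P (c t) h)) y - ?w y
              = (1 / s) *\<^sub>R (cpart e vs (P (c (t + s)) h) y - cpart e vs (P (c t) h) y - s *\<^sub>R ?w y)"
          proof -
            have PE: "P (c (t + s)) h \<in> E" "P (c t) h \<in> E" using elim met h by (auto intro: P_E)
            have "s \<noteq> 0" using elim by blast
            have "cpart e vs ((1 / s) *\<^sub>R (P (c (t + s)) h - P (c t) h)) y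
                = (1 / s) *\<^sub>R (cpart e vs (P (c (t + s)) h) y - cpart e vs (P (c t) h) y)"
              by (rule trans[OF cpart_scaleR[OF E_minus[OF PE] e(1) yr]])
                 (simp only: cpart_diff[OF PE e(1) yr])
            then show ?thesis using \<open>s \<noteq> 0\<close> by (simp only: scaleR_diff_right) simp
          qed
          have "norm (cpart e vs ((1 / s) *\<^sub>R (P (c (t + s)) h - P (c t) h)) y - ?w y) \<le> \<epsilon>/2"
            unfolding quot norm_scaleR using bnd elim by (simp only: abs_divide abs_one) (simp add: pos_divide_le_eq)
          then show "dist (cpart e vs ((1 / s) *\<^sub>R (P (c (t + s)) h - P (c t) h)) y) (?w y) < \<epsilon>"
            using \<open>\<epsilon> > 0\<close> by (simp add: dist_norm)
        qed
      qed
    qed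
  qed
qed

text \<open>By linearity of \<open>P\<close> in its second argument the remaining term is \<open>P (c (t + s))\<close> applied to a
  difference quotient, which converges by joint continuity.\<close>

lemma P_chain:
  assumes met: "\<forall>\<^sub>F s in at 0. c (t + s) \<in> metrics A" "c t \<in> metrics A"
    and lim: "limitin TT (\<lambda>s. (1 / s) *\<^sub>R (c (t + s) - c t)) v (at 0)"
    and h: "h t \<in> E" "limitin TT (\<lambda>s. (1 / s) *\<^sub>R (h (t + s) - h t)) w (at 0)"
  shows "limitin TT (\<lambda>s. (1 / s) *\<^sub>R (P (c (t + s)) (h (t + s)) - P (c t) (h t)))
    (D_operator A P (c t) v (h t) + P (c t) w) (at 0)"
proof -
  have "limitin TT (\<lambda>s. (1 / s) *\<^sub>R (P (c (t + s)) (h t) - P (c t) (h t)) + P (c (t + s)) ((1 / s) *\<^sub>R (h (t + s) - h t)))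
    (D_operator A P (c t) v (h t) + P (c t) w) (at 0)"
    by (rule limitin_add[OF P_chain_metric[OF met h(1) lim]
          P_cont[OF derivative_imp_limitin[OF lim metricsD(1)[OF met(2)]] met(2,1) h(2)]])
  then show ?thesis
  proof (rule limitin_transform_eventually[rotated])
    show "\<forall>\<^sub>F s in at 0. (1 / s) *\<^sub>R (P (c (t + s)) (h t) - P (c t) (h t)) + P (c (t + s)) ((1 / s) *\<^sub>R (h (t + s) - h t))
        = (1 / s) *\<^sub>R (P (c (t + s)) (h (t + s)) - P (c t) (h t))"
      using met(1) limitin_TT_D(2)[OF derivative_imp_limitin[OF h(2,1)]]
    proof eventually_elim
      case (elim s)
      then show ?case using h(1)
        by (simp add: P_scaleR P_diff E_minus scaleR_add_right[symmetric] del: scaleR_add_right)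
    qed
  qed
qed

end


section \<open>The first variation of the energy\<close>

lemma second_difference_mean_value:
  fixes f :: "real \<Rightarrow> real \<Rightarrow> real"
  assumes "h > 0"
    and fs: "\<And>s t. s \<in> {s0..s0+h} \<Longrightarrow> t \<in> {t0..t0+h} \<Longrightarrow> ((\<lambda>s. f s t) has_real_derivative fs s t) (at s)"
    and f12: "\<And>s t. s \<in> {s0..s0+h} \<Longrightarrow> t \<in> {t0..t0+h} \<Longrightarrow> ((\<lambda>t. fs s t) has_real_derivative f12 s t) (at t)"
  shows "\<exists>s\<in>{s0..s0+h}. \<exists>t\<in>{t0..t0+h}.
    f (s0+h) (t0+h) - f s0 (t0+h) - (f (s0+h) t0 - f s0 t0) = h * (h * f12 s t)"
proof -
  have "\<exists>z>s0. z < s0 + h \<and> (f (s0+h) (t0+h) - f (s0+h) t0) - (f s0 (t0+h) - f s0 t0)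
      = (s0 + h - s0) * (fs z (t0+h) - fs z t0)"
    using \<open>h > 0\<close> fs by (intro MVT2 DERIV_diff) auto
  then obtain s where s: "s0 < s" "s < s0 + h"
    "(f (s0+h) (t0+h) - f (s0+h) t0) - (f s0 (t0+h) - f s0 t0) = h * (fs s (t0+h) - fs s t0)" by auto
  have "\<exists>z>t0. z < t0 + h \<and> fs s (t0+h) - fs s t0 = (t0 + h - t0) * f12 s z"
    using \<open>h > 0\<close> s f12 by (intro MVT2) auto
  then obtain t where t: "t0 < t" "t < t0 + h" "fs s (t0+h) - fs s t0 = h * f12 s t" by auto
  show ?thesis
    using s t by (intro bexI[of _ s] bexI[of _ t]) auto
qed

text \<open>Schwarz' theorem: both mixed derivatives are limits of the same second difference quotient.\<close>

lemma mixed_partials_eq: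
  fixes f :: "real \<Rightarrow> real \<Rightarrow> real"
  assumes T: "open T" "(s0, t0) \<in> T"
    and fs: "\<And>s t. (s, t) \<in> T \<Longrightarrow> ((\<lambda>s. f s t) has_real_derivative fs s t) (at s)"
    and ft: "\<And>s t. (s, t) \<in> T \<Longrightarrow> ((\<lambda>t. f s t) has_real_derivative ft s t) (at t)"
    and f12: "\<And>s t. (s, t) \<in> T \<Longrightarrow> ((\<lambda>t. fs s t) has_real_derivative f12 s t) (at t)"
    and f21: "\<And>s t. (s, t) \<in> T \<Longrightarrow> ((\<lambda>s. ft s t) has_real_derivative f21 s t) (at s)"
    and cont: "continuous_on T (\<lambda>(s, t). f12 s t)" "continuous_on T (\<lambda>(s, t). f21 s t)"
  shows "f12 s0 t0 = f21 s0 t0"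
proof (rule ccontr)
  assume ne: "f12 s0 t0 \<noteq> f21 s0 t0"
  define e where "e = \<bar>f12 s0 t0 - f21 s0 t0\<bar> / 2"
  have "e > 0" using ne by (simp add: e_def)
  have near: "\<exists>S. open S \<and> (s0, t0) \<in> S \<and> (\<forall>p\<in>S \<inter> T. dist (case p of (s, t) \<Rightarrow> u s t) (u s0 t0) < e)"
    if "continuous_on T (\<lambda>(s, t). u s t)" for u :: "real \<Rightarrow> real \<Rightarrow> real"
  proof -
    have "\<forall>\<^sub>F p in at (s0, t0) within T. dist (case p of (s, t) \<Rightarrow> u s t) (u s0 t0) < e"
      using that T(2) \<open>e > 0\<close> unfolding continuous_on_def by (auto dest!: bspec[OF _ T(2)] tendstoD)
    then show ?thesis
      unfolding eventually_at_topological using \<open>e > 0\<close> by (force simp: dist_self)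
  qed
  from near[OF cont(1)] obtain S1 where S1: "open S1" "(s0, t0) \<in> S1"
    "\<forall>p\<in>S1 \<inter> T. dist (case p of (s, t) \<Rightarrow> f12 s t) (f12 s0 t0) < e" by (elim exE conjE)
  from near[OF cont(2)] obtain S2 where S2: "open S2" "(s0, t0) \<in> S2"
    "\<forall>p\<in>S2 \<inter> T. dist (case p of (s, t) \<Rightarrow> f21 s t) (f21 s0 t0) < e" by (elim exE conjE)
  have "open (S1 \<inter> S2 \<inter> T)" "(s0, t0) \<in> S1 \<inter> S2 \<inter> T"
    using S1(1,2) S2(1,2) T by (simp_all add: open_Int)
  then obtain V W where VW: "open V" "open W" "(s0, t0) \<in> V \<times> W" "V \<times> W \<subseteq> S1 \<inter> S2 \<inter> T"
    by (rule open_prod_elim)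
  obtain r1 where r1: "r1 > 0" "cball s0 r1 \<subseteq> V" using VW(1,3) by (meson mem_Times_iff SigmaD1 open_contains_cball)
  obtain r2 where r2: "r2 > 0" "cball t0 r2 \<subseteq> W" using VW(2,3) by (meson mem_Times_iff SigmaD2 open_contains_cball)
  define h where "h = min r1 r2"
  have h: "h > 0" using r1 r2 by (simp add: h_def)
  have box: "(s, t) \<in> S1 \<inter> S2 \<inter> T" if "s \<in> {s0..s0+h}" "t \<in> {t0..t0+h}" for s t
  proof -
    have "s \<in> cball s0 r1" "t \<in> cball t0 r2" using that by (auto simp: h_def dist_real_def)
    then have "(s, t) \<in> V \<times> W" using r1(2) r2(2) by auto
    then show ?thesis using VW(4) by blast
  qed
  obtain s t where st: "s \<in> {s0..s0+h}" "t \<in> {t0..t0+h}"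
    "f (s0+h) (t0+h) - f s0 (t0+h) - (f (s0+h) t0 - f s0 t0) = h * (h * f12 s t)"
    using second_difference_mean_value[OF h, of s0 t0 f fs f12] fs f12 box by blast
  obtain t' s' where st': "t' \<in> {t0..t0+h}" "s' \<in> {s0..s0+h}"
    "f (s0+h) (t0+h) - f (s0+h) t0 - (f s0 (t0+h) - f s0 t0) = h * (h * f21 s' t')"
    using second_difference_mean_value[OF h, of t0 s0 "\<lambda>t s. f s t" "\<lambda>t s. ft s t" "\<lambda>t s. f21 s t"] ft f21 box
    by blast
  have "h * (h * f12 s t) = h * (h * f21 s' t')" using st(3) st'(3) by linarith
  then have "f12 s t = f21 s' t'" using h by simp
  moreover have "dist (f12 s t) (f12 s0 t0) < e" using bspec[OF S1(3), of "(s, t)"] box[OF st(1,2)] by simp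
  moreover have "dist (f21 s' t') (f21 s0 t0) < e" using bspec[OF S2(3), of "(s', t')"] box[OF st'(2,1)] by simp
  moreover have "dist (f12 s0 t0) (f21 s0 t0) \<le> dist (f12 s t) (f12 s0 t0) + dist (f12 s t) (f21 s0 t0)"
    by (metis dist_triangle3)
  ultimately show False by (simp add: e_def dist_real_def)
qed

context compact_manifold
begin

lemma family_limit:
  fixes D :: "'v::real_normed_vector list \<Rightarrow> 'v \<Rightarrow> ('a, 'n) tensor_field"
  assumes "derivative_family euclidean T TT \<gamma> D" "\<tau> \<in> T"
  shows "limitin TT (D vs) (D vs \<tau>) (at \<tau> within T)"
proof -
  have "limitin TT (\<lambda>i. D (map (\<lambda>v. v i) (map (\<lambda>v i. v) vs)) i) (D vs \<tau>) (at \<tau> within T)"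
    by (rule derivative_family_limit[OF assms(1)])
       (use assms(2) in \<open>auto simp: eventually_at_filter tendsto_ident_at\<close>)
  then show ?thesis by (simp add: o_def)
qed

lemma family_joint_cont:
  fixes D :: "'v::real_normed_vector list \<Rightarrow> 'v \<Rightarrow> ('a, 'n) tensor_field"
  shows "derivative_family euclidean T TT \<gamma> D \<Longrightarrow> joint_cont T (D vs)"
  by (rule joint_contI) (rule family_limit)

lemma family_E:
  fixes D :: "'v::real_normed_vector list \<Rightarrow> 'v \<Rightarrow> ('a, 'n) tensor_field"
  shows "derivative_family euclidean T TT \<gamma> D \<Longrightarrow> \<tau> \<in> T \<Longrightarrow> D vs \<tau> \<in> E"
  by (rule limitin_TT_D(1)[OF family_limit])

lemma family_deriv:
  fixes D :: "'v::real_normed_vector list \<Rightarrow> 'v \<Rightarrow> ('a, 'n) tensor_field"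
  shows "derivative_family euclidean T TT \<gamma> D \<Longrightarrow> \<tau> \<in> T \<Longrightarrow>
    limitin TT (\<lambda>s::real. (1 / s) *\<^sub>R (D vs (\<tau> + s *\<^sub>R v) - D vs \<tau>)) (D (v # vs) \<tau>) (at 0)"
  by (rule derivative_family_Cons) auto

lemma path_deriv_cong:
  assumes "limitin TT (\<lambda>s. (1 / s) *\<^sub>R (c (t + s) - c t)) l (at 0)"
    and "open J" "t \<in> J" "\<And>t. t \<in> J \<Longrightarrow> c t = c' t"
  shows "limitin TT (\<lambda>s. (1 / s) *\<^sub>R (c' (t + s) - c' t)) l (at 0)"
proof (rule limitin_transform_eventually[OF _ assms(1)])
  have "((\<lambda>s. t + s) \<longlongrightarrow> t + 0) (at 0)" by (intro tendsto_intros)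
  then have "\<forall>\<^sub>F s in at 0. t + s \<in> J"
    using assms(2,3) by (auto dest: topological_tendstoD)
  then show "\<forall>\<^sub>F s in at 0. (1 / s) *\<^sub>R (c (t + s) - c t) = (1 / s) *\<^sub>R (c' (t + s) - c' t)"
    by eventually_elim (use assms(3,4) in simp)
qed

lemma ip_zero_right: "ip g h 0 = 0"
  by (simp add: ip_def tensor_inner_def linear_0[OF bounded_linear.linear[OF bounded_linear_trace]])

lemma cont_field_E: "h \<in> E \<Longrightarrow> cont_field h"
  by (rule joint_cont_const)

lemma cont_field_ops:
  assumes "g \<in> metrics A"
  shows "cont_field h \<Longrightarrow> cont_field k \<Longrightarrow> cont_field (\<lambda>x. h x + k x)"
    "cont_field h \<Longrightarrow> cont_field k \<Longrightarrow> cont_field (\<lambda>x. h x - k x)"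
    "cont_field h \<Longrightarrow> cont_field (\<lambda>x. r *\<^sub>R h x)"
    "cont_field h \<Longrightarrow> cont_field k \<Longrightarrow> cont_field (\<lambda>x. h x ** matrix_inv (g x) ** k x)"
    "cont_field h \<Longrightarrow> cont_field k \<Longrightarrow> cont_field (\<lambda>x. (r * trace (matrix_inv (g x) ** h x)) *\<^sub>R k x)"
    "cont_field h \<Longrightarrow> cont_field k \<Longrightarrow> cont_field (drift g h k)"
  by (rule joint_cont_add joint_cont_diff joint_cont_cmult
        joint_cont_contract[OF _ cont_field_E[OF metricsD(1)[OF assms]]]
        joint_cont_scale_trace[OF _ cont_field_E[OF metricsD(1)[OF assms]]]
        joint_cont_drift[OF cont_field_E[OF metricsD(1)[OF assms]]];
      (assumption | rule assms))+

text \<open>The transpose of \<open>m \<mapsto> drift g m q\<close> with respect to the pairing.\<close>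

definition codrift :: "('a, 'n) tensor_field \<Rightarrow> ('a, 'n) tensor_field \<Rightarrow> ('a, 'n) tensor_field \<Rightarrow> ('a, 'n) tensor_field" where
  "codrift g q h = (\<lambda>x. (1/2 * trace (matrix_inv (g x) ** (q x ** matrix_inv (g x) ** h x))) *\<^sub>R g x
     - q x ** matrix_inv (g x) ** h x - h x ** matrix_inv (g x) ** q x)"

lemma tensor_inner_codrift:
  assumes "g \<in> metrics A"
  shows "tensor_inner g (drift g m q) h x = tensor_inner g (codrift g q h) m x"
proof -
  let ?G = "matrix_inv (g x)"
  have G: "?G ** g x = mat 1" by (rule matrix_inv_works(2)[OF metricsD(3)[OF assms]])
  have 1: "trace (?G ** m x ** ?G ** q x ** ?G ** h x) = trace (?G ** q x ** ?G ** h x ** ?G ** m x)"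
    using trace_mul_sym[of "?G ** m x" "?G ** q x ** ?G ** h x"] by (simp add: matrix_mul_assoc)
  have 2: "trace (?G ** q x ** ?G ** m x ** ?G ** h x) = trace (?G ** h x ** ?G ** q x ** ?G ** m x)"
    using trace_mul_sym[of "?G ** q x ** ?G ** m x" "?G ** h x"] by (simp add: matrix_mul_assoc)
  show ?thesis
    unfolding tensor_inner_drift 1 2 codrift_def tensor_inner_diff_left tensor_inner_scaleR_left
    by (simp add: tensor_inner_def matrix_mul_assoc G)
qed

end

locale geodesic_setting = operator_family A m P
  for A :: "('a::t2_space, 'n::finite) chart set" and m P +
  fixes Adj :: "('a, 'n) tensor_field \<Rightarrow> ('a, 'n) tensor_field \<Rightarrow> ('a, 'n) tensor_field \<Rightarrow> ('a, 'n) tensor_field"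
  assumes adjoint: "is_adjoint_of_D A P Adj"
    and adjoint_smooth: "tvs_smooth
         (prod_topology (tensor_topology A) (prod_topology (tensor_topology A) (tensor_topology A)))
         (metrics A \<times> sym_tensor_fields A \<times> sym_tensor_fields A)
         (tensor_topology A) (\<lambda>(g, h, k). Adj g h k)"
begin

lemma Adj_E: "g \<in> metrics A \<Longrightarrow> h \<in> E \<Longrightarrow> k \<in> E \<Longrightarrow> Adj g h k \<in> E"
  and Adj_ip: "g \<in> metrics A \<Longrightarrow> h \<in> E \<Longrightarrow> k \<in> E \<Longrightarrow> l \<in> E \<Longrightarrow>
    ip g (D_operator A P g l h) k = ip g l (Adj g h k)"
  using adjoint by (simp_all add: is_adjoint_of_D_def ip_def)

lemma Adj_cont:
  assumes "limitin TT gs g \<Phi>" "g \<in> metrics A" "eventually (\<lambda>i. gs i \<in> metrics A) \<Phi>"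
    and "limitin TT hs h \<Phi>" "limitin TT ks k \<Phi>"
  shows "limitin TT (\<lambda>i. Adj (gs i) (hs i) (ks i)) (Adj g h k) \<Phi>"
proof -
  let ?U = "metrics A \<times> E \<times> E"
  obtain D where D: "derivative_family (prod_topology TT (prod_topology TT TT)) ?U TT (\<lambda>(g, h, k). Adj g h k) D"
    using adjoint_smooth unfolding tvs_smooth_iff by blast
  note h = limitin_TT_D(1,2)[OF assms(4)] and k = limitin_TT_D(1,2)[OF assms(5)]
  have ev: "\<forall>\<^sub>F i in \<Phi>. gs i \<in> metrics A \<and> hs i \<in> E \<and> ks i \<in> E"
    using assms(3) h(2) k(2) by (simp add: eventually_conj_iff)
  have "limitin TT (\<lambda>i. D (map (\<lambda>v. v i) []) (gs i, hs i, ks i)) (D [] (g, h, k)) \<Phi>"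
    using assms h k ev by (intro derivative_family_limit[OF D]) (auto simp: limitin_pairwise o_def)
  then have "limitin TT (\<lambda>i. D [] (gs i, hs i, ks i)) (Adj g h k) \<Phi>"
    using derivative_family_Nil[OF D] assms(2) h k by simp
  then show ?thesis
    by (rule limitin_transform_eventually[rotated])
       (use ev in \<open>eventually_elim, use derivative_family_Nil[OF D] in auto\<close>)
qed

text \<open>The right-hand side of the equation for the momentum \<open>P g h\<close>, at the metric \<open>g\<close> with velocity \<open>h\<close>.\<close>

definition rhs :: "('a, 'n) tensor_field \<Rightarrow> ('a, 'n) tensor_field \<Rightarrow> ('a, 'n) tensor_field" where
  "rhs g h = (\<lambda>x. (1/2) *\<^sub>R Adj g h h x
     + (1/4 * trace (matrix_inv (g x) ** P g h x ** matrix_inv (g x) ** h x)) *\<^sub>R g x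
     + (1/2) *\<^sub>R (h x ** matrix_inv (g x) ** P g h x)
     + (1/2) *\<^sub>R (P g h x ** matrix_inv (g x) ** h x)
     - (1/2 * trace (matrix_inv (g x) ** h x)) *\<^sub>R P g h x)"

text \<open>The terms regrouped by origin: the adjoint and \<open>codrift\<close> come from varying the operator and the
  metric in the energy, \<open>drift\<close> from differentiating the pairing in time.\<close>

lemma rhs_drift:
  "rhs g h = (\<lambda>x. ((1/2) *\<^sub>R Adj g h h x + (1/2) *\<^sub>R codrift g (P g h) h x) - drift g h (P g h) x)"
  by (rule ext) (simp add: rhs_def codrift_def drift_def matrix_mul_assoc scaleR_diff_right algebra_simps
      flip: scaleR_add_left)

lemma rhs_E:
  assumes "g \<in> metrics A" "h \<in> E"
  shows "rhs g h \<in> E"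
proof -
  let ?q = "P g h"
  note E = metricsD(1)[OF assms(1)] assms(2) P_E[OF assms] Adj_E[OF assms assms(2)]
  have ts: "tensor_smooth u" if "u \<in> E" for u using that by (simp add: E_iff)
  have "rhs g h = (\<lambda>x. ((1/2) *\<^sub>R Adj g h h x
     + (1/4 * trace (matrix_inv (g x) ** (?q x ** matrix_inv (g x) ** h x))) *\<^sub>R g x
     + (1/2) *\<^sub>R (h x ** matrix_inv (g x) ** ?q x + ?q x ** matrix_inv (g x) ** h x))
     - (1/2 * trace (matrix_inv (g x) ** h x)) *\<^sub>R ?q x)"
    by (rule ext) (simp add: rhs_def matrix_mul_assoc scaleR_add_right)
  also have "\<dots> \<in> E"
    using E assms ts
    by (intro E_diff E_add E_scale scalar_smooth_const scalar_smooth_cmult scalar_smooth_trace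
        tensor_smooth_contract E_sym_contract) auto
  finally show ?thesis .
qed

text \<open>The first variation at a fixed time: \<open>k\<close> is the variation field and \<open>k'\<close> its time
  derivative, \<open>q'\<close> the time derivative of the momentum \<open>P g h\<close>.  The left-hand side is the derivative of
  the energy density; the bracket is the time derivative of the pairing of momentum and variation.\<close>

lemma variation_identity:
  assumes g: "g \<in> metrics A" and E: "h \<in> E" "k \<in> E" "k' \<in> E" "q' \<in> E"
  shows "(1/2) * (ip g (\<lambda>x. (D_operator A P g k h + P g k') x + drift g k (P g h) x) h + ip g (P g h) k')
    = (ip g (\<lambda>x. q' x + drift g h (P g h) x) k + ip g (P g h) k') + ip g (\<lambda>x. rhs g h x - q' x) k"
proof -
  let ?q = "P g h"
  have gE: "g \<in> E" by (rule metricsD[OF g])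
  note E' = E P_E[OF g E(1)] P_E[OF g E(3)] D_operator_E[OF g E(2,1)] Adj_E[OF g E(1,1)]
  note cf = E'[THEN cont_field_E] cont_field_E[OF gE]
  note ops = cont_field_ops[OF g]
  have co: "cont_field (codrift g ?q h)"
    unfolding codrift_def by (intro ops cf)
  have "ip g (\<lambda>x. (D_operator A P g k h + P g k') x + drift g k ?q x) h
      = ip g (D_operator A P g k h) h + ip g (P g k') h + ip g (drift g k ?q) h"
    unfolding plus_fun_apply by (simp add: ip_add[OF g] ops cf)
  also have "ip g (D_operator A P g k h) h = ip g (Adj g h h) k"
    using Adj_ip[OF g E(1,1,2)] by (simp add: ip_commute)
  also have "ip g (P g k') h = ip g ?q k'"
    using P_symmetric[OF g E(3,1)] by (simp add: ip_commute)
  also have "ip g (drift g k ?q) h = ip g (codrift g ?q h) k"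
  proof -
    have "tensor_inner g (drift g k ?q) h = tensor_inner g (codrift g ?q h) k"
      by (rule ext) (rule tensor_inner_codrift[OF g])
    then show ?thesis by (simp add: ip_def)
  qed
  finally have L: "ip g (\<lambda>x. (D_operator A P g k h + P g k') x + drift g k ?q x) h
      = ip g (Adj g h h) k + ip g ?q k' + ip g (codrift g ?q h) k" .
  have "ip g (\<lambda>x. rhs g h x - q' x) k
      = (1/2) * ip g (Adj g h h) k + (1/2) * ip g (codrift g ?q h) k - ip g (drift g h ?q) k - ip g q' k"
    unfolding rhs_drift by (simp add: ip_add[OF g] ip_scaleR ops cf co)
  moreover have "ip g (\<lambda>x. q' x + drift g h ?q x) k = ip g q' k + ip g (drift g h ?q) k"
    by (simp add: ip_add[OF g] ops cf)
  ultimately show ?thesis unfolding L by (simp add: algebra_simps)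
qed

text \<open>On an open domain the derivatives given by \<open>tvs_deriv\<close> are those of the derivative family of the
  path; the product rule for the momentum is the chain rule for \<open>P\<close>.\<close>

lemma path_facts:
  assumes J: "open J" and path: "smooth_metric_path A J g"
    and gt: "gt = tvs_deriv TT g" and gtt: "gtt = tvs_deriv TT gt"
    and q: "q = (\<lambda>t. P (g t) (gt t))" and qt: "qt = tvs_deriv TT q"
    and t: "t \<in> J"
  shows "g t \<in> metrics A" "gt t \<in> E" "gtt t \<in> E" "q t \<in> E"
    "limitin TT (\<lambda>s. (1 / s) *\<^sub>R (g (t + s) - g t)) (gt t) (at 0)"
    "limitin TT (\<lambda>s. (1 / s) *\<^sub>R (q (t + s) - q t)) (qt t) (at 0)"
    "qt t = D_operator A P (g t) (gt t) (gt t) + P (g t) (gtt t)"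
    "limitin TT g (g t) (at t within J)" "limitin TT gt (gt t) (at t within J)"
    "limitin TT q (q t) (at t within J)" "limitin TT qt (qt t) (at t within J)"
proof -
  have met: "g t \<in> metrics A" if "t \<in> J" for t using path that by (simp add: smooth_metric_path_def)
  obtain D where D: "derivative_family euclidean J TT g D"
    using path unfolding smooth_metric_path_def tvs_smooth_iff by blast
  have within: "limitin TT u (u t) (at t within J)"
    if "limitin TT u' (u' t) (at t within J)" "t \<in> J" "\<And>t. t \<in> J \<Longrightarrow> u' t = u t" for u u' t
  proof -
    have "limitin TT u (u' t) (at t within J)"
      by (rule limitin_transform_eventually[OF _ that(1)]) (auto simp: eventually_at_filter that(3))
    then show ?thesis using that by simp
  qed
  have D0: "D [] t = g t" if "t \<in> J" for t by (rule derivative_family_Nil[OF D that])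
  have dg: "limitin TT (\<lambda>s. (1 / s) *\<^sub>R (g (t + s) - g t)) (D [1] t) (at 0)" if "t \<in> J" for t
    by (rule path_deriv_cong[OF _ J that D0]) (use family_deriv[OF D that, of "[]" 1] in simp_all)
  have gt_D: "D [1] t = gt t" if "t \<in> J" for t
    unfolding gt by (rule tvs_deriv_eq[OF dg[OF that], symmetric])
  have dgt: "limitin TT (\<lambda>s. (1 / s) *\<^sub>R (gt (t + s) - gt t)) (D [1, 1] t) (at 0)" if "t \<in> J" for t
    by (rule path_deriv_cong[OF _ J that gt_D]) (use family_deriv[OF D that, of "[1]" 1] in simp_all)
  have gtt_D: "D [1, 1] t = gtt t" if "t \<in> J" for t
    unfolding gtt by (rule tvs_deriv_eq[OF dgt[OF that], symmetric])
  have E: "gt t \<in> E" "gtt t \<in> E" if "t \<in> J" for t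
    using family_E[OF D that, of "[1]"] family_E[OF D that, of "[1, 1]"] gt_D gtt_D that by auto
  have near: "\<forall>\<^sub>F s in at 0. g (t + s) \<in> metrics A" if "t \<in> J" for t
  proof -
    have "((\<lambda>s. t + s) \<longlongrightarrow> t + 0) (at 0)" by (intro tendsto_intros)
    then have "\<forall>\<^sub>F s in at 0. t + s \<in> J"
      using J that by (auto dest: topological_tendstoD)
    then show ?thesis by eventually_elim (rule met)
  qed
  have dq: "limitin TT (\<lambda>s. (1 / s) *\<^sub>R (q (t + s) - q t))
      (D_operator A P (g t) (gt t) (gt t) + P (g t) (gtt t)) (at 0)" if "t \<in> J" for t
    unfolding q using dg[OF that] dgt[OF that]
    by (intro P_chain near met E that) (simp_all add: gt_D gtt_D that)
  have qt_eq: "qt t = D_operator A P (g t) (gt t) (gt t) + P (g t) (gtt t)" if "t \<in> J" for t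
    unfolding qt by (rule tvs_deriv_eq[OF dq[OF that]])
  have cg: "limitin TT g (g t) (at t within J)" if "t \<in> J" for t
    by (rule within[OF family_limit[OF D that] that D0])
  have cgt: "limitin TT gt (gt t) (at t within J)" if "t \<in> J" for t
    by (rule within[OF family_limit[OF D that] that gt_D])
  have cgtt: "limitin TT gtt (gtt t) (at t within J)" if "t \<in> J" for t
    by (rule within[OF family_limit[OF D that] that gtt_D])
  have evJ: "\<forall>\<^sub>F t in at t within J. g t \<in> metrics A" for t
    by (auto simp: eventually_at_filter met)
  have cqt: "limitin TT (\<lambda>t. D_operator A P (g t) (gt t) (gt t) + P (g t) (gtt t))
       (D_operator A P (g t) (gt t) (gt t) + P (g t) (gtt t)) (at t within J)" if "t \<in> J" for t
    by (intro limitin_add D_operator_cont P_cont cg cgt cgtt that met evJ)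
  show "g t \<in> metrics A" "gt t \<in> E" "gtt t \<in> E" by (intro met E t)+
  show "q t \<in> E" unfolding q by (intro P_E met E t)
  show "limitin TT (\<lambda>s. (1 / s) *\<^sub>R (g (t + s) - g t)) (gt t) (at 0)" using dg[OF t] gt_D[OF t] by simp
  show "limitin TT (\<lambda>s. (1 / s) *\<^sub>R (q (t + s) - q t)) (qt t) (at 0)" using dq[OF t] qt_eq[OF t] by simp
  show "qt t = D_operator A P (g t) (gt t) (gt t) + P (g t) (gtt t)" by (rule qt_eq[OF t])
  show "limitin TT g (g t) (at t within J)" by (rule cg[OF t])
  show "limitin TT gt (gt t) (at t within J)" by (rule cgt[OF t])
  show "limitin TT q (q t) (at t within J)" unfolding q by (intro P_cont cg cgt t met evJ)
  show "limitin TT qt (qt t) (at t within J)"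
    using within[OF cqt[OF t] t, of qt] qt_eq by simp
qed

text \<open>The energy is differentiated under the integral sign; after exchanging the mixed derivatives, the
  variation identity exhibits the integrand as a total time derivative plus the pairing of the
  variation field with the defect of the equation.  The total derivative integrates to zero because
  the variation field vanishes at the fixed end points.\<close>

theorem first_variation:
  assumes J: "open J" and path: "smooth_metric_path A J g"
    and gt: "gt = tvs_deriv TT g" and q: "q = (\<lambda>t. P (g t) (gt t))" and qt: "qt = tvs_deriv TT q"
    and ab: "a < b" "{a..b} \<subseteq> J" and \<epsilon>: "\<epsilon> > 0"
    and sm: "tvs_smooth euclidean ({-\<epsilon><..<\<epsilon>} \<times> J) TT \<gamma>"
    and met: "\<forall>s\<in>{-\<epsilon><..<\<epsilon>}. \<forall>t\<in>J. \<gamma> (s, t) \<in> metrics A"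
    and init: "\<forall>t\<in>J. \<gamma> (0, t) = g t"
    and fixed: "\<forall>s\<in>{-\<epsilon><..<\<epsilon>}. \<gamma> (s, a) = g a \<and> \<gamma> (s, b) = g b"
  shows "\<exists>k. (\<forall>t\<in>J. limitin TT (\<lambda>s. (1 / s) *\<^sub>R (\<gamma> (s, t) - g t)) (k t) (at 0)) \<and>
    ((\<lambda>s. path_energy A (metric_GP A P) a b (\<lambda>t. \<gamma> (s, t))) has_real_derivative
      integral {a..b} (\<lambda>t. ip (g t) (\<lambda>x. rhs (g t) (gt t) x - qt t x) (k t))) (at 0)"
proof -
  define I where "I = {-\<epsilon><..<\<epsilon>}"
  let ?T = "I \<times> J"
  have I: "open I" "0 \<in> I" "convex I" using \<epsilon> by (auto simp: I_def)
  have T: "open ?T" using I J by (simp add: open_Times)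
  note pf = path_facts[OF J path gt refl q qt]
  have abJ: "t \<in> J" if "t \<in> {a..b}" for t using ab that by auto
  obtain D where D: "derivative_family euclidean ?T TT \<gamma> D"
    using sm unfolding tvs_smooth_iff I_def by blast
  have D0: "D [] \<tau> = \<gamma> \<tau>" if "\<tau> \<in> ?T" for \<tau> by (rule derivative_family_Nil[OF D that])
  let ?h = "D [(0, 1)]" and ?k = "D [(1, 0)]" and ?hs = "D [(1, 0), (0, 1)]" and ?kt = "D [(0, 1), (1, 0)]"
  have met': "\<gamma> \<tau> \<in> metrics A" if "\<tau> \<in> ?T" for \<tau> using met that by (auto simp: I_def)
  note DE = family_E[OF D]
  have ds: "limitin TT (\<lambda>r. (1 / r) *\<^sub>R (D vs (s + r, t) - D vs (s, t))) (D ((1, 0) # vs) (s, t)) (at 0)"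
    if "(s, t) \<in> ?T" for s t vs
    using family_deriv[OF D that, of vs "(1, 0)"] by simp
  have dt: "limitin TT (\<lambda>r. (1 / r) *\<^sub>R (D vs (s, t + r) - D vs (s, t))) (D ((0, 1) # vs) (s, t)) (at 0)"
    if "(s, t) \<in> ?T" for s t vs
    using family_deriv[OF D that, of vs "(0, 1)"] by simp
  have ds\<gamma>: "limitin TT (\<lambda>r. (1 / r) *\<^sub>R (\<gamma> (s + r, t) - \<gamma> (s, t))) (?k (s, t)) (at 0)"
    if "(s, t) \<in> ?T" for s t
    by (rule path_deriv_cong[where c = "\<lambda>s. D [] (s, t)" and J = I, OF ds I(1)]) (use that D0 in auto)
  have dt\<gamma>: "limitin TT (\<lambda>r. (1 / r) *\<^sub>R (\<gamma> (s, t + r) - \<gamma> (s, t))) (?h (s, t)) (at 0)"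
    if "(s, t) \<in> ?T" for s t
    by (rule path_deriv_cong[where c = "\<lambda>t. D [] (s, t)" and J = J, OF dt J]) (use that D0 in auto)
  have h_deriv: "tvs_deriv TT (\<lambda>t. \<gamma> (s, t)) t = ?h (s, t)" if "(s, t) \<in> ?T" for s t
    by (rule tvs_deriv_eq[OF dt\<gamma>[OF that]])
  have h0: "?h (0, t) = gt t" if "t \<in> J" for t
  proof -
    have "limitin TT (\<lambda>r. (1 / r) *\<^sub>R (g (t + r) - g t)) (?h (0, t)) (at 0)"
      by (rule path_deriv_cong[where c = "\<lambda>t. \<gamma> (0, t)", OF dt\<gamma> J that]) (use that I init in auto)
    then show ?thesis unfolding gt by (rule tvs_deriv_eq[symmetric])
  qed
  have mixed: "?hs \<tau> = ?kt \<tau>" if \<tau>: "\<tau> \<in> ?T" for \<tau>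
  proof (intro ext)
    fix x
    obtain s0 t0 where st: "\<tau> = (s0, t0)" "(s0, t0) \<in> ?T" using \<tau> by (cases \<tau>) auto
    have ent: "((\<lambda>r. c r x $ i $ j) has_real_derivative l x $ i $ j) (at t)"
      if "limitin TT (\<lambda>s. (1 / s) *\<^sub>R (c (t + s) - c t)) l (at 0)" for c l t i j
      unfolding has_real_derivative_iff_has_vector_derivative
      by (rule bounded_linear.has_vector_derivative[OF _ pointwise_derivative[OF that]])
         (rule bounded_linear_compose[OF bounded_linear_vec_nth bounded_linear_vec_nth])
    have cont: "continuous_on ?T (\<lambda>(s, t). D vs (s, t) x $ i $ j)" for vs i j
      unfolding continuous_on_def case_prod_unfold prod.collapse
      by (intro ballI tendsto_vec_nth limitin_pointwise family_limit[OF D])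
    have "?kt (s0, t0) x $ i $ j = ?hs (s0, t0) x $ i $ j" for i j
      by (rule mixed_partials_eq[OF T st(2), where f = "\<lambda>s t. \<gamma> (s, t) x $ i $ j"
            and fs = "\<lambda>s t. ?k (s, t) x $ i $ j" and ft = "\<lambda>s t. ?h (s, t) x $ i $ j"])
         (intro ent ds\<gamma> dt\<gamma> ds dt cont; assumption)+
    then show "?hs \<tau> x = ?kt \<tau> x" by (simp add: st vec_eq_iff)
  qed
  define Q where "Q \<tau> = P (\<gamma> \<tau>) (?h \<tau>)" for \<tau>
  define Qs where "Qs \<tau> = D_operator A P (\<gamma> \<tau>) (?k \<tau>) (?h \<tau>) + P (\<gamma> \<tau>) (?hs \<tau>)" for \<tau>
  have lim\<gamma>: "limitin TT \<gamma> (\<gamma> \<tau>) (at \<tau> within ?T)" if "\<tau> \<in> ?T" for \<tau>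
  proof -
    have "limitin TT \<gamma> (D [] \<tau>) (at \<tau> within ?T)"
      by (rule limitin_transform_eventually[OF _ family_limit[OF D that]]) (auto simp: eventually_at_filter D0)
    then show ?thesis using D0[OF that] by simp
  qed
  have ev: "\<forall>\<^sub>F \<tau> in at \<tau> within ?T. \<gamma> \<tau> \<in> metrics A" for \<tau>
    by (auto simp: eventually_at_filter met')
  note fl = family_limit[OF D]
  have limQ: "limitin TT Q (Q \<tau>) (at \<tau> within ?T)" if "\<tau> \<in> ?T" for \<tau>
    unfolding Q_def[abs_def] by (intro P_cont lim\<gamma> fl met' ev that)
  have limQs: "limitin TT Qs (Qs \<tau>) (at \<tau> within ?T)" if "\<tau> \<in> ?T" for \<tau>
    unfolding Qs_def[abs_def] by (intro limitin_add D_operator_cont P_cont lim\<gamma> fl met' ev that)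
  note jc = joint_contI[OF lim\<gamma>] joint_contI[OF limQ] joint_contI[OF limQs] family_joint_cont[OF D]
  let ?G = "\<lambda>\<tau>. ip (\<gamma> \<tau>) (Q \<tau>) (?h \<tau>)"
  let ?G' = "\<lambda>\<tau>. ip (\<gamma> \<tau>) (\<lambda>x. Qs \<tau> x + drift (\<gamma> \<tau>) (?k \<tau>) (Q \<tau>) x) (?h \<tau>) + ip (\<gamma> \<tau>) (Q \<tau>) (?hs \<tau>)"
  have G_cont: "continuous_on ?T ?G" by (intro ip_cont T jc met')
  have G'_cont: "continuous_on ?T ?G'"
    by (intro continuous_on_add ip_cont T jc met' joint_cont_add joint_cont_drift)
  have dQ: "limitin TT (\<lambda>r. (1 / r) *\<^sub>R (Q (s + r, t) - Q (s, t))) (Qs (s, t)) (at 0)" if "(s, t) \<in> ?T" for s t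
  proof -
    have "((\<lambda>r. s + r) \<longlongrightarrow> s + 0) (at 0)" by (intro tendsto_intros)
    then have "\<forall>\<^sub>F r in at 0. s + r \<in> I"
      using I(1) that by (auto dest: topological_tendstoD)
    then have "\<forall>\<^sub>F r in at 0. \<gamma> (s + r, t) \<in> metrics A"
      by eventually_elim (use met' that in auto)
    then show ?thesis
      unfolding Q_def Qs_def
      by (rule P_chain[where c = "\<lambda>s. \<gamma> (s, t)" and h = "\<lambda>s. ?h (s, t)", OF _ met'[OF that] ds\<gamma>[OF that] DE[OF that] ds[OF that]])
  qed
  have dG: "((\<lambda>s. ?G (s, t)) has_real_derivative ?G' (s, t)) (at s)" if "s \<in> I" "t \<in> J" for s t
  proof -
    have m: "(s, t) \<in> ?T" if "s \<in> I" for s using that \<open>t \<in> J\<close> by simp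
    have cp: "joint_cont I (\<lambda>s. u (s, t))" if "joint_cont ?T u" for u
      by (rule joint_cont_compose[OF that]) (use \<open>t \<in> J\<close> in \<open>auto intro!: continuous_intros\<close>)
    show ?thesis
      by (rule ip_has_derivative[OF I(1) \<open>s \<in> I\<close>, where g' = "\<lambda>s. ?k (s, t)" and h' = "\<lambda>s. Qs (s, t)"
            and k' = "\<lambda>s. ?hs (s, t)"])
         (intro met' m cp jc pointwise_derivative ds\<gamma> dQ ds; assumption)+
  qed
  have energy: "path_energy A (metric_GP A P) a b (\<lambda>t. \<gamma> (s, t)) = 1/2 * integral (cbox a b) (\<lambda>t. ?G (s, t))"
    if "s \<in> I" for s
    unfolding path_energy_def
    using that abJ by (auto intro!: integral_cong simp: h_deriv metric_GP_def ip_def Q_def)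
  have "((\<lambda>s. integral (cbox a b) (\<lambda>t. ?G (s, t))) has_field_derivative integral (cbox a b) (\<lambda>t. ?G' (0, t))) (at 0 within I)"
  proof (rule leibniz_rule_field_derivative[where f = "\<lambda>s t. ?G (s, t)"
        and fx = "\<lambda>s t. ?G' (s, t)", OF _ _ _ I(2,3)])
    fix s t assume "s \<in> I" "t \<in> cbox a b"
    then show "((\<lambda>s. ?G (s, t)) has_field_derivative ?G' (s, t)) (at s within I)"
      by (intro has_field_derivative_at_within[OF dG] abJ) auto
  next
    fix s assume "s \<in> I"
    then have "continuous_on (cbox a b) (\<lambda>t. ?G (s, t))"
      by (intro continuous_on_compose2[OF G_cont] continuous_intros) (use abJ in auto)
    then show "(\<lambda>t. ?G (s, t)) integrable_on cbox a b" by (rule integrable_continuous)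
  next
    show "continuous_on (I \<times> cbox a b) (\<lambda>(s, t). ?G' (s, t))"
    proof -
      have "I \<times> cbox a b \<subseteq> ?T" using abJ by auto
      from continuous_on_subset[OF G'_cont this] show ?thesis by (simp add: case_prod_unfold)
    qed
  qed
  then have "((\<lambda>s. integral (cbox a b) (\<lambda>t. ?G (s, t))) has_real_derivative integral (cbox a b) (\<lambda>t. ?G' (0, t))) (at 0)"
    using at_within_open[OF I(2,1)] by simp
  from DERIV_cmult[OF this, of "1/2"]
  have dE: "((\<lambda>s. path_energy A (metric_GP A P) a b (\<lambda>t. \<gamma> (s, t))) has_real_derivative
      1/2 * integral {a..b} (\<lambda>t. ?G' (0, t))) (at 0)"
    unfolding cbox_interval[symmetric]
    by (rule has_field_derivative_transform_within_open[OF _ I(1,2)]) (rule energy[symmetric])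
  let ?K = "\<lambda>t. ip (g t) (q t) (?k (0, t))"
  let ?K' = "\<lambda>t. ip (g t) (\<lambda>x. qt t x + drift (g t) (gt t) (q t) x) (?k (0, t)) + ip (g t) (q t) (?kt (0, t))"
  have m0: "(0, t) \<in> ?T" if "t \<in> J" for t using I that by simp
  have cp0: "joint_cont J (\<lambda>t. D vs (0, t))" for vs
    by (rule joint_cont_compose[OF family_joint_cont[OF D]]) (use I in \<open>auto intro!: continuous_intros\<close>)
  have dK: "(?K has_real_derivative ?K' t) (at t)" if "t \<in> J" for t
    by (rule ip_has_derivative[OF J that, where g' = gt and h' = qt and k' = "\<lambda>t. ?kt (0, t)"])
       (intro pf(1) joint_contI pf(8-11) cp0 pointwise_derivative pf(5,6) dt m0; assumption)+
  have "(?K' has_integral ?K b - ?K a) {a..b}"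
    using ab abJ
    by (intro fundamental_theorem_of_calculus)
       (auto simp: has_real_derivative_iff_has_vector_derivative[symmetric] intro!: has_field_derivative_at_within[OF dK])
  moreover have kz: "?k (0, t) = 0" if "\<forall>s\<in>I. \<gamma> (s, t) = g t" "t \<in> J" for t
  proof (rule limitin_unique[OF ds\<gamma>[OF m0[OF that(2)]]])
    have z: "0 \<in> E" using E_zero[OF metricsD(1)[OF pf(1)[OF that(2)]]] .
    show "limitin TT (\<lambda>r. (1 / r) *\<^sub>R (\<gamma> (0 + r, t) - \<gamma> (0, t))) 0 (at 0)"
    proof (rule limitin_transform_eventually[OF _ limitin_const[OF z]])
      show "\<forall>\<^sub>F r in at 0. 0 = (1 / r) *\<^sub>R (\<gamma> (0 + r, t) - \<gamma> (0, t))"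
        unfolding eventually_at_topological using I that by (intro exI[of _ I]) auto
    qed
  qed simp
  have "?K a = 0" "?K b = 0"
    using kz[of a] kz[of b] fixed abJ[of a] abJ[of b] ab(1) by (simp_all add: I_def ip_zero_right)
  ultimately have K': "(?K' has_integral 0) {a..b}" by simp
  have G'_half: "1/2 * ?G' (0, t) = ?K' t + ip (g t) (\<lambda>x. rhs (g t) (gt t) x - qt t x) (?k (0, t))" if "t \<in> J" for t
  proof -
    have qtE: "qt t \<in> E" by (rule limitin_TT_D(1)[OF pf(6)[OF that]])
    show ?thesis
      using variation_identity[OF pf(1,2)[OF that] DE[OF m0[OF that]] DE[OF m0[OF that]] qtE, of "[(1, 0)]" "[(0, 1), (1, 0)]"]
        init h0[OF that] mixed[OF m0[OF that]] that
      by (simp add: Q_def Qs_def q)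
  qed
  have "continuous_on {a..b} (\<lambda>t. 1/2 * ?G' (0, t))"
    by (intro continuous_on_mult_left continuous_on_compose2[OF G'_cont] continuous_intros) (use I(2) abJ in auto)
  then have "((\<lambda>t. 1/2 * ?G' (0, t)) has_integral integral {a..b} (\<lambda>t. 1/2 * ?G' (0, t))) {a..b}"
    by (intro integrable_integral integrable_continuous_real)
  from has_integral_diff[OF this K', unfolded diff_0_right]
  have "((\<lambda>t. ip (g t) (\<lambda>x. rhs (g t) (gt t) x - qt t x) (?k (0, t))) has_integral
      integral {a..b} (\<lambda>t. 1/2 * ?G' (0, t))) {a..b}"
    by (rule has_integral_eq[rotated]) (simp only: G'_half[OF abJ] add_diff_cancel_left')
  then have "1/2 * integral {a..b} (\<lambda>t. ?G' (0, t))
      = integral {a..b} (\<lambda>t. ip (g t) (\<lambda>x. rhs (g t) (gt t) x - qt t x) (?k (0, t)))"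
    by (simp add: integral_unique)
  moreover have "\<forall>t\<in>J. limitin TT (\<lambda>s. (1 / s) *\<^sub>R (\<gamma> (s, t) - g t)) (?k (0, t)) (at 0)"
    using ds\<gamma>[OF m0] init by simp
  ultimately show ?thesis using dE by (intro exI[of _ "\<lambda>t. ?k (0, t)"]) simp
qed

end


section \<open>Test variations\<close>

text \<open>The functions \<open>x\<^sup>-\<^sup>n exp (-1/x)\<close>, extended by zero, composed with \<open>x = \<sigma> (t - a)\<close>.  Their linear span
  is closed under differentiation, and products of two of them are bump functions.\<close>

definition flat :: "nat \<Rightarrow> real \<Rightarrow> real \<Rightarrow> real \<Rightarrow> real" where
  "flat n a \<sigma> t = (let x = \<sigma> * (t - a) in if x > 0 then exp (- (1 / x)) / x ^ n else 0)"

lemma flat_quotient_tendsto: "((\<lambda>x. exp (- (1 / x)) / x ^ n) \<longlongrightarrow> 0) (at_right (0::real))"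
proof -
  have "((\<lambda>y::real. y ^ n / exp y) \<longlongrightarrow> 0) at_top" by (rule tendsto_power_div_exp_0)
  then have "((\<lambda>x::real. inverse x ^ n / exp (inverse x)) \<longlongrightarrow> 0) (at_right 0)"
    by (rule filterlim_compose[OF _ filterlim_inverse_at_top_right])
  then show ?thesis by (simp add: exp_minus field_simps)
qed

lemma DERIV_flat:
  assumes "\<sigma> \<noteq> 0"
  shows "(flat n a \<sigma> has_real_derivative \<sigma> * (flat (n + 2) a \<sigma> t - real n * flat (n + 1) a \<sigma> t)) (at t)"
proof -
  define F where "F n x = (if x > 0 then exp (- (1 / x)) / x ^ n else 0)" for n and x :: real
  have F: "(F n has_real_derivative F (n + 2) x - real n * F (n + 1) x) (at x)" for x
  proof -
    consider "x > 0" | "x < 0" | "x = 0" by linarith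
    then show ?thesis
    proof cases
      case 1
      have "((\<lambda>x. exp (- (1 / x)) / x ^ n) has_real_derivative
          exp (- (1 / x)) / x ^ (n + 2) - real n * (exp (- (1 / x)) / x ^ (n + 1))) (at x)"
        using 1 by (auto intro!: derivative_eq_intros simp: field_simps power2_eq_square)
          (cases n; simp add: field_simps)
      then have "((\<lambda>x. exp (- (1 / x)) / x ^ n) has_real_derivative F (n + 2) x - real n * F (n + 1) x) (at x)"
        using 1 by (simp add: F_def)
      then show ?thesis
        by (rule has_field_derivative_transform_within_open[of _ _ _ "{0<..}"]) (use 1 in \<open>auto simp: F_def\<close>)
    next
      case 2
      have "((\<lambda>x. 0) has_real_derivative F (n + 2) x - real n * F (n + 1) x) (at x)"
        using 2 by (simp add: F_def)
      then show ?thesis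
        by (rule has_field_derivative_transform_within_open[of _ _ _ "{..<0}"]) (use 2 in \<open>auto simp: F_def\<close>)
    next
      case 3
      have "((\<lambda>h. F n h / h) \<longlongrightarrow> 0) (at_right 0)"
        by (rule Lim_transform_eventually[OF flat_quotient_tendsto[of "n + 1"]])
           (auto simp: eventually_at_filter F_def field_simps intro!: always_eventually)
      moreover have "((\<lambda>h. F n h / h) \<longlongrightarrow> 0) (at_left 0)"
        by (rule Lim_transform_eventually[OF tendsto_const])
           (auto simp: eventually_at_filter F_def intro!: always_eventually)
      ultimately have "((\<lambda>h. F n h / h) \<longlongrightarrow> 0) (at 0)" by (simp add: filterlim_at_split)
      then show ?thesis using 3 by (simp add: DERIV_def F_def)
    qed
  qed
  have "((\<lambda>t. F n (\<sigma> * (t - a))) has_real_derivative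
      (F (n + 2) (\<sigma> * (t - a)) - real n * F (n + 1) (\<sigma> * (t - a))) * \<sigma>) (at t)"
    by (rule DERIV_chain2[OF F]) (auto intro!: derivative_eq_intros)
  moreover have "flat k a \<sigma> = (\<lambda>t. F k (\<sigma> * (t - a)))" for k
    by (simp add: flat_def F_def Let_def fun_eq_iff)
  ultimately show ?thesis by (simp add: mult.commute)
qed

lemma Ck_flat:
  assumes "\<sigma> \<noteq> 0"
  shows "Ck N UNIV (flat n a \<sigma>)"
proof (induction N arbitrary: n)
  case (Suc N)
  let ?f' = "\<lambda>t. \<sigma> * (flat (n + 2) a \<sigma> t + (- real n) * flat (n + 1) a \<sigma> t)"
  have 1: "Ck N UNIV (\<lambda>t. (- real n) * flat (n + 1) a \<sigma> t)"
    by (rule Ck_bounded_linear[OF bounded_linear_mult_right open_UNIV Suc.IH])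
  have f': "Ck N UNIV ?f'"
    by (rule Ck_bounded_linear[OF bounded_linear_mult_right open_UNIV Ck_add[OF open_UNIV Suc.IH 1]])
  show ?case
  proof (rule Ck_SucI[OF open_UNIV, where f' = "\<lambda>t v. ?f' t * v"])
    show "(flat n a \<sigma> has_derivative (\<lambda>v. ?f' t * v)) (at t)" for t
      using DERIV_flat[OF assms, of n a t] by (simp add: has_field_derivative_def)
    show "Ck N UNIV (\<lambda>t. ?f' t * v)" for v
      by (rule Ck_bounded_linear[OF bounded_linear_mult_left open_UNIV f'])
  qed
qed simp

lemma bump_function:
  assumes "a < b"
  obtains d :: "nat \<Rightarrow> real \<Rightarrow> real"
  where "\<And>k t. (d k has_real_derivative d (Suc k) t) (at t)"
    and "\<And>t. a < t \<Longrightarrow> t < b \<Longrightarrow> d 0 t > 0" and "\<And>t. t \<notin> {a<..<b} \<Longrightarrow> d 0 t = 0"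
proof -
  define \<phi> where "\<phi> t = flat 0 a 1 t * flat 0 b (-1) t" for t
  have "smooth_on UNIV \<phi>"
    unfolding smooth_on_iff_Ck \<phi>_def[abs_def]
  proof
    show "Ck N UNIV (\<lambda>t. flat 0 a 1 t * flat 0 b (-1) t)" for N
      by (rule Ck_bilinear[OF bounded_bilinear_mult open_UNIV Ck_flat Ck_flat]) simp_all
  qed
  then have d: "iter_partial vs \<phi> differentiable (at t)" for vs t by (simp add: smooth_on_def)
  show ?thesis
  proof (rule that[of "\<lambda>k. iter_partial (replicate k 1) \<phi>"])
    fix k t
    obtain D where "(iter_partial (replicate k 1) \<phi> has_real_derivative D) (at t)"
      using d[of "replicate k 1" t] real_differentiable_def by blast
    moreover from this have "frechet_derivative (iter_partial (replicate k 1) \<phi>) (at t) = (*) D"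
      unfolding has_field_derivative_def by (rule frechet_derivative_at[symmetric])
    ultimately show "(iter_partial (replicate k 1) \<phi> has_real_derivative iter_partial (replicate (Suc k) 1) \<phi> t) (at t)"
      by simp
  qed (use assms in \<open>auto simp: \<phi>_def flat_def Let_def\<close>)
qed

text \<open>Coefficients of the iterated directional derivatives of \<open>(s, t) \<mapsto> s * \<phi> t\<close>: along \<open>vs\<close> the
  derivative is \<open>s * prod_snd vs * \<phi>\<^sup>(\<^sup>k\<^sup>) t + sum_fst vs * \<phi>\<^sup>(\<^sup>k\<^sup>-\<^sup>1\<^sup>) t\<close> with \<open>k = length vs\<close>;
  for empty \<open>vs\<close> the second coefficient is zero, so the truncated index does not matter.\<close>

fun prod_snd :: "(real \<times> real) list \<Rightarrow> real" where
  "prod_snd [] = 1"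
| "prod_snd (v # vs) = snd v * prod_snd vs"

fun sum_fst :: "(real \<times> real) list \<Rightarrow> real" where
  "sum_fst [] = 0"
| "sum_fst (v # vs) = fst v * prod_snd vs + snd v * sum_fst vs"

context compact_manifold
begin

text \<open>The derivative family is that of \<open>g\<close> along the time components plus the explicit derivatives of
  \<open>s * \<phi> t\<close> times \<open>h\<close>.\<close>

lemma bump_variation_smooth:
  assumes J: "open J" and g: "tvs_smooth euclidean J TT g" and h: "h \<in> E"
    and d: "\<And>k t. (d k has_real_derivative d (Suc k) t) (at t)"
  shows "tvs_smooth euclidean (S \<times> J) TT (\<lambda>(s, t). g t + (s * d 0 t) *\<^sub>R h)"
proof -
  obtain D where D: "derivative_family euclidean J TT g D"
    using g unfolding tvs_smooth_iff by blast
  define \<alpha> where "\<alpha> vs = (\<lambda>(s, t). s * prod_snd vs * d (length vs) t + sum_fst vs * d (length vs - 1) t)" for vs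
  define B where "B vs \<tau> = D (map snd vs) (snd \<tau>) + \<alpha> vs \<tau> *\<^sub>R h" for vs \<tau>
  have dcont: "continuous_on UNIV (d k)" for k
    by (rule continuous_at_imp_continuous_on) (use d DERIV_isCont in blast)
  have "derivative_family euclidean (S \<times> J) TT (\<lambda>(s, t). g t + (s * d 0 t) *\<^sub>R h) B"
    unfolding derivative_family_def
  proof (intro conjI ballI allI)
    fix \<tau> assume "\<tau> \<in> S \<times> J"
    then show "B [] \<tau> = (case \<tau> of (s, t) \<Rightarrow> g t + (s * d 0 t) *\<^sub>R h)"
      using derivative_family_Nil[OF D] by (auto simp: B_def \<alpha>_def)
  next
    fix vs :: "(real \<times> real) list" and v \<tau> :: "real \<times> real" assume \<tau>: "\<tau> \<in> S \<times> J"
    obtain s t where st: "\<tau> = (s, t)" "t \<in> J" using \<tau> by auto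
    obtain x y where v: "v = (x, y)" by (cases v)
    let ?n = "length vs"
    have "((\<lambda>r. \<alpha> vs (s + r * x, t + r * y)) has_real_derivative \<alpha> (v # vs) (s, t)) (at 0)"
    proof -
      have lin: "((\<lambda>r. t + r * y) has_real_derivative y) (at 0)" "((\<lambda>r. s + r * x) has_real_derivative x) (at 0)"
        by (auto intro!: derivative_eq_intros)
      have dd: "((\<lambda>r. d k (t + r * y)) has_real_derivative d (Suc k) t * y) (at 0)" for k
        using DERIV_chain2[OF d[of k "t + 0 * y"] lin(1)] by simp
      have der: "((\<lambda>r. (s + r * x) * prod_snd vs * d ?n (t + r * y) + sum_fst vs * d (?n - 1) (t + r * y)) has_real_derivative
          (x * prod_snd vs * d ?n (t + 0 * y) + d (Suc ?n) t * y * ((s + 0 * x) * prod_snd vs)) + sum_fst vs * (d (Suc (?n - 1)) t * y)) (at 0)"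
        by (intro DERIV_add DERIV_mult DERIV_cmult dd DERIV_cmult_right lin)
      show ?thesis
        unfolding \<alpha>_def prod.case
        by (rule DERIV_cong[OF der]) (cases vs; simp add: v algebra_simps)
    qed
    then have lim: "((\<lambda>r. (1 / r) * (\<alpha> vs (s + r * x, t + r * y) - \<alpha> vs (s, t))) \<longlongrightarrow> \<alpha> (v # vs) (s, t)) (at 0)"
      by (simp add: DERIV_def)
    have "limitin TT (\<lambda>r. (1 / r) *\<^sub>R (D (map snd vs) (t + r *\<^sub>R y) - D (map snd vs) t)
        + ((1 / r) * (\<alpha> vs (s + r * x, t + r * y) - \<alpha> vs (s, t))) *\<^sub>R h) (D (y # map snd vs) t + \<alpha> (v # vs) (s, t) *\<^sub>R h) (at 0)"
      by (intro limitin_add limitin_scaleR lim limitin_const h family_deriv[OF D] st(2))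
    moreover have "(1 / r) *\<^sub>R (D (map snd vs) (t + r *\<^sub>R y) - D (map snd vs) t)
        + ((1 / r) * (\<alpha> vs (s + r * x, t + r * y) - \<alpha> vs (s, t))) *\<^sub>R h = (1 / r) *\<^sub>R (B vs (\<tau> + r *\<^sub>R v) - B vs \<tau>)" for r
      by (simp add: B_def st v algebra_simps)
    ultimately show "limitin TT (\<lambda>r::real. (1 / r) *\<^sub>R (B vs (\<tau> + r *\<^sub>R v) - B vs \<tau>)) (B (v # vs) \<tau>) (at 0)"
      by (simp add: B_def st v)
  next
    fix k
    let ?Z = "prod_topology (subtopology euclidean (S \<times> J)) (product_topology (\<lambda>i::nat. euclidean :: (real \<times> real) topology) {..<k})"
    show "continuous_map ?Z TT (\<lambda>(u, f). B (map f [0..<k]) u)"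
      unfolding continuous_map_atin
    proof
      fix z0 assume z0: "z0 \<in> topspace ?Z"
      have lim: "(f \<longlongrightarrow> f z0) (atin ?Z z0)" if "continuous_map ?Z euclidean f" for f :: "_ \<Rightarrow> 'x::topological_space"
        using limitin_continuous_map[OF that z0 refl] by (simp add: limitin_canonical_iff)
      have cu: "continuous_map ?Z euclidean (\<lambda>z. fst z)"
        by (rule continuous_map_into_fulltopology[OF continuous_map_fst])
      have cf: "continuous_map ?Z euclidean (\<lambda>z. snd z i)" if "i < k" for i
        using continuous_map_compose[OF continuous_map_snd continuous_map_product_projection[of i "{..<k}"]] that
        by (simp add: o_def)
      have lu: "((\<lambda>z. fst (fst z)) \<longlongrightarrow> fst (fst z0)) (atin ?Z z0)" "((\<lambda>z. snd (fst z)) \<longlongrightarrow> snd (fst z0)) (atin ?Z z0)"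
        by (intro tendsto_fst tendsto_snd lim cu)+
      have lf: "((\<lambda>z. snd z i) \<longlongrightarrow> snd z0 i) (atin ?Z z0)" if "i < k" for i by (rule lim[OF cf[OF that]])
      have lp: "((\<lambda>z. prod_snd (map (snd z) is)) \<longlongrightarrow> prod_snd (map (snd z0) is)) (atin ?Z z0)" if "set is \<subseteq> {..<k}" for "is"
        using that by (induction "is") (auto intro!: tendsto_intros lf)
      have ls: "((\<lambda>z. sum_fst (map (snd z) is)) \<longlongrightarrow> sum_fst (map (snd z0) is)) (atin ?Z z0)" if "set is \<subseteq> {..<k}" for "is"
        using that by (induction "is") (auto intro!: tendsto_intros lf lp)
      have ld: "((\<lambda>z. d n (snd (fst z))) \<longlongrightarrow> d n (snd (fst z0))) (atin ?Z z0)" for n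
        using continuous_on_tendsto_compose[OF dcont lu(2)] by simp
      have "((\<lambda>z. \<alpha> (map (snd z) [0..<k]) (fst z)) \<longlongrightarrow> \<alpha> (map (snd z0) [0..<k]) (fst z0)) (atin ?Z z0)"
        unfolding \<alpha>_def case_prod_unfold length_map
        by (intro tendsto_intros lu ld lp ls) auto
      moreover have "limitin TT (\<lambda>z. D (map (\<lambda>v. v z) (map (\<lambda>i z. snd (snd z i)) [0..<k])) (snd (fst z)))
          (D (map (\<lambda>i. snd (snd z0 i)) [0..<k]) (snd (fst z0))) (atin ?Z z0)"
      proof (rule derivative_family_limit[OF D])
        show "limitin euclidean (\<lambda>z. snd (fst z)) (snd (fst z0)) (atin ?Z z0)" using lu(2) by simp
        have topJ: "snd (fst z) \<in> J" if "z \<in> topspace ?Z" for z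
          using that by (simp only: topspace_prod_topology topspace_subtopology mem_Times_iff Int_iff)
        show "snd (fst z0) \<in> J" by (rule topJ[OF z0])
        show "\<forall>\<^sub>F z in atin ?Z z0. snd (fst z) \<in> J"
          unfolding eventually_atin
        proof (intro disjI2 exI[of _ "topspace ?Z"] conjI openin_topspace z0 ballI)
          fix z assume "z \<in> topspace ?Z - {z0}"
          then show "snd (fst z) \<in> J" by (intro topJ) (rule DiffD1)
        qed
      qed (auto intro!: tendsto_snd lf)
      ultimately have "limitin TT (\<lambda>z. D (map (\<lambda>v. v z) (map (\<lambda>i z. snd (snd z i)) [0..<k])) (snd (fst z))
          + \<alpha> (map (snd z) [0..<k]) (fst z) *\<^sub>R h)
          (D (map (\<lambda>i. snd (snd z0 i)) [0..<k]) (snd (fst z0)) + \<alpha> (map (snd z0) [0..<k]) (fst z0) *\<^sub>R h) (atin ?Z z0)"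
        by (intro limitin_add limitin_scaleR limitin_const h)
      then show "limitin TT (\<lambda>(u, f). B (map f [0..<k]) u) ((\<lambda>(u, f). B (map f [0..<k]) u) z0) (atin ?Z z0)"
        by (simp add: B_def case_prod_unfold o_def)
    qed
  qed
  then show ?thesis unfolding tvs_smooth_iff by (rule exI[of _ B])
qed

text \<open>The bound on \<open>s\<close> has to serve all of \<open>J\<close>, where \<open>g\<close> may degenerate towards the ends; it exists
  because the variation is trivial outside the compact interval \<open>{a..b}\<close>.\<close>

lemma bump_variation_metrics:
  assumes J: "open J" and g: "smooth_metric_path A J g" and h: "h \<in> E"
    and d: "continuous_on UNIV d" "\<And>t. t \<notin> {a<..<b} \<Longrightarrow> d t = 0" and ab: "{a..b} \<subseteq> J"
  shows "\<exists>\<epsilon>>0. \<forall>s\<in>{-\<epsilon><..<\<epsilon>}. \<forall>t\<in>J. g t + (s * d t) *\<^sub>R h \<in> metrics A"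
proof -
  have met: "g t \<in> metrics A" if "t \<in> J" for t using g that by (simp add: smooth_metric_path_def)
  obtain D where D: "derivative_family euclidean J TT g D"
    using g unfolding smooth_metric_path_def tvs_smooth_iff by blast
  let ?T = "UNIV \<times> J :: (real \<times> real) set"
  let ?u = "\<lambda>\<tau>. g (snd \<tau>) + (fst \<tau> * d (snd \<tau>)) *\<^sub>R h"
  have T: "open ?T" using J by (simp add: open_Times)
  have gj: "joint_cont ?T (\<lambda>\<tau>. D [] (snd \<tau>))"
    by (rule joint_cont_compose[OF family_joint_cont[OF D]]) (auto intro!: continuous_intros)
  have hj: "joint_cont ?T (\<lambda>\<tau>. (fst \<tau> * d (snd \<tau>)) *\<^sub>R h)"
  proof (rule joint_contI)
    fix \<tau>
    have "((\<lambda>\<tau>. fst \<tau> * d (snd \<tau>)) \<longlongrightarrow> fst \<tau> * d (snd \<tau>)) (at \<tau> within ?T)"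
      by (intro tendsto_intros continuous_on_tendsto_compose[OF d(1)]) auto
    then show "limitin TT (\<lambda>\<tau>. (fst \<tau> * d (snd \<tau>)) *\<^sub>R h) ((fst \<tau> * d (snd \<tau>)) *\<^sub>R h) (at \<tau> within ?T)"
      by (intro limitin_scaleR limitin_const h)
  qed
  have "open {(\<tau>, x). \<tau> \<in> ?T \<and> posdef (D [] (snd \<tau>) x + ((fst \<tau> * d (snd \<tau>)) *\<^sub>R h) x)}"
    using open_posdef_family[OF T joint_cont_add[OF gj hj]] .
  \<comment> \<open>Regrouped to apply the tube lemma to the compact factor of time interval and manifold.\<close>
  then have "open ((\<lambda>(s, t, x). ((s, t), x)) -` {(\<tau>, x). \<tau> \<in> ?T \<and> posdef (D [] (snd \<tau>) x + ((fst \<tau> * d (snd \<tau>)) *\<^sub>R h) x)})"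
    by (rule open_vimage) (auto simp: case_prod_unfold intro!: continuous_intros)
  also have "(\<lambda>(s, t, x). ((s, t), x)) -` {(\<tau>, x). \<tau> \<in> ?T \<and> posdef (D [] (snd \<tau>) x + ((fst \<tau> * d (snd \<tau>)) *\<^sub>R h) x)}
      = {(s, t, x). t \<in> J \<and> posdef (?u (s, t) x)}"
    using derivative_family_Nil[OF D] by auto
  finally have op: "open {(s, t, x). t \<in> J \<and> posdef (?u (s, t) x)}" .
  have "{0} \<times> ({a..b} \<times> UNIV) \<subseteq> {(s, t, x). t \<in> J \<and> posdef (?u (s, t) x)}"
    using ab metricsD(2)[OF met] by auto
  from Elementary_Topology.tube_lemma[OF compact_Times[OF compact_Icc compact_UNIV'] op this]
  obtain X0 where X0: "0 \<in> X0" "open X0" "X0 \<times> ({a..b} \<times> UNIV) \<subseteq> {(s, t, x). t \<in> J \<and> posdef (?u (s, t) x)}"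
    by (elim exE conjE)
  obtain \<epsilon> where \<epsilon>: "\<epsilon> > 0" "ball 0 \<epsilon> \<subseteq> X0" using X0 by (meson open_contains_ball)
  have "g t + (s * d t) *\<^sub>R h \<in> metrics A" if "s \<in> {-\<epsilon><..<\<epsilon>}" "t \<in> J" for s t
  proof (cases "t \<in> {a..b}")
    case True
    have "s \<in> X0" using that(1) \<epsilon> by (auto simp: dist_real_def)
    then have pd: "posdef ((g t + (s * d t) *\<^sub>R h) x)" for x using X0(3) True by force
    have "g t + (s * d t) *\<^sub>R h \<in> E" by (intro E_plus E_scaleR h metricsD(1)[OF met[OF that(2)]])
    then show ?thesis using pd by (simp add: metrics_def posdef_def)
  next
    case False
    then have "d t = 0" by (intro d(2)) auto
    then show ?thesis using met[OF that(2)] by simp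
  qed
  then show ?thesis using \<epsilon>(1) by blast
qed

end

context geodesic_setting
begin

section \<open>The geodesic equation\<close>

text \<open>If the defect of the equation paired with some field \<open>h\<close> does not vanish at a time \<open>t\<^sub>0\<close>, it keeps
  its sign on an interval around \<open>t\<^sub>0\<close>; the variation by \<open>h\<close> times a bump function supported there then
  has non-zero first variation.\<close>

lemma geodesic_iff_momentum:
  assumes J: "open J" and path: "smooth_metric_path A J g"
    and gt: "gt = tvs_deriv TT g" and q: "q = (\<lambda>t. P (g t) (gt t))" and qt: "qt = tvs_deriv TT q"
  shows "is_geodesic A (metric_GP A P) J g \<longleftrightarrow> (\<forall>t\<in>J. qt t = rhs (g t) (gt t))"
proof
  note pf = path_facts[OF J path gt refl q qt]
  have qtE: "qt t \<in> E" if "t \<in> J" for t by (rule limitin_TT_D(1)[OF pf(6)[OF that]])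
  show "is_geodesic A (metric_GP A P) J g" if eq: "\<forall>t\<in>J. qt t = rhs (g t) (gt t)"
    unfolding is_geodesic_def
  proof (intro conjI path allI impI, elim conjE)
    fix a b \<epsilon> :: real and \<gamma>
    assume ab: "a < b" "{a..b} \<subseteq> J" and \<epsilon>: "0 < \<epsilon>"
      and v: "tvs_smooth euclidean ({-\<epsilon><..<\<epsilon>} \<times> J) TT \<gamma>"
        "\<forall>s\<in>{-\<epsilon><..<\<epsilon>}. \<forall>t\<in>J. \<gamma> (s, t) \<in> metrics A" "\<forall>t\<in>J. \<gamma> (0, t) = g t"
        "\<forall>s\<in>{-\<epsilon><..<\<epsilon>}. \<gamma> (s, a) = g a \<and> \<gamma> (s, b) = g b"
    obtain k where k: "((\<lambda>s. path_energy A (metric_GP A P) a b (\<lambda>t. \<gamma> (s, t))) has_real_derivative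
      integral {a..b} (\<lambda>t. ip (g t) (\<lambda>x. rhs (g t) (gt t) x - qt t x) (k t))) (at 0)"
      using first_variation[OF J path gt q qt ab \<epsilon> v] by blast
    have "ip (g t) (\<lambda>x. rhs (g t) (gt t) x - qt t x) (k t) = 0" if "t \<in> {a..b}" for t
    proof -
      have "(\<lambda>x. rhs (g t) (gt t) x - qt t x) = 0" using eq that ab by (auto simp: fun_eq_iff)
      then show ?thesis using ip_zero_right[of "g t" "k t"] by (simp add: ip_commute)
    qed
    then have "integral {a..b} (\<lambda>t. ip (g t) (\<lambda>x. rhs (g t) (gt t) x - qt t x) (k t)) = integral {a..b} (\<lambda>t. 0)"
      by (intro integral_cong)
    with k show "((\<lambda>s. path_energy A (metric_GP A P) a b (\<lambda>t. \<gamma> (s, t))) has_real_derivative 0) (at 0)" by simp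
  qed
  show "\<forall>t\<in>J. qt t = rhs (g t) (gt t)" if geo: "is_geodesic A (metric_GP A P) J g"
  proof
    fix t0 assume t0: "t0 \<in> J"
    let ?X = "\<lambda>t x. rhs (g t) (gt t) x - qt t x"
    have XE: "?X t \<in> E" if "t \<in> J" for t by (intro E_diff rhs_E pf(1,2) qtE that)
    have "ip (g t0) h (?X t0) = 0" if h: "h \<in> E" for h
    proof (rule ccontr)
      assume ne: "ip (g t0) h (?X t0) \<noteq> 0"
      let ?\<psi> = "\<lambda>t. ip (g t) (?X t) h"
      have evm: "\<forall>\<^sub>F t in at t within J. g t \<in> metrics A" for t by (auto simp: eventually_at_filter pf(1))
      have jg: "joint_cont J g" "joint_cont J gt" "joint_cont J q" "joint_cont J qt"
        by (auto intro!: joint_contI pf)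
      have ja: "joint_cont J (\<lambda>t. Adj (g t) (gt t) (gt t))"
        by (intro joint_contI Adj_cont pf evm)
      have "joint_cont J (\<lambda>t. rhs (g t) (gt t))"
        unfolding rhs_drift codrift_def using jg ja pf(1)
        by (intro joint_cont_diff joint_cont_add joint_cont_cmult joint_cont_drift joint_cont_contract
            joint_cont_scale_trace[where h = "\<lambda>t x. P (g t) (gt t) x ** matrix_inv (g t x) ** gt t x"])
           (auto simp: q)
      then have \<psi>c: "continuous_on J ?\<psi>"
        by (intro ip_cont J jg joint_cont_diff joint_cont_const h pf(1))
      have "isCont ?\<psi> t0" using \<psi>c J t0 by (simp add: continuous_on_eq_continuous_at)
      moreover have "?\<psi> t0 \<noteq> 0" using ne by (simp add: ip_commute)
      ultimately have "\<forall>\<^sub>F t in at t0. ?\<psi> t * ?\<psi> t0 > 0"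
        by (intro order_tendstoD(1)[OF tendsto_mult[OF isContD tendsto_const]]) (auto simp: zero_less_mult_iff)
      then obtain U where U: "open U" "t0 \<in> U" "\<And>t. t \<in> U \<Longrightarrow> t \<noteq> t0 \<Longrightarrow> ?\<psi> t * ?\<psi> t0 > 0"
        unfolding eventually_at_topological by blast
      have U': "?\<psi> t * ?\<psi> t0 > 0" if "t \<in> U" for t
        using U(3)[OF that] \<open>?\<psi> t0 \<noteq> 0\<close> by (cases "t = t0") (auto simp: zero_less_mult_iff)
      obtain r where r: "r > 0" "cball t0 r \<subseteq> U \<inter> J"
        using open_Int[OF U(1) J] U(2) t0 by (meson IntI open_contains_cball)
      define a b where "a = t0 - r" and "b = t0 + r"
      have ab: "a < b" and abU: "{a..b} \<subseteq> U \<inter> J"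
        using r by (auto simp: a_def b_def dist_real_def subset_iff abs_le_iff)
      then have abJ: "{a..b} \<subseteq> J" by blast
      obtain d :: "nat \<Rightarrow> real \<Rightarrow> real" where d: "\<And>k t. (d k has_real_derivative d (Suc k) t) (at t)"
        "\<And>t. a < t \<Longrightarrow> t < b \<Longrightarrow> d 0 t > 0" "\<And>t. t \<notin> {a<..<b} \<Longrightarrow> d 0 t = 0"
        using bump_function[OF ab] by metis
      have dc: "continuous_on UNIV (d 0)"
        by (rule continuous_at_imp_continuous_on) (use d(1) DERIV_isCont in blast)
      obtain \<epsilon> where \<epsilon>: "\<epsilon> > 0" "\<forall>s\<in>{-\<epsilon><..<\<epsilon>}. \<forall>t\<in>J. g t + (s * d 0 t) *\<^sub>R h \<in> metrics A"
        using bump_variation_metrics[OF J path h dc d(3) abJ] by blast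
      let ?\<gamma> = "\<lambda>(s, t). g t + (s * d 0 t) *\<^sub>R h"
      have sm: "tvs_smooth euclidean ({-\<epsilon><..<\<epsilon>} \<times> J) TT ?\<gamma>"
        using path by (intro bump_variation_smooth J h d(1)) (simp add: smooth_metric_path_def)
      have v: "\<forall>s\<in>{-\<epsilon><..<\<epsilon>}. \<forall>t\<in>J. ?\<gamma> (s, t) \<in> metrics A" "\<forall>t\<in>J. ?\<gamma> (0, t) = g t"
        "\<forall>s\<in>{-\<epsilon><..<\<epsilon>}. ?\<gamma> (s, a) = g a \<and> ?\<gamma> (s, b) = g b"
        using \<epsilon>(2) d(3) by auto
      obtain k where k: "\<And>t. t \<in> J \<Longrightarrow> limitin TT (\<lambda>s. (1 / s) *\<^sub>R (?\<gamma> (s, t) - g t)) (k t) (at 0)"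
        and dE: "((\<lambda>s. path_energy A (metric_GP A P) a b (\<lambda>t. ?\<gamma> (s, t))) has_real_derivative
          integral {a..b} (\<lambda>t. ip (g t) (?X t) (k t))) (at 0)"
        using first_variation[OF J path gt q qt ab abJ \<epsilon>(1) sm v] by blast
      have "((\<lambda>s. path_energy A (metric_GP A P) a b (\<lambda>t. ?\<gamma> (s, t))) has_real_derivative 0) (at 0)"
        using geo ab abJ \<epsilon>(1) sm v unfolding is_geodesic_def by blast
      from DERIV_unique[OF dE this]
      have zero: "integral {a..b} (\<lambda>t. ip (g t) (?X t) (k t)) = 0" .
      have k_eq: "k t = d 0 t *\<^sub>R h" if "t \<in> J" for t
      proof (rule limitin_unique[OF k[OF that]])
        show "limitin TT (\<lambda>s. (1 / s) *\<^sub>R (?\<gamma> (s, t) - g t)) (d 0 t *\<^sub>R h) (at 0)"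
        proof (rule limitin_transform_eventually)
          show "limitin TT (\<lambda>s. d 0 t *\<^sub>R h) (d 0 t *\<^sub>R h) (at 0)" by (intro limitin_const E_scaleR h)
          show "\<forall>\<^sub>F s in at 0. d 0 t *\<^sub>R h = (1 / s) *\<^sub>R (?\<gamma> (s, t) - g t)"
            using eventually_neq_at_within[of 0] by eventually_elim simp
        qed
      qed simp
      have ip_k: "ip (g t) (?X t) (k t) = d 0 t * ?\<psi> t" if "t \<in> {a..b}" for t
        using k_eq[of t] that abJ ip_scaleR[of "g t" "d 0 t" h "?X t"]
        by (auto simp: ip_commute scaleR_fun_def)
      let ?f = "\<lambda>t. d 0 t * (?\<psi> t * ?\<psi> t0)"
      have "integral {a..b} (\<lambda>t. d 0 t * ?\<psi> t) = 0"
        using zero integral_cong[of "{a..b}", OF ip_k] by simp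
      then have "integral {a..b} (\<lambda>t. d 0 t * ?\<psi> t * ?\<psi> t0) = 0" by simp
      then have int0: "integral {a..b} ?f = 0" by (simp add: mult.assoc)
      have fc: "continuous_on {a..b} ?f"
        by (intro continuous_intros continuous_on_subset[OF dc] continuous_on_subset[OF \<psi>c]) (use abJ in auto)
      have nn: "?f t \<ge> 0" if "t \<in> {a..b}" for t
      proof -
        have "?\<psi> t * ?\<psi> t0 > 0" using U' that abU by blast
        moreover have "d 0 t \<ge> 0" using d(2)[of t] d(3)[of t] by (cases "t \<in> {a<..<b}") auto
        ultimately show ?thesis by simp
      qed
      have "?f t0 = 0"
        using integral_eq_0_iff[OF fc ab] nn int0 r(1) by (auto simp: a_def b_def)
      moreover have "d 0 t0 > 0" using d(2)[of t0] r(1) by (simp add: a_def b_def)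
      ultimately show False using \<open>?\<psi> t0 \<noteq> 0\<close> by simp
    qed
    then have "?X t0 = 0" by (rule ip_nondegenerate[OF pf(1)[OF t0] XE[OF t0]])
    then show "qt t0 = rhs (g t0) (gt t0)" by (auto simp: fun_eq_iff)
  qed
qed

text \<open>The two forms of the equation differ by the product rule
  \<open>(P\<^sub>g g\<^sub>t)\<^sub>t = (D\<^sub>(\<^sub>g\<^sub>,\<^sub>g\<^sub>t\<^sub>)P) g\<^sub>t + P\<^sub>g g\<^sub>t\<^sub>t\<close>.\<close>

lemma momentum_iff_acceleration:
  assumes J: "open J" and path: "smooth_metric_path A J g"
    and gt: "gt = tvs_deriv TT g" and gtt: "gtt = tvs_deriv TT gt"
    and q: "q = (\<lambda>t. P (g t) (gt t))" and qt: "qt = tvs_deriv TT q" and t: "t \<in> J"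
  shows "qt t = rhs (g t) (gt t) \<longleftrightarrow>
    gtt t = inv_into E (P (g t)) (rhs (g t) (gt t) - D_operator A P (g t) (gt t) (gt t))"
proof -
  note pf = path_facts[OF J path gt gtt q qt t]
  let ?Y = "rhs (g t) (gt t) - D_operator A P (g t) (gt t) (gt t)"
  have YE: "?Y \<in> E" by (intro E_minus rhs_E D_operator_E pf)
  note bij = P_bij[OF pf(1)]
  have "qt t = rhs (g t) (gt t) \<longleftrightarrow> P (g t) (gtt t) = ?Y"
    unfolding pf(7) by (auto simp: algebra_simps)
  also have "\<dots> \<longleftrightarrow> gtt t = inv_into E (P (g t)) ?Y"
  proof
    show "gtt t = inv_into E (P (g t)) ?Y" if "P (g t) (gtt t) = ?Y"
      using bij_betw_inv_into_left[OF bij pf(3)] that by simp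
    show "P (g t) (gtt t) = ?Y" if "gtt t = inv_into E (P (g t)) ?Y"
      using bij_betw_inv_into_right[OF bij YE] that by simp
  qed
  finally show ?thesis .
qed

end


theorem mainTheorem2:
  fixes A :: "('a::t2_space, 'n::finite) chart set"
    and p :: real
    and P :: "('a, 'n) tensor_field \<Rightarrow> ('a, 'n) tensor_field \<Rightarrow> ('a, 'n) tensor_field"
    and Adj :: "('a, 'n) tensor_field \<Rightarrow> ('a, 'n) tensor_field \<Rightarrow> ('a, 'n) tensor_field
                  \<Rightarrow> ('a, 'n) tensor_field"
    and J :: "real set"
    and g g\<^sub>t g\<^sub>t\<^sub>t q q\<^sub>t :: "real \<Rightarrow> ('a, 'n) tensor_field"
  assumes manifold: "compact_smooth_manifold A"
    and P: "admissible_operator_family A (2 * p) P"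
    and adjoint: "is_adjoint_of_D A P Adj"
    and adjoint_smooth:
      "tvs_smooth
         (prod_topology (tensor_topology A) (prod_topology (tensor_topology A) (tensor_topology A)))
         (metrics A \<times> sym_tensor_fields A \<times> sym_tensor_fields A)
         (tensor_topology A) (\<lambda>(g, h, k). Adj g h k)"
    and adjoint_bilinear:
      "\<forall>g\<in>metrics A.
         (\<forall>k\<in>sym_tensor_fields A. linear_on_subspace (sym_tensor_fields A) (\<lambda>h. Adj g h k)) \<and>
         (\<forall>h\<in>sym_tensor_fields A. linear_on_subspace (sym_tensor_fields A) (Adj g h))"
    and J: "open J" "is_interval J"
    and path: "smooth_metric_path A J g"
    and g\<^sub>t: "g\<^sub>t = tvs_deriv (tensor_topology A) g"
    and g\<^sub>t\<^sub>t: "g\<^sub>t\<^sub>t = tvs_deriv (tensor_topology A) g\<^sub>t"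
    and q: "q = (\<lambda>t. P (g t) (g\<^sub>t t))"
    and q\<^sub>t: "q\<^sub>t = tvs_deriv (tensor_topology A) q"
  shows "(is_geodesic A (metric_GP A P) J g \<longleftrightarrow>
           (\<forall>t\<in>J. g\<^sub>t\<^sub>t t =
              inv_into (sym_tensor_fields A) (P (g t))
                (\<lambda>x. (1/2) *\<^sub>R Adj (g t) (g\<^sub>t t) (g\<^sub>t t) x
                    + (1/4 * trace (matrix_inv (g t x) ** q t x ** matrix_inv (g t x) ** g\<^sub>t t x))
                        *\<^sub>R g t x
                    + (1/2) *\<^sub>R (g\<^sub>t t x ** matrix_inv (g t x) ** q t x)
                    + (1/2) *\<^sub>R (q t x ** matrix_inv (g t x) ** g\<^sub>t t x)
                    - D_operator A P (g t) (g\<^sub>t t) (g\<^sub>t t) x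
                    - (1/2 * trace (matrix_inv (g t x) ** g\<^sub>t t x)) *\<^sub>R q t x)))
       \<and> (is_geodesic A (metric_GP A P) J g \<longleftrightarrow>
           (\<forall>t\<in>J. q\<^sub>t t =
                (\<lambda>x. (1/2) *\<^sub>R Adj (g t) (g\<^sub>t t) (g\<^sub>t t) x
                    + (1/4 * trace (matrix_inv (g t x) ** q t x ** matrix_inv (g t x) ** g\<^sub>t t x))
                        *\<^sub>R g t x
                    + (1/2) *\<^sub>R (g\<^sub>t t x ** matrix_inv (g t x) ** q t x)
                    + (1/2) *\<^sub>R (q t x ** matrix_inv (g t x) ** g\<^sub>t t x)
                    - (1/2 * trace (matrix_inv (g t x) ** g\<^sub>t t x)) *\<^sub>R q t x)))"
proof -
  interpret geodesic_setting A "2 * p" P Adj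
    by unfold_locales (rule manifold P adjoint adjoint_smooth)+
  have momentum: "is_geodesic A (metric_GP A P) J g \<longleftrightarrow> (\<forall>t\<in>J. q\<^sub>t t = rhs (g t) (g\<^sub>t t))"
    by (rule geodesic_iff_momentum[OF J(1) path g\<^sub>t q q\<^sub>t])
  have acceleration: "q\<^sub>t t = rhs (g t) (g\<^sub>t t) \<longleftrightarrow>
      g\<^sub>t\<^sub>t t = inv_into E (P (g t)) (rhs (g t) (g\<^sub>t t) - D_operator A P (g t) (g\<^sub>t t) (g\<^sub>t t))" if "t \<in> J" for t
    by (rule momentum_iff_acceleration[OF J(1) path g\<^sub>t g\<^sub>t\<^sub>t q q\<^sub>t that])
  have rhs_q: "rhs (g t) (g\<^sub>t t) =
      (\<lambda>x. (1/2) *\<^sub>R Adj (g t) (g\<^sub>t t) (g\<^sub>t t) x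
          + (1/4 * trace (matrix_inv (g t x) ** q t x ** matrix_inv (g t x) ** g\<^sub>t t x)) *\<^sub>R g t x
          + (1/2) *\<^sub>R (g\<^sub>t t x ** matrix_inv (g t x) ** q t x)
          + (1/2) *\<^sub>R (q t x ** matrix_inv (g t x) ** g\<^sub>t t x)
          - (1/2 * trace (matrix_inv (g t x) ** g\<^sub>t t x)) *\<^sub>R q t x)" for t
    unfolding rhs_def q by (rule refl)
  have "rhs (g t) (g\<^sub>t t) - D_operator A P (g t) (g\<^sub>t t) (g\<^sub>t t) =
      (\<lambda>x. (1/2) *\<^sub>R Adj (g t) (g\<^sub>t t) (g\<^sub>t t) x
          + (1/4 * trace (matrix_inv (g t x) ** q t x ** matrix_inv (g t x) ** g\<^sub>t t x)) *\<^sub>R g t x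
          + (1/2) *\<^sub>R (g\<^sub>t t x ** matrix_inv (g t x) ** q t x)
          + (1/2) *\<^sub>R (q t x ** matrix_inv (g t x) ** g\<^sub>t t x)
          - D_operator A P (g t) (g\<^sub>t t) (g\<^sub>t t) x
          - (1/2 * trace (matrix_inv (g t x) ** g\<^sub>t t x)) *\<^sub>R q t x)" for t
    unfolding rhs_q by (rule ext) (simp add: algebra_simps)
  then show ?thesis
    using momentum acceleration unfolding rhs_q by simp
qed

end
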